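(* There is no computable function which bounds the Heesch number for tilings of the hyperbolic plane. Precisely: there is no computable function $f$ such that, for every finite set $S$ of labelled prototiles (copies of the regular heptagon of $\{7,3\}$ with edge labels from a finite alphabet) which does not tile the hyperbolic plane, the Heesch number of $S$ is at most $f(S)$.
   Context: A finite set $S$ of prototiles tiles the hyperbolic plane if there is a tiling of the hyperbolic plane by copies of elements of $S$ in which tiles sharing an edge carry matching labels on that edge. The tiles are regular heptagons with interior angles $\frac{2\pi}{3}$, as in the tessellation $\{7,3\}$. A corona around a finite patch of tiles is a layer of tiles of $S$ surrounding it, all edge-matching conditions being respected. The Heesch number of $S$ is the maximum number $k$ of successive coronas that can be formed with tiles of $S$ around a disc (starting from a single tile), i.e. the largest $k$ such that some tile can be surrounded by $k$ nested coronas. *)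

theory Defs
  imports Complex_Main "HOL-Library.Nat_Bijection" "HOL-Library.Extended_Nat"
begin

datatype recf = Zr | Sc | Id nat | Cn recf "recf list" | Pr recf recf | Mn recf

inductive eval :: "recf \<Rightarrow> nat list \<Rightarrow> nat \<Rightarrow> bool" where
  ev_Z:  "eval Zr xs 0"
| ev_S:  "eval Sc (x # xs) (Suc x)"
| ev_Id: "i < length xs \<Longrightarrow> eval (Id i) xs (xs ! i)"
| ev_Cn: "list_all2 (\<lambda>g y. eval g xs y) gs ys \<Longrightarrow> eval f ys z \<Longrightarrow> eval (Cn f gs) xs z"
| ev_Pr0: "eval f xs y \<Longrightarrow> eval (Pr f g) (0 # xs) y"
| ev_PrS: "eval (Pr f g) (n # xs) y \<Longrightarrow> eval g (n # y # xs) z \<Longrightarrow> eval (Pr f g) (Suc n # xs) z"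
| ev_Mn: "eval f (n # xs) 0 \<Longrightarrow> (\<forall>m<n. \<exists>y. 0 < y \<and> eval f (m # xs) y) \<Longrightarrow> eval (Mn f) xs n"

definition computable :: "(nat \<Rightarrow> nat) \<Rightarrow> bool" where
  "computable h \<longleftrightarrow> (\<exists>r. \<forall>n. eval r [n] (h n))"

text \<open>A prototile: the 7 edge labels (natural numbers) of a regular heptagon, listed
  counterclockwise. A finite set of prototiles is encoded by listing it.\<close>

definition prototile :: "nat list \<Rightarrow> bool" where
  "prototile t \<longleftrightarrow> length t = 7"

definition encode_tiles :: "nat list list \<Rightarrow> nat" where
  "encode_tiles ts = list_encode (map list_encode ts)"

definition computable_on_tilesets :: "(nat list set \<Rightarrow> nat) \<Rightarrow> bool" where
  "computable_on_tilesets f \<longleftrightarrow>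
     (\<exists>h. computable h \<and> (\<forall>ts. (\<forall>t\<in>set ts. prototile t) \<longrightarrow> h (encode_tiles ts) = f (set ts)))"

definition copies :: "nat list set \<Rightarrow> nat list set" where
  "copies S = {rotate k t | k t. t \<in> S} \<union> {rotate k (rev t) | k t. t \<in> S}"

section \<open>The tessellation {7,3} in the Poincare disk\<close>

definition hp :: real where
  "hp = sqrt (1 - 4 * (sin (pi / 7))\<^sup>2) / (1 + 2 * sin (pi / 7))"

definition rot7 :: "complex \<Rightarrow> complex" where
  "rot7 z = cis (2 * pi / 7) * z"

text \<open>half-turn about the midpoint of an edge of the base heptagon (at disk coordinate hp)\<close>
definition halfturn :: "complex \<Rightarrow> complex" where
  "halfturn z = (2 * of_real hp - (1 + of_real hp ^ 2) * z) / ((1 + of_real hp ^ 2) - 2 * of_real hp * z)"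

text \<open>The rotation symmetry group of the tessellation {7,3}.\<close>
inductive_set symgrp :: "(complex \<Rightarrow> complex) set" where
  "id \<in> symgrp"
| "g \<in> symgrp \<Longrightarrow> g \<circ> rot7 \<in> symgrp"
| "g \<in> symgrp \<Longrightarrow> g \<circ> halfturn \<in> symgrp"

text \<open>Faces are identified with their centres.\<close>
definition centers :: "complex set" where
  "centers = {g 0 | g. g \<in> symgrp}"

text \<open>Centres of the 7 neighbours of the face g(0), in counterclockwise order.\<close>
definition face_nbrs :: "(complex \<Rightarrow> complex) \<Rightarrow> complex list" where
  "face_nbrs g = map (\<lambda>i. g ((rot7 ^^ i) (halfturn 0))) [0..<7]"

definition adjacent :: "complex \<Rightarrow> complex \<Rightarrow> bool" where
  "adjacent c c' \<longleftrightarrow> (\<exists>g\<in>symgrp. g 0 = c \<and> c' \<in> set (face_nbrs g))"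

text \<open>Faces within k steps of the base face (the base tile and its first k coronas).\<close>
fun ball :: "nat \<Rightarrow> complex set" where
  "ball 0 = {0}"
| "ball (Suc k) = ball k \<union> {c'. \<exists>c\<in>ball k. adjacent c c'}"

text \<open>L c c' is the label which the tile on face c carries on its edge shared with face c'.
  A valid labelled patch on the faces F: each face carries a copy of a prototile, and tiles on
  adjacent faces carry equal labels on their common edge.\<close>
definition valid_patch :: "nat list set \<Rightarrow> complex set \<Rightarrow> (complex \<Rightarrow> complex \<Rightarrow> nat) \<Rightarrow> bool" where
  "valid_patch S F L \<longleftrightarrow>
     (\<forall>c\<in>F. \<exists>g\<in>symgrp. g 0 = c \<and> map (L c) (face_nbrs g) \<in> copies S) \<and>
     (\<forall>c\<in>F. \<forall>c'\<in>F. adjacent c c' \<longrightarrow> L c c' = L c' c)"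

definition tiles_plane :: "nat list set \<Rightarrow> bool" where
  "tiles_plane S \<longleftrightarrow> (\<exists>L. valid_patch S centers L)"

definition surroundable :: "nat list set \<Rightarrow> nat \<Rightarrow> bool" where
  "surroundable S k \<longleftrightarrow> (\<exists>L. valid_patch S (ball k) L)"

definition heesch_number :: "nat list set \<Rightarrow> enat" where
  "heesch_number S = Sup {enat k | k. surroundable S k}"

end

theory Submission
  imports Defs "HOL-Library.Countable" "HOL-Library.Diagonal_Subsequence"
begin

text \<open>
  The faces of the tessellation are arranged in rows, a face having two or three children in the
  next row, so that from one row to the next all lengths grow by the square \<open>lam\<close> of the golden
  ratio. As in Kari's construction, the labels of a row spell Beatty sequences of a real vector and
  neighbouring rows are related by affine constraints. Encoding stacks as points of a Cantor set in
  \<open>[0, 1]\<close>, a tile set simulates a stack machine from an arbitrary configuration: it tiles the plane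
  only if the machine has an infinite run, and a long finite run yields a large patch. The
  machine is a variant of Hooper's. It runs a counter program on an input \<open>n\<close>, but recursively
  restarts itself before each step, so that it has no infinite run from any configuration if the
  program halts, and yet has a run as long as that of the program. The number \<open>n\<close> only enters the tile
  set through the numbering of the labels. Therefore a program can compute the alleged bound for
  the tile set made from the templates coded by \<open>n\<close>, and run longer than that; taking for \<open>n\<close> the code
  of the templates of this very program gives a contradiction.
\<close>

section \<open>Metric data of the heptagon\<close>

text \<open>No seed tile is prescribed, so a tiling only yields an infinite run from some unknown
  configuration. Halting on proper inputs would therefore prove nothing; the machine must be mortal
  from every configuration. Undecidability of tiling is not formalised: a single tile set that beats
  the alleged bound is enough, and long running times come cheaply, since a counter grows by at most
  one per step. Two features of tilings shape the geometric half. Copies may be rotated and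
  reflected independently, so the labels must force the descendants of a face to agree with it in
  orientation. And the real vectors are limits of averages over longer and longer segments of single
  rows, where only the two carries at the ends disturb the constraints; such averages are meaningful
  up to scale only, so one coordinate serves as unit. For the converse only balls must be filled,
  which a finite run, one configuration per row, achieves.\<close>

definition nbr_dist :: real where
  "nbr_dist = sqrt (2 * cos (2 * pi / 7) - 1)"

lemma sin_pi_7: "0 < sin (pi / 7)" "sin (pi / 7) < 1 / 2"
proof -
  show "0 < sin (pi / 7)" by (intro sin_gt_zero) auto
  have "sin (pi / 7) < sin (pi / 6)" by (rule sin_monotone_2pi) (use pi_gt_zero in linarith)+
  then show "sin (pi / 7) < 1 / 2" by (simp add: sin_30)
qed

lemma cos_2pi_7: "1 / 2 < cos (2 * pi / 7)" "cos (2 * pi / 7) < 3 / 4"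
proof -
  have "cos (pi / 3) < cos (2 * pi / 7)" by (rule cos_monotone_0_pi) (use pi_gt_zero in linarith)+
  then show "1 / 2 < cos (2 * pi / 7)" by (simp add: cos_60)
  have "cos (2 * pi / 7) < cos (pi / 4)" by (rule cos_monotone_0_pi) (use pi_gt_zero in linarith)+
  moreover have "sqrt 2 < 3 / 2" by (rule real_less_lsqrt) (auto simp: power2_eq_square)
  ultimately show "cos (2 * pi / 7) < 3 / 4" by (simp add: cos_45)
qed

lemma nbr_dist: "0 < nbr_dist" "nbr_dist < 1" "nbr_dist\<^sup>2 = 2 * cos (2 * pi / 7) - 1" "nbr_dist\<^sup>2 < 1 / 2"
proof -
  show sq: "nbr_dist\<^sup>2 = 2 * cos (2 * pi / 7) - 1" and "0 < nbr_dist"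
    using cos_2pi_7 by (auto simp: nbr_dist_def)
  then show "nbr_dist\<^sup>2 < 1 / 2" using cos_2pi_7 by simp
  then show "nbr_dist < 1" using \<open>0 < nbr_dist\<close>
    by (intro power2_less_imp_less[of nbr_dist 1]) auto
qed

abbreviation (input) "nd \<equiv> complex_of_real nbr_dist"
definition w7 :: complex where "w7 = cis (2 * pi / 7)"

text \<open>Doubling of the hyperbolic distance from the centre to an edge midpoint:
  \<open>nbr_dist\<close> is \<open>halfturn 0\<close>, the disk coordinate of a neighbouring
  centre. With it the half-turn takes the simple form of \<open>halfturn_eq\<close>.\<close>

lemma hp_eq: "2 * hp = nbr_dist * (1 + hp\<^sup>2)"
proof -
  let ?s = "sin (pi / 7)"
  have nd: "cos (2 * pi / 7) = 1 - 2 * ?s\<^sup>2" using cos_double_sin[of "pi / 7"] by simp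
  have n: "nbr_dist = sqrt (1 - 4 * ?s\<^sup>2)" unfolding nbr_dist_def nd by (simp add: algebra_simps)
  have pos: "0 < 1 - 4 * ?s\<^sup>2" 
    using nbr_dist(1) unfolding n by simp
  have "hp * (1 + 2 * ?s) = nbr_dist" unfolding hp_def n using sin_pi_7 by simp
  moreover have "(1 + hp\<^sup>2) * (1 + 2 * ?s) = 2"
  proof -
    have "hp\<^sup>2 = (1 - 4 * ?s\<^sup>2) / (1 + 2 * ?s)\<^sup>2" unfolding hp_def using pos by (simp add: power_divide)
    also have "\<dots> = (1 - 2 * ?s) / (1 + 2 * ?s)"
      using sin_pi_7 by (simp add: divide_simps) (simp add: power2_eq_square algebra_simps)
    finally show ?thesis using sin_pi_7 by (simp add: field_simps)
  qed
  ultimately have "2 * hp * (1 + 2 * ?s) = nbr_dist * (1 + hp\<^sup>2) * (1 + 2 * ?s)" by (simp add: mult.assoc)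
  then show ?thesis using sin_pi_7 by simp
qed

lemma halfturn_eq: "halfturn z = (nd - z) / (1 - nd * z)"
proof -
  let ?k = "1 + complex_of_real hp ^ 2"
  have k: "?k \<noteq> 0" using of_real_eq_0_iff[of "1 + hp\<^sup>2"] by (smt (verit) of_real_1 of_real_add of_real_power zero_le_power2)
  have h: "2 * complex_of_real hp = nd * ?k" using arg_cong[OF hp_eq, of complex_of_real] by simp
  have "halfturn z = (?k * (nd - z)) / (?k * (1 - nd * z))"
    unfolding halfturn_def h by (simp add: algebra_simps)
  then show ?thesis using k by simp
qed

lemma c_sq: "nd * nd = w7 + inverse w7 - 1"
proof -
  have "w7 + inverse w7 = 2 * cos (2 * pi / 7)"
    unfolding w7_def by (simp add: cis_inverse complex_eq_iff)
  moreover have "nd * nd = complex_of_real (nbr_dist\<^sup>2)" by (simp add: power2_eq_square)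
  ultimately show ?thesis using nbr_dist(3) by simp
qed

lemma w7_pow: "w7 ^ 7 = 1" "w7 \<noteq> 0" "cmod w7 = 1"
  by (auto simp: w7_def DeMoivre)

lemma rot7_eq: "rot7 z = w7 * z" by (simp add: rot7_def w7_def)

lemma rot7_pow: "(rot7 ^^ i) z = w7 ^ i * z"
  by (induction i) (auto simp: rot7_eq)

text \<open>The closed disk is taken because half-turns are later applied to points
  \<open>cis x\<close> at infinity.\<close>

lemma den_nz: "cmod z \<le> 1 \<Longrightarrow> 1 - nd * z \<noteq> 0"
proof
  assume "cmod z \<le> 1" "1 - nd * z = 0"
  then have "cmod (nd * z) = 1" by (metis eq_iff_diff_eq_0 norm_one)
  moreover have "cmod (nd * z) \<le> nbr_dist * 1" unfolding norm_mult using \<open>cmod z \<le> 1\<close> nbr_dist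
    by (intro mult_mono) auto
  ultimately show False using nbr_dist by simp
qed

lemma norm_halfturn: "cmod z < 1 \<Longrightarrow> cmod (halfturn z) < 1"
proof -
  assume z: "cmod z < 1"
  have "(cmod (1 - nd * z))\<^sup>2 - (cmod (nd - z))\<^sup>2 = (1 - nbr_dist\<^sup>2) * (1 - (cmod z)\<^sup>2)"
    unfolding cmod_power2 by (simp add: algebra_simps power2_eq_square)
  moreover have "0 < (1 - nbr_dist\<^sup>2) * (1 - (cmod z)\<^sup>2)"
    using z nbr_dist by (intro mult_pos_pos) (auto simp: abs_square_less_1)
  ultimately have "(cmod (nd - z))\<^sup>2 < (cmod (1 - nd * z))\<^sup>2" by simp
  then have "cmod (nd - z) < cmod (1 - nd * z)" by (rule power2_less_imp_less) simp
  then show ?thesis using den_nz[of z] z unfolding halfturn_eq norm_divide by (simp add: divide_simps)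
qed

lemma halfturn_halfturn: "cmod z < 1 \<Longrightarrow> halfturn (halfturn z) = z"
proof -
  assume z: "cmod z < 1"
  have n: "1 - nd * z \<noteq> 0" using den_nz[of z] z by simp
  have m: "1 - nd * nd \<noteq> 0" using den_nz[of nd] nbr_dist by simp
  have a: "nd - halfturn z = (1 - nd * nd) * z / (1 - nd * z)"
    unfolding halfturn_eq using n by (simp add: divide_simps) (simp add: algebra_simps)
  have b: "1 - nd * halfturn z = (1 - nd * nd) / (1 - nd * z)"
    unfolding halfturn_eq using n by (simp add: divide_simps) (simp add: algebra_simps)
  have "halfturn (halfturn z) = ((1 - nd * nd) * z / (1 - nd * z)) / ((1 - nd * nd) / (1 - nd * z))"
    unfolding halfturn_eq[of "halfturn z"] a b ..
  also have "\<dots> = z" using n m by simp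
  finally show ?thesis .
qed

text \<open>Three heptagons meet at each vertex, so turning by one edge and crossing has order 3.
  This is where the exact value of \<open>nbr_dist\<close> enters, through
  \<open>c_sq\<close>.\<close>

lemma triangle_relation:
  assumes z: "cmod z < 1"
  shows "halfturn (rot7 (halfturn z)) = inverse w7 * halfturn (inverse w7 * z)"
proof -
  let ?v = "inverse w7"
  have n: "1 - nd * z \<noteq> 0" using den_nz[of z] z by simp
  have n2: "1 - nd * (?v * z) \<noteq> 0" using den_nz[of "?v * z"] z w7_pow by (simp add: norm_mult norm_inverse)
  have "cmod (rot7 (halfturn z)) < 1" using norm_halfturn[OF z] w7_pow by (simp add: rot7_eq norm_mult)
  then have n3: "1 - nd * (w7 * ((nd - z) / (1 - nd * z))) \<noteq> 0"
    using den_nz[of "rot7 (halfturn z)"] by (simp add: rot7_eq halfturn_eq)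
  have v: "w7 * ?v = 1" using w7_pow by simp
  have e1: "nd * (1 - nd * z) - w7 * (nd - z) = (1 - w7) * nd + (1 - ?v) * z"
  proof -
    have "nd * (1 - nd * z) - w7 * (nd - z) = nd - (nd * nd) * z - w7 * nd + w7 * z" by (simp add: algebra_simps)
    also have "\<dots> = (1 - w7) * nd + (1 - ?v) * z" unfolding c_sq by (simp add: algebra_simps)
    finally show ?thesis .
  qed
  have e2: "(1 - nd * z) - nd * (w7 * (nd - z)) = (1 - w7) * w7 + (w7 - 1) * (nd * z)"
  proof -
    have "(1 - nd * z) - nd * (w7 * (nd - z)) = 1 - nd * z - w7 * (nd * nd) + w7 * nd * z" by (simp add: algebra_simps)
    also have "\<dots> = (1 - w7) * w7 + (w7 - 1) * (nd * z) + (1 - w7 * ?v)" unfolding c_sq by (simp add: algebra_simps)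
    finally show ?thesis using v by simp
  qed
  have "halfturn (rot7 (halfturn z)) = (nd - w7 * ((nd - z) / (1 - nd * z))) / (1 - nd * (w7 * ((nd - z) / (1 - nd * z))))"
    by (simp add: halfturn_eq rot7_eq)
  also have "\<dots> = (nd * (1 - nd * z) - w7 * (nd - z)) / ((1 - nd * z) - nd * (w7 * (nd - z)))"
    using n n3 by (simp add: divide_simps)
  also have "\<dots> = ((1 - w7) * nd + (1 - ?v) * z) / ((1 - w7) * w7 + (w7 - 1) * (nd * z))" unfolding e1 e2 ..
  also have "\<dots> = ?v * ((nd - ?v * z) / (1 - nd * (?v * z)))"
  proof -
    \<comment> \<open>Numerator and denominator have the common factor \<open>1 - w7\<close>, which
      is to be cancelled.\<close>
    have ne: "w7 \<noteq> 1" 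
    proof
      assume "w7 = 1"
      then have "Re w7 = 1" by simp
      then show False using cos_2pi_7 by (simp add: w7_def)
    qed
    have a: "(1 - w7) * nd + (1 - ?v) * z = (1 - w7) * (nd - ?v * z)"
      using v by (simp add: algebra_simps)
    have b: "(1 - w7) * w7 + (w7 - 1) * (nd * z) = (1 - w7) * w7 * (1 - nd * (?v * z))"
    proof -
      have "(1 - w7) * w7 * (1 - nd * (?v * z)) = (1 - w7) * w7 - (1 - w7) * (w7 * ?v) * (nd * z)"
        by (simp add: algebra_simps)
      then show ?thesis unfolding v by (simp add: algebra_simps)
    qed
    show ?thesis unfolding a b using ne w7_pow n2 by (simp add: divide_simps)
  qed
  finally show ?thesis by (simp add: halfturn_eq)
qed

section \<open>Frames\<close>

text \<open>Identities of motions fail at the pole of the half-turn, where division yields 0.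
  Cutting off outside the open disk turns them into equalities of functions.\<close>

definition on_disk :: "(complex \<Rightarrow> complex) \<Rightarrow> complex \<Rightarrow> complex" where
  "on_disk g z = (if cmod z < 1 then g z else 0)"

text \<open>Composition on the right: \<open>al\<close> turns a frame by one edge of its own face,
  \<open>be\<close> passes to the face across edge 0.\<close>

definition al :: "(complex \<Rightarrow> complex) \<Rightarrow> complex \<Rightarrow> complex" where "al g = on_disk (g \<circ> rot7)"
definition be :: "(complex \<Rightarrow> complex) \<Rightarrow> complex \<Rightarrow> complex" where "be g = on_disk (g \<circ> halfturn)"
definition frames :: "(complex \<Rightarrow> complex) set" where "frames = on_disk ` symgrp"

lemma norm_rot7 [simp]: "cmod (rot7 z) = cmod z"
  by (simp add: rot7_eq norm_mult w7_pow)

lemma al_apply: "cmod z < 1 \<Longrightarrow> al g z = g (w7 * z)"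
  by (simp add: al_def on_disk_def rot7_eq)

lemma be_apply: "cmod z < 1 \<Longrightarrow> be g z = g (halfturn z)"
  by (simp add: be_def on_disk_def)

lemma al_pow_apply: "cmod z < 1 \<Longrightarrow> (al ^^ i) g z = g (w7 ^ i * z)"
  by (induction i arbitrary: z) (auto simp: al_apply norm_mult norm_power w7_pow mult.assoc mult.left_commute power_commutes)

lemma al_on_disk: "al (on_disk g) = on_disk (g \<circ> rot7)"
  by (auto simp: al_def on_disk_def fun_eq_iff)

lemma be_on_disk: "be (on_disk g) = on_disk (g \<circ> halfturn)"
  by (auto simp: be_def on_disk_def fun_eq_iff norm_halfturn)

lemma frames_al [intro]: "g \<in> frames \<Longrightarrow> al g \<in> frames"
  unfolding frames_def by (auto simp: al_on_disk intro: symgrp.intros)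

lemma frames_be [intro]: "g \<in> frames \<Longrightarrow> be g \<in> frames"
  unfolding frames_def by (auto simp: be_on_disk intro: symgrp.intros)

lemma frames_al_pow [intro]: "g \<in> frames \<Longrightarrow> (al ^^ i) g \<in> frames"
  by (induction i) auto

lemma frames_id: "on_disk id \<in> frames"
  unfolding frames_def by (auto intro: symgrp.intros)

lemma frame_outside: "g \<in> frames \<Longrightarrow> \<not> cmod z < 1 \<Longrightarrow> g z = 0"
  by (auto simp: frames_def on_disk_def)

lemma frame_eqI: "g \<in> frames \<Longrightarrow> h \<in> frames \<Longrightarrow> (\<And>z. cmod z < 1 \<Longrightarrow> g z = h z) \<Longrightarrow> g = h"
  by (metis ext frame_outside)

lemma al_7: "g \<in> frames \<Longrightarrow> (al ^^ 7) g = g"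
  by (intro frame_eqI) (auto simp: al_pow_apply w7_pow)

lemma be_be: "g \<in> frames \<Longrightarrow> be (be g) = g"
  by (intro frame_eqI) (auto simp: be_apply norm_halfturn halfturn_halfturn)

lemma be_al_be: "g \<in> frames \<Longrightarrow> be (al (be g)) = (al ^^ 6) (be ((al ^^ 6) g))"
proof (intro frame_eqI)
  fix z assume g: "g \<in> frames" and z: "cmod z < 1"
  have w6: "w7 ^ 6 = inverse w7"
  proof -
    have "w7 ^ 6 * w7 = 1" using w7_pow(1) power_Suc2[of w7 6] by simp
    then show ?thesis by (metis inverse_unique mult.commute)
  qed
  have n: "cmod (inverse w7 * z) < 1" using z by (simp add: norm_mult norm_inverse w7_pow)
  then have n2: "cmod (halfturn (inverse w7 * z)) < 1" by (rule norm_halfturn)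
  show "be (al (be g)) z = (al ^^ 6) (be ((al ^^ 6) g)) z"
    using z n n2 triangle_relation[OF z]
    by (simp add: be_apply al_apply norm_halfturn al_pow_apply w6 norm_mult w7_pow rot7_eq)
qed auto

lemma frame_inj:
  assumes "g \<in> frames" "cmod z < 1" "cmod z' < 1" "g z = g z'"
  shows "z = z'"
proof -
  obtain h where h: "h \<in> symgrp" "g = on_disk h" using assms by (auto simp: frames_def)
  then have "h z = h z'" using assms by (simp add: on_disk_def)
  from h(1) this assms(2,3) show ?thesis
  proof (induction arbitrary: z z')
    case (2 g)
    then have "rot7 z = rot7 z'" by simp
    then show ?case using w7_pow by (simp add: rot7_eq)
  next
    case (3 g)
    then have "halfturn z = halfturn z'" by (simp add: norm_halfturn)
    then show ?case using 3 halfturn_halfturn by metis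
  qed simp
qed

lemma frame_center: "g \<in> symgrp \<Longrightarrow> on_disk g 0 = g 0"
  by (simp add: on_disk_def)

text \<open>The result is a frame of the face across edge \<open>i\<close> whose own edge 0 leads
  back. The turn \<open>A\<close> is a parameter because it will be \<open>al\<close> or its
  inverse.\<close>

definition nbr :: "((complex \<Rightarrow> complex) \<Rightarrow> complex \<Rightarrow> complex) \<Rightarrow> nat \<Rightarrow> (complex \<Rightarrow> complex) \<Rightarrow> complex \<Rightarrow> complex" where
  "nbr A i g = be ((A ^^ i) g)"

abbreviation nb :: "nat \<Rightarrow> (complex \<Rightarrow> complex) \<Rightarrow> complex \<Rightarrow> complex" where "nb \<equiv> nbr al"

lemma frames_nb [intro]: "g \<in> frames \<Longrightarrow> nb i g \<in> frames"
  by (auto simp: nbr_def)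

lemma nb_apply: "cmod z < 1 \<Longrightarrow> nb i g z = g (w7 ^ i * halfturn z)"
  by (simp add: nbr_def be_apply norm_halfturn al_pow_apply)

lemma face_nbrs_frame: "g \<in> symgrp \<Longrightarrow> face_nbrs g = map (\<lambda>i. nb i (on_disk g) 0) [0..<7]"
  by (auto simp: face_nbrs_def nb_apply rot7_pow on_disk_def norm_mult norm_power w7_pow norm_halfturn)

lemma adjacent_frame: "adjacent x y \<longleftrightarrow> (\<exists>g\<in>frames. \<exists>i<7. g 0 = x \<and> y = nb i g 0)"
  unfolding adjacent_def frames_def by (auto simp: face_nbrs_frame frame_center; blast)

text \<open>The relations of the triangle group that involve the turn. They hold for
  \<open>al\<close> and for its inverse, so rows can be built in either orientation, as reflected
  copies require.\<close>

definition rotation :: "((complex \<Rightarrow> complex) \<Rightarrow> complex \<Rightarrow> complex) \<Rightarrow> bool" where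
  "rotation A \<longleftrightarrow> (\<forall>g\<in>frames. A g \<in> frames \<and> (A ^^ 7) g = g \<and> be (A (be g)) = (A ^^ 6) (be ((A ^^ 6) g)))"

lemma rotationD:
  assumes "rotation A" "g \<in> frames"
  shows "A g \<in> frames" "(A ^^ 7) g = g" "be (A (be g)) = (A ^^ 6) (be ((A ^^ 6) g))"
  using assms by (auto simp: rotation_def)

lemma pow_add: "(A ^^ a) ((A ^^ b) g) = (A ^^ (a + b)) g"
  by (simp add: funpow_add)

lemma frames_pow: "rotation A \<Longrightarrow> g \<in> frames \<Longrightarrow> (A ^^ a) g \<in> frames"
  by (induction a) (auto simp: rotationD)

lemma frames_nbr: "rotation A \<Longrightarrow> g \<in> frames \<Longrightarrow> nbr A i g \<in> frames"
  by (auto simp: nbr_def frames_pow)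

lemma pow_mod: "rotation A \<Longrightarrow> g \<in> frames \<Longrightarrow> (A ^^ a) g = (A ^^ (a mod 7)) g"
proof (induction a rule: less_induct)
  case (less a)
  show ?case
  proof (cases "a < 7")
    case False
    then obtain b where b: "a = b + 7" by (metis add.commute le_add_diff_inverse not_less)
    then have "(A ^^ a) g = (A ^^ b) g" using rotationD(2)[OF less.prems] by (simp add: funpow_add)
    then show ?thesis using less.IH[of b] less.prems b by simp
  qed simp
qed

lemma pow_be_pow: "rotation A \<Longrightarrow> g \<in> frames \<Longrightarrow> (A ^^ 6) (be ((A ^^ a) g)) = be (A (be ((A ^^ ((a + 1) mod 7)) g)))"
proof -
  assume g: "rotation A" "g \<in> frames"
  have "(A ^^ 6) ((A ^^ ((a + 1) mod 7)) g) = (A ^^ a) g"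
  proof -
    have "(6 + (a + 1) mod 7) mod 7 = a mod 7" by presburger
    then show ?thesis unfolding pow_add by (metis pow_mod[OF g])
  qed
  then show ?thesis using rotationD(3)[OF g(1), of "(A ^^ ((a + 1) mod 7)) g"] frames_pow[OF g] by simp
qed

lemma rotation_al: "rotation al"
  unfolding rotation_def using al_7 be_al_be by blast

lemma rotation_al_inverse: "rotation (al ^^ 6)"
  unfolding rotation_def
proof (intro ballI conjI)
  fix g assume g: "g \<in> frames"
  have p: "((al ^^ 6) ^^ a) h = (al ^^ (6 * a mod 7)) h" if "h \<in> frames" for a h
    using pow_mod[OF rotation_al that, of "6 * a"] by (simp add: funpow_mult)
  show "(al ^^ 6) g \<in> frames" using g by auto
  show "((al ^^ 6) ^^ 7) g = g" using p[OF g, of 7] by simp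
  have "be (al (be (al g))) = (al ^^ 6) (be ((al ^^ 7) g))"
    using be_al_be[of "al g"] g pow_add[where A = al and a = 6 and b = 1 and g = g] by auto
  then have "be (be (al (be (al g)))) = be ((al ^^ 6) (be g))" using al_7[OF g] by simp
  then have "al (be (al g)) = be ((al ^^ 6) (be g))" using g by (simp add: be_be frames_al frames_be)
  moreover have "((al ^^ 6) ^^ 6) (be (((al ^^ 6) ^^ 6) g)) = al (be (al g))"
    using p[OF g, of 6] p[of "be (al g)" 6] g by (simp add: frames_al frames_be)
  ultimately show "be ((al ^^ 6) (be g)) = ((al ^^ 6) ^^ 6) (be (((al ^^ 6) ^^ 6) g))" by simp
qed

text \<open>Faces of role \<open>P1\<close>, \<open>P2\<close>, \<open>P3\<close> have one neighbour in the previous row. Faces of role \<open>PL\<close> are shared by two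
  adjacent faces of that row and count as last child of the left one. The role \<open>PR\<close> occurs only on
  labels: it marks the edge of such a face with its right parent.\<close>

datatype role = P1 | P2 | P3 | PL | PR

definition is_A :: "role \<Rightarrow> bool" where "is_A r \<longleftrightarrow> r \<in> {P1, P2, P3}"
text \<open>Numbering of the edges: 0 leads to the (left) parent, 1 to the left neighbour, 2 to the
  last child of that neighbour, 3 and on to the own children, then comes the right neighbour; edge 6
  of a face with two parents leads to the right one.\<close>

definition nkids :: "role \<Rightarrow> nat" where "nkids r = (if is_A r then 3 else 2)"
definition kid_role :: "role \<Rightarrow> nat \<Rightarrow> role" where
  "kid_role r j = (if is_A r then [P1, P2, PL] ! j else [P3, PL] ! j)"
text \<open>A face with one parent is followed by the next face around that parent. A face with two
  parents is first turned so that the right parent is used instead.\<close>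

definition right_of :: "((complex \<Rightarrow> complex) \<Rightarrow> complex \<Rightarrow> complex) \<Rightarrow> role \<Rightarrow> (complex \<Rightarrow> complex) \<Rightarrow> complex \<Rightarrow> complex" where
  "right_of A r g = be (A (be (if is_A r then g else (A ^^ 6) g)))"
abbreviation right_frame :: "role \<Rightarrow> (complex \<Rightarrow> complex) \<Rightarrow> complex \<Rightarrow> complex" where "right_frame \<equiv> right_of al"
definition right_index :: "role \<Rightarrow> nat" where "right_index r = (if is_A r then 6 else 5)"

lemma frames_right: "rotation A \<Longrightarrow> g \<in> frames \<Longrightarrow> right_of A r g \<in> frames"
  by (auto simp: right_of_def frames_pow rotationD(1) frames_be)

lemma is_A_simps [simp]: "is_A P1" "is_A P2" "is_A P3" "\<not> is_A PL" "\<not> is_A PR"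
  by (auto simp: is_A_def)

lemma right_of_sibling:
  "rotation A \<Longrightarrow> g \<in> frames \<Longrightarrow> is_A r \<Longrightarrow> right_of A r (nbr A i g) = nbr A (Suc i) g"
  by (simp add: right_of_def nbr_def be_be frames_pow)

text \<open>By the relation at a vertex the same face is reached directly through edge
  \<open>right_index r\<close>, which is edge 1 for the neighbour.\<close>

lemma right_of_alt:
  assumes g: "rotation A" "g \<in> frames"
  shows "right_of A r g = (A ^^ 6) (nbr A (right_index r) g)"
proof (cases "is_A r")
  case False
  have "right_of A r g = (A ^^ 6) (be ((A ^^ 6) ((A ^^ 6) g)))"
    using False rotationD(3)[OF g(1), of "(A ^^ 6) g"] frames_pow[OF g] by (simp add: right_of_def)
  also have "(A ^^ 6) ((A ^^ 6) g) = (A ^^ 5) g"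
    unfolding pow_add by (subst pow_mod[OF g]) simp
  finally show ?thesis using False by (simp add: right_index_def nbr_def)
qed (simp add: right_of_def rotationD(3)[OF g] right_index_def nbr_def)

lemma edge_right:
  assumes g: "rotation A" "g \<in> frames"
  shows "nbr A (right_index r) g = A (right_of A r g)"
  using pow_add[where A = A and a = 1 and b = 6 and g = "nbr A (right_index r) g"] rotationD(2)[OF g(1) frames_nbr[OF g, of "right_index r"]]
  unfolding right_of_alt[OF g] by simp

lemma last_kid_index: "2 + nkids r = right_index r - 1" "right_index r < 7" "0 < nkids r"
  by (auto simp: nkids_def right_index_def)

text \<open>The last child is shared: it lies across edge 2 of the right neighbour and sees that
  second parent across its own edge 6.\<close>

lemma edge_low:
  assumes g: "rotation A" "g \<in> frames"
  shows "nbr A 2 (right_of A r g) = (A ^^ 6) (nbr A (2 + nkids r) g)"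
proof -
  let ?h = "be ((A ^^ right_index r) g)"
  have h: "?h \<in> frames" using g by (auto simp: frames_pow)
  have "nbr A 2 (right_of A r g) = be ((A ^^ 8) ?h)"
    unfolding right_of_alt[OF g] nbr_def pow_add by simp
  also have "(A ^^ 8) ?h = A ?h" by (subst pow_mod[OF g(1) h]) simp
  also have "be (A ?h) = (A ^^ 6) (be ((A ^^ (2 + nkids r)) g))"
    using pow_be_pow[OF g, of "2 + nkids r"] by (auto simp: nkids_def right_index_def)
  finally show ?thesis by (simp add: nbr_def)
qed

text \<open>Around the right neighbour the shared child is followed by the first own child. This
  joins the children of adjacent faces into one row.\<close>

lemma right_of_last:
  assumes g: "rotation A" "g \<in> frames" and r': "\<not> is_A r'"
  shows "right_of A r' (nbr A (2 + nkids r) g) = nbr A 3 (right_of A r g)"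
proof -
  have f: "nbr A (2 + nkids r) g \<in> frames" using frames_nbr[OF g] .
  have "right_of A r' (nbr A (2 + nkids r) g) = be (A (be ((A ^^ 6) (nbr A (2 + nkids r) g))))"
    using r' by (simp add: right_of_def)
  also have "\<dots> = be (A (be (nbr A 2 (right_of A r g))))" by (simp add: edge_low[OF g])
  also have "\<dots> = nbr A 3 (right_of A r g)"
    using g by (simp add: nbr_def be_be rotationD frames_right numeral_3_eq_3 numeral_2_eq_2)
  finally show ?thesis .
qed

section \<open>Lengths and positions of the faces in their rows\<close>

definition gphi :: real where "gphi = (1 + sqrt 5) / 2"

lemma gphi: "gphi * gphi = gphi + 1" "1 < gphi" "gphi < 2"
proof -
  show "gphi * gphi = gphi + 1" by (simp add: gphi_def field_simps)
  show "1 < gphi" by (simp add: gphi_def)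
  have "sqrt 5 < 3" by (rule real_less_lsqrt) auto
  then show "gphi < 2" by (simp add: gphi_def)
qed

text \<open>Replacing faces by children has the matrix with rows (2, 1) and (1, 1). Its largest
  eigenvalue is \<open>lam\<close>, with the lengths \<open>gphi\<close> and 1 as eigenvector, so
  the children of a face fill exactly \<open>lam\<close> times its interval.\<close>

definition lam :: real where "lam = gphi + 1"
definition len :: "role \<Rightarrow> real" where "len r = (if is_A r then gphi else 1)"

text \<open>Every root is the middle child of the next one, so their descendants spread to both
  sides. The position -1 given to all of them is the fixed point of the map p to
  \<open>lam * p + gphi\<close>.\<close>

fun root_frame :: "nat \<Rightarrow> complex \<Rightarrow> complex" where
  "root_frame 0 = on_disk id"
| "root_frame (Suc m) = (al ^^ 3) (be (root_frame m))"

lemma frames_root [intro]: "root_frame m \<in> frames"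
  by (induction m) (auto intro: frames_id)

lemma root_kid: "nb 4 (root_frame (Suc m)) = root_frame m"
proof -
  have f: "be (root_frame m) \<in> frames" by auto
  have "(al ^^ 4) ((al ^^ 3) (be (root_frame m))) = be (root_frame m)"
    unfolding pow_add using al_7[OF f] by simp
  then show ?thesis by (simp add: nbr_def be_be[OF frames_root])
qed

text \<open>\<open>cell t p r g\<close>: the face with frame \<open>g\<close> lies in row \<open>t\<close>, occupies the interval from \<open>p\<close> to \<open>p + len r\<close>
  of that row, and edge 0 of \<open>g\<close> leads to its parent.\<close>

inductive cell :: "int \<Rightarrow> real \<Rightarrow> role \<Rightarrow> (complex \<Rightarrow> complex) \<Rightarrow> bool" where
  root: "cell (- int m) (- 1) P2 (root_frame m)"
| kid: "cell t p r g \<Longrightarrow> j < nkids r \<Longrightarrow> cell (t + 1) (lam * p + j * gphi) (kid_role r j) (nb (3 + j) g)"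

lemma cell_frames: "cell t p r g \<Longrightarrow> g \<in> frames"
  by (induction rule: cell.induct) auto

lemma kid_role_cases:
  assumes "j < nkids r"
  obtains "is_A r" "j = 0" "kid_role r j = P1" | "is_A r" "j = 1" "kid_role r j = P2" | "is_A r" "j = 2" "kid_role r j = PL"
  | "\<not> is_A r" "j = 0" "kid_role r j = P3" | "\<not> is_A r" "j = 1" "kid_role r j = PL"
  using assms by (cases "is_A r"; cases j rule: nat.exhaust; auto simp: nkids_def kid_role_def less_Suc_eq numeral_eq_Suc)

lemma cell_role: "cell t p r g \<Longrightarrow> r \<noteq> PR"
  by (induction rule: cell.induct) (auto elim!: kid_role_cases)

fun succ_role :: "role \<Rightarrow> role set" where
  "succ_role P1 = {P2}" | "succ_role P2 = {PL}" | "succ_role P3 = {PL}" | "succ_role PL = {P1, P3}" | "succ_role PR = {}"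

lemma lam_gphi: "lam * gphi = 2 * gphi + 1" "lam = gphi + 1"
  using gphi by (simp_all add: lam_def algebra_simps)

lemma cell_root_Suc: "cell (- int m - 1) (- 1) P2 (root_frame (Suc m))"
proof -
  have "- int (Suc m) = - int m - 1" by simp
  with cell.root[of "Suc m"] show ?thesis by (simp only:)
qed

lemma cell_parent:
  assumes "cell t p r g"
  shows "\<exists>p' r' g' j. cell (t - 1) p' r' g' \<and> j < nkids r' \<and> p = lam * p' + j * gphi \<and> r = kid_role r' j \<and> g = nb (3 + j) g'"
  using assms
proof cases
  case (root m)
  have "cell (t - 1) (- 1) P2 (root_frame (Suc m))" using cell_root_Suc[of m] root by (simp only:)
  then show ?thesis using root root_kid[of m]
    by (intro exI[of _ "- 1"] exI[of _ P2] exI[of _ "root_frame (Suc m)"] exI[of _ 1]) (auto simp: nkids_def kid_role_def lam_def)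
next
  case (kid t' p' r' g' j)
  then show ?thesis by (intro exI[of _ p'] exI[of _ r'] exI[of _ g'] exI[of _ j]) auto
qed

lemma kid_right:
  assumes nd: "cell t p r g" and j: "Suc j < nkids r"
  shows "right_frame (kid_role r j) (nb (3 + j) g) = nb (3 + Suc j) g" "is_A (kid_role r j)" "kid_role r (Suc j) \<in> succ_role (kid_role r j)"
    "lam * p + j * gphi + len (kid_role r j) = lam * p + Suc j * gphi"
proof -
  have *: "is_A (kid_role r j)" "kid_role r (Suc j) \<in> succ_role (kid_role r j)"
    using j by (auto simp: nkids_def kid_role_def less_Suc_eq numeral_eq_Suc split: if_splits)
  then show "is_A (kid_role r j)" "kid_role r (Suc j) \<in> succ_role (kid_role r j)" by auto
  show "right_frame (kid_role r j) (nb (3 + j) g) = nb (3 + Suc j) g"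
    using right_of_sibling[OF rotation_al cell_frames[OF nd] *(1)] by simp
  show "lam * p + j * gphi + len (kid_role r j) = lam * p + Suc j * gphi"
    using * by (simp add: len_def algebra_simps)
qed

lemma last_kid:
  "lam * p + (nkids r - 1) * gphi + len (kid_role r (nkids r - 1)) = lam * (p + len r)" "kid_role r (nkids r - 1) = PL"
  by (auto simp: nkids_def kid_role_def len_def lam_gphi gphi(1) algebra_simps)

lemma first_kid: "kid_role r 0 = (if is_A r then P1 else P3)"
  by (simp add: kid_role_def)

text \<open>The right neighbour of a last child is the first child of the parent's right neighbour,
  which makes the induction work. A root is treated as the middle child of the next root.\<close>

lemma cell_right:
  assumes "cell t p r g"
  shows "\<exists>r'\<in>succ_role r. cell t (p + len r) r' (right_frame r g)"
  using assms
proof (induction rule: cell.induct)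
  case (root m)
  have nd: "cell (- int m - 1) (- 1) P2 (root_frame (Suc m))" by (rule cell_root_Suc)
  have "cell (- int m - 1 + 1) (lam * - 1 + real 2 * gphi) (kid_role P2 2) (nb (3 + 2) (root_frame (Suc m)))"
    by (rule cell.kid[OF nd]) (simp add: nkids_def)
  moreover have "right_frame P2 (root_frame m) = nb 5 (root_frame (Suc m))"
    using right_of_sibling[OF rotation_al frames_root, of P2 4 "Suc m"] root_kid[of m] by simp
  ultimately show ?case by (simp add: kid_role_def len_def lam_def)
next
  case (kid t p r g j)
  show ?case
  proof (cases "Suc j < nkids r")
    case True
    show ?thesis
      unfolding kid_right(1,4)[OF kid.hyps(1) True]
      using cell.kid[OF kid.hyps(1) True] kid_right(3)[OF kid.hyps(1) True] by blast
  next
    case False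
    then have j: "j = nkids r - 1" "3 + j = 2 + nkids r" using kid.hyps by auto
    obtain r' where r': "r' \<in> succ_role r" "cell t (p + len r) r' (right_frame r g)" using kid.IH by blast
    have "cell (t + 1) (lam * (p + len r) + real 0 * gphi) (kid_role r' 0) (nb (3 + 0) (right_frame r g))"
      using r'(2) by (rule cell.kid) (simp add: nkids_def)
    moreover have "right_frame PL (nb (2 + nkids r) g) = nb 3 (right_frame r g)"
      using right_of_last[OF rotation_al, of g PL] cell_frames[OF kid.hyps(1)] by simp
    moreover have "kid_role r' 0 \<in> succ_role PL" by (auto simp: first_kid)
    ultimately show ?thesis
      using last_kid(1)[where r = r and p = p] last_kid(2)[of r] unfolding j(2) unfolding j(1) by auto
  qed
qed

lemma cell_left:
  assumes "cell t p r g"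
  shows "\<exists>p' r' g'. cell t p' r' g' \<and> p = p' + len r' \<and> g = right_frame r' g' \<and> r \<in> succ_role r'"
  using assms
proof (induction rule: cell.induct)
  case (root m)
  have nd: "cell (- int m - 1) (- 1) P2 (root_frame (Suc m))" by (rule cell_root_Suc)
  have "cell (- int m - 1 + 1) (lam * - 1 + real 0 * gphi) (kid_role P2 0) (nb (3 + 0) (root_frame (Suc m)))"
    by (rule cell.kid[OF nd]) (simp add: nkids_def)
  moreover have "right_frame P1 (nb 3 (root_frame (Suc m))) = root_frame m"
    using right_of_sibling[OF rotation_al frames_root, of P1 3 "Suc m"] root_kid[of m] by simp
  ultimately show ?case
    by (intro exI[of _ "- lam"] exI[of _ P1] exI[of _ "nb 3 (root_frame (Suc m))"])
      (simp add: kid_role_def len_def lam_def)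
next
  case (kid t p r g j)
  show ?case
  proof (cases j)
    case 0
    obtain p' r' g' where l: "cell t p' r' g'" "p = p' + len r'" "g = right_frame r' g'" "r \<in> succ_role r'" using kid.IH by blast
    have nd: "cell (t + 1) (lam * p' + real (nkids r' - 1) * gphi) (kid_role r' (nkids r' - 1)) (nb (3 + (nkids r' - 1)) g')"
      using l(1) by (rule cell.kid) (simp add: nkids_def)
    have e: "3 + (nkids r' - 1) = 2 + nkids r'" by (simp add: nkids_def)
    have "right_frame PL (nb (2 + nkids r') g') = nb 3 g"
      using right_of_last[OF rotation_al, of g' PL r'] cell_frames[OF l(1)] l(3) by simp
    moreover have "kid_role r 0 \<in> succ_role PL" by (auto simp: first_kid)
    ultimately show ?thesis
      using nd last_kid(1)[where r = r' and p = p'] last_kid(2)[of r'] l(2) 0 unfolding e by (metis add_0 add.right_neutral mult_zero_left of_nat_0)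
  next
    case (Suc i)
    then have i: "Suc i < nkids r" "i < nkids r" using kid.hyps by auto
    show ?thesis
      using cell.kid[OF kid.hyps(1) i(2)] kid_right[OF kid.hyps(1) i(1)] Suc by metis
  qed
qed

section \<open>Different cells have different centres\<close>

text \<open>The argument of the fixed point at infinity of the motion to the first child.\<close>

definition chi :: real where "chi = 3 * pi / 7 + arccos (nbr_dist * cos (pi / 7))"

lemma cos_3pi_7: "cos (3 * pi / 7) = nbr_dist\<^sup>2 * cos (pi / 7)"
proof -
  have "cos (3 * pi / 7) + cos (pi / 7) = 2 * cos (2 * pi / 7) * cos (pi / 7)"
    using cos_plus_cos[of "3 * pi / 7" "pi / 7"] by simp
  then show ?thesis unfolding nbr_dist(3) by (simp add: algebra_simps)
qed

lemma cos_pi_7: "0 < cos (pi / 7)" "cos (pi / 7) < 1"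
proof -
  show "0 < cos (pi / 7)" by (rule cos_gt_zero_pi) (use pi_gt_zero in linarith)+
  have "cos (pi / 7) < cos 0" by (rule cos_monotone_0_pi) (use pi_gt_zero in linarith)+
  then show "cos (pi / 7) < 1" by simp
qed

text \<open>The bounds make the directions \<open>ang r\<close> increase (upper bound) while
  spanning less than pi (lower bound).\<close>

lemma chi_bounds: "9 * pi / 14 < chi" "chi < 6 * pi / 7"
  and cos_chi: "cos (chi - 3 * pi / 7) = nbr_dist * cos (pi / 7)"
proof -
  let ?y = "nbr_dist * cos (pi / 7)"
  have y: "0 < ?y" "?y < 1" using nbr_dist cos_pi_7 mult_strict_mono[of nbr_dist 1 "cos (pi / 7)" 1] by auto
  show cc: "cos (chi - 3 * pi / 7) = ?y" using y by (simp add: chi_def)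
  have b: "0 \<le> arccos ?y" "arccos ?y \<le> pi" using y by (auto intro: arccos_lbound arccos_ubound)
  have "?y < cos (3 * pi / 14)"
  proof -
    have "?y < nbr_dist" using nbr_dist cos_pi_7 by simp
    also have "nbr_dist < sqrt (1 / 2)" using nbr_dist by (intro real_less_rsqrt) auto
    also have "\<dots> = cos (pi / 4)" by (simp add: cos_45 real_sqrt_divide field_simps)
    also have "\<dots> < cos (3 * pi / 14)" by (rule cos_monotone_0_pi) (use pi_gt_zero in linarith)+
    finally show ?thesis .
  qed
  then have "cos (arccos ?y) < cos (3 * pi / 14)" using y by simp
  then have "3 * pi / 14 < arccos ?y"
    by (subst (asm) cos_mono_less_eq) (use b pi_gt_zero in \<open>auto\<close>)
  then show "9 * pi / 14 < chi" by (simp add: chi_def)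
  have "cos (3 * pi / 7) < ?y"
  proof -
    have "nbr_dist\<^sup>2 < nbr_dist"
      using nbr_dist(1,2) mult_strict_left_mono[of nbr_dist 1 nbr_dist] by (simp add: power2_eq_square)
    then show ?thesis unfolding cos_3pi_7 using cos_pi_7 by simp
  qed
  then have "cos (3 * pi / 7) < cos (arccos ?y)" using y by simp
  then have "arccos ?y < 3 * pi / 7"
    by (subst (asm) cos_mono_less_eq) (use b pi_gt_zero in \<open>auto\<close>)
  then show "chi < 6 * pi / 7" by (simp add: chi_def)
qed

lemma w7_pow_cis: "w7 ^ n = cis (2 * pi * n / 7)"
  by (simp add: w7_def DeMoivre algebra_simps)

lemma cis_2pi_add: "cis (x + 2 * pi) = cis x"
  by (simp add: complex_eq_iff)

lemma halfturn_cis: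
  assumes "w7 ^ a * (nd - cis x) = y * (1 - nd * cis x)"
  shows "w7 ^ a * halfturn (cis x) = y"
  using assms den_nz[of "cis x"] by (simp add: halfturn_eq divide_simps)

lemma halfturn_chi: "w7 ^ 3 * halfturn (cis chi) = cis chi"
proof (rule halfturn_cis)
  define d where "d = chi - 3 * pi / 7"
  have cd: "cos d * nbr_dist = cos (3 * pi / 7)" unfolding d_def cos_chi cos_3pi_7 by (simp add: power2_eq_square)
  have e: "cis chi = cis (3 * pi / 7) * cis d" by (simp add: cis_mult d_def)
  have s: "cis d + cis (- d) = 2 * cos d" by (simp add: complex_eq_iff)
  have "nd * (cis d + cis (- d)) = complex_of_real (2 * (cos d * nbr_dist))" unfolding s by simp
  also have "\<dots> = cis (3 * pi / 7) + cis (- (3 * pi / 7))" unfolding cd by (simp add: complex_eq_iff)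
  finally have k: "nd * (cis d + cis (- d)) = cis (3 * pi / 7) + cis (- (3 * pi / 7))" .
  have "cis (6 * pi / 7) * cis d * (nd * (cis d + cis (- d))) = cis (6 * pi / 7) * cis d * (cis (3 * pi / 7) + cis (- (3 * pi / 7)))"
    unfolding k ..
  moreover have "cis (6 * pi / 7) * cis d * (cis d + cis (- d)) = cis chi * cis chi + cis (6 * pi / 7)"
    by (simp add: distrib_left mult.assoc cis_mult d_def)
  moreover have "cis (6 * pi / 7) * cis d * (cis (3 * pi / 7) + cis (- (3 * pi / 7))) = cis (6 * pi / 7) * cis chi + cis chi"
    by (simp add: distrib_left mult.assoc cis_mult d_def)
  ultimately have main: "nd * (cis chi * cis chi + cis (6 * pi / 7)) = cis (6 * pi / 7) * cis chi + cis chi"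
    by (metis mult.left_commute)
  have "w7 ^ 3 = cis (6 * pi / 7)" unfolding w7_pow_cis by (simp add: algebra_simps)
  then show "w7 ^ 3 * (nd - cis chi) = cis chi * (1 - nd * cis chi)"
    using main by (simp add: algebra_simps)
qed

text \<open>For a child with one parent: the right boundary direction of its descendants is carried
  to the ray that separates it from its next sibling.\<close>

lemma halfturn_chi_right: "w7 ^ 2 * halfturn (cis (16 * pi / 7 - chi)) = cis chi"
proof (rule halfturn_cis)
  define d where "d = chi - 3 * pi / 7"
  have cd: "cos d = nbr_dist * cos (pi / 7)" unfolding d_def by (rule cos_chi)
  have s: "cis d + cis (- d) = 2 * cos d" by (simp add: complex_eq_iff)
  have s2: "cis (pi / 7) + cis (- (pi / 7)) = 2 * cos (pi / 7)" by (simp add: complex_eq_iff)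
  have k: "cis d + cis (- d) = nd * (cis (pi / 7) + cis (- (pi / 7)))" unfolding s s2 cd by simp
  have per: "cis (16 * pi / 7 - chi) = cis (2 * pi / 7 - chi)"
    using cis_2pi_add[of "2 * pi / 7 - chi"] by (simp add: algebra_simps)
  have "cis (3 * pi / 7) * (cis d + cis (- d)) = cis chi + cis (6 * pi / 7 - chi)"
    by (simp add: distrib_left cis_mult d_def)
  moreover have "cis (3 * pi / 7) * (cis (pi / 7) + cis (- (pi / 7))) = cis (4 * pi / 7) + cis (2 * pi / 7)"
    by (simp add: distrib_left cis_mult)
  ultimately have main: "cis chi + cis (6 * pi / 7 - chi) = nd * (cis (4 * pi / 7) + cis (2 * pi / 7))"
    using k by (metis mult.left_commute)
  have w: "w7 ^ 2 = cis (4 * pi / 7)" unfolding w7_pow_cis by (simp add: algebra_simps)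
  show "w7 ^ 2 * (nd - cis (16 * pi / 7 - chi)) = cis chi * (1 - nd * cis (16 * pi / 7 - chi))"
    unfolding w per using main by (simp add: right_diff_distrib cis_mult algebra_simps)
qed

lemma halfturn_cnj: "halfturn (cnj z) = cnj (halfturn z)"
  by (simp add: halfturn_eq)

text \<open>Mirror image of \<open>halfturn_chi\<close>: the fixed point at infinity of the passage
  to the last child of a face with two parents.\<close>

lemma halfturn_chi_cnj: "w7 ^ 4 * halfturn (cis (2 * pi - chi)) = cis (2 * pi - chi)"
proof -
  have per: "cis (2 * pi - chi) = cnj (cis chi)"
    using cis_2pi_add[of "- chi"] by (simp add: cis_cnj)
  have "cnj (w7 ^ 3 * halfturn (cis chi)) = cnj (cis chi)" by (simp only: halfturn_chi)
  then have "cnj (w7 ^ 3) * halfturn (cnj (cis chi)) = cnj (cis chi)" by (simp add: halfturn_cnj)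
  moreover have "w7 ^ 4 = cnj (w7 ^ 3)"
  proof -
    have "w7 ^ 4 = cis (- (6 * pi / 7))"
      using cis_2pi_add[of "- (6 * pi / 7)"] unfolding w7_pow_cis by (simp add: algebra_simps)
    then show ?thesis unfolding w7_pow_cis by (simp add: cis_cnj algebra_simps)
  qed
  ultimately show ?thesis unfolding per by simp
qed

text \<open>Consecutive rays from the centre in these directions enclose the descendants of one
  child. The outermost rays point to the limits of the chains of first and of last children.\<close>

definition ang :: "role \<Rightarrow> nat \<Rightarrow> real" where
  "ang r k = (if is_A r then [chi, chi + 2 * pi / 7, chi + 4 * pi / 7, 16 * pi / 7 - chi] ! k
    else [chi, chi + 2 * pi / 7, 2 * pi - chi] ! k)"

lemma ang_0 [simp]: "ang r 0 = chi"
  by (simp add: ang_def)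

text \<open>Positive on the left of the line through 0 in direction \<open>x\<close>. Two such
  conditions cut out a wedge of angle below pi.\<close>

definition left_of :: "real \<Rightarrow> complex \<Rightarrow> real" where "left_of x z = Im (z * cis (- x))"

definition sector :: "role \<Rightarrow> complex set" where
  "sector r = {z. cmod z < 1 \<and> 0 \<le> left_of (ang r 0) z \<and> left_of (ang r (nkids r)) z \<le> 0}"

text \<open>After clearing denominators the quantity becomes a combination of
  \<open>left_of x z\<close> and sin x times the squared distance of \<open>z\<close> from
  \<open>cis x\<close>, with a nonnegative and a positive coefficient.\<close>

lemma left_of_halfturn:
  assumes z: "cmod z < 1"
  shows "0 \<le> left_of x z \<Longrightarrow> 0 < sin x \<Longrightarrow> 0 < Im (halfturn z * cnj (halfturn (cis x)))"
    and "left_of x z \<le> 0 \<Longrightarrow> sin x < 0 \<Longrightarrow> Im (halfturn z * cnj (halfturn (cis x))) < 0"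
proof -
  let ?n = nbr_dist and ?a = "cos x" and ?b = "sin x" and ?N = "1 + (Re z)\<^sup>2 + (Im z)\<^sup>2"
  define I where "I = left_of x z"
  have I: "I = Im z * ?a - Re z * ?b" by (simp add: I_def left_of_def)
  have ab: "?a\<^sup>2 + ?b\<^sup>2 = 1" by simp
  define K where "K = (cmod (1 - nd * z))\<^sup>2 * (cmod (1 - nd * cis x))\<^sup>2"
  have K: "0 < K" using den_nz[of z] den_nz[of "cis x"] z by (simp add: K_def)
  have "halfturn z * cnj (halfturn (cis x)) = ((nd - z) * cnj (1 - nd * z) * cnj ((nd - cis x) * cnj (1 - nd * cis x))) / K"
    unfolding halfturn_eq K_def of_real_mult complex_norm_square using den_nz[of z] den_nz[of "cis x"] den_nz[of "cnj z"] den_nz[of "cnj (cis x)"] z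
    by (simp add: divide_simps)
  then have eq: "Im (halfturn z * cnj (halfturn (cis x))) * K = Im ((nd - z) * cnj (1 - nd * z) * cnj ((nd - cis x) * cnj (1 - nd * cis x)))"
    using K by simp
  have p: "(nd - z) * cnj (1 - nd * z) = Complex (?n * ?N - (1 + ?n\<^sup>2) * Re z) (- (1 - ?n\<^sup>2) * Im z)"
    by (simp add: complex_eq_iff algebra_simps power2_eq_square)
  have q: "(nd - cis x) * cnj (1 - nd * cis x) = Complex (2 * ?n - (1 + ?n\<^sup>2) * ?a) (- (1 - ?n\<^sup>2) * ?b)"
    by (simp add: complex_eq_iff algebra_simps power2_eq_square)
      (metis distrib_left mult.right_neutral sin_cos_squared_add3)
  have "Im ((nd - z) * cnj (1 - nd * z) * cnj ((nd - cis x) * cnj (1 - nd * cis x)))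
      = (1 - ?n\<^sup>2) * ((1 + ?n\<^sup>2) * I + ?n * (?b * ?N - 2 * Im z))"
    unfolding p q I using ab by (simp add: algebra_simps)
  then have main: "Im (halfturn z * cnj (halfturn (cis x))) * K = (1 - ?n\<^sup>2) * ((1 + ?n\<^sup>2) * I + ?n * (?b * ?N - 2 * Im z))"
    using eq by simp
  have n2: "0 < 1 - ?n\<^sup>2" using nbr_dist by simp
  have "z \<noteq> cis x" using z by auto
  then have "0 < (cmod (z - cis x))\<^sup>2" by simp
  also have "(cmod (z - cis x))\<^sup>2 = ?N - 2 * (Re z * ?a + Im z * ?b)"
    unfolding cmod_power2 using ab by (simp add: power2_diff algebra_simps)
  finally have d: "0 < ?N - 2 * (Re z * ?a + Im z * ?b)" .
  have id: "?b * ?N - 2 * Im z = ?b * (?N - 2 * (Re z * ?a + Im z * ?b)) - 2 * ?a * I"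
  proof -
    have "?b * (?N - 2 * (Re z * ?a + Im z * ?b)) - 2 * ?a * I = ?b * ?N - 2 * Im z * (?a\<^sup>2 + ?b\<^sup>2)"
    proof -
      have "Im z * (cos x * (cos x * 2)) + Im z * (sin x * (sin x * 2)) = Im z * 2 * (cos x * cos x + sin x * sin x)"
        by (simp only: distrib_left mult_ac)
      then have "Im z * (cos x * (cos x * 2)) + Im z * (sin x * (sin x * 2)) = Im z * 2"
        by (simp only: sin_cos_squared_add3 mult_1_right)
      then show ?thesis unfolding I by (simp add: algebra_simps power2_eq_square)
    qed
    then show ?thesis using ab by simp
  qed
  have pos: "0 \<le> 1 + ?n\<^sup>2 - 2 * ?n * ?a"
  proof -
    have "?n * ?a \<le> ?n" using nbr_dist by (simp add: mult_left_le)
    moreover have "0 \<le> (1 - ?n)\<^sup>2" by simp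
    ultimately show ?thesis by (simp add: power2_diff)
  qed
  have rew: "(1 + ?n\<^sup>2) * I + ?n * (?b * ?N - 2 * Im z) = (1 + ?n\<^sup>2 - 2 * ?n * ?a) * I + ?n * (?b * (?N - 2 * (Re z * ?a + Im z * ?b)))"
    unfolding id by (simp add: algebra_simps)
  show "0 < Im (halfturn z * cnj (halfturn (cis x)))" if "0 \<le> left_of x z" "0 < sin x"
  proof -
    have "0 \<le> (1 + ?n\<^sup>2 - 2 * ?n * ?a) * I" using pos that by (simp add: I_def)
    moreover have "0 < ?n * (?b * (?N - 2 * (Re z * ?a + Im z * ?b)))" using that d nbr_dist by simp
    ultimately have "0 < Im (halfturn z * cnj (halfturn (cis x))) * K" unfolding main rew using n2 by simp
    then show ?thesis using K by (simp add: zero_less_mult_iff)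
  qed
  show "Im (halfturn z * cnj (halfturn (cis x))) < 0" if "left_of x z \<le> 0" "sin x < 0"
  proof -
    have "(1 + ?n\<^sup>2 - 2 * ?n * ?a) * I \<le> 0" using pos that by (simp add: I_def mult_nonneg_nonpos)
    moreover have "?n * (?b * (?N - 2 * (Re z * ?a + Im z * ?b))) < 0" using that d nbr_dist
      by (intro mult_pos_neg mult_neg_pos) auto
    ultimately have "Im (halfturn z * cnj (halfturn (cis x))) * K < 0" unfolding main rew using n2 by (simp add: mult_pos_neg)
    then show ?thesis using K by (simp add: mult_less_0_iff)
  qed
qed

lemma left_of_alt: "left_of x z = Im z * cos x - Re z * sin x"
  by (simp add: left_of_def)

text \<open>Linear dependence of three directions in the plane; it transfers signs at two rays to
  the rays beyond them.\<close>

lemma left_of_between: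
  "left_of t z * sin (v - u) = left_of u z * sin (v - t) - left_of v z * sin (u - t)"
  by (simp add: left_of_alt sin_diff algebra_simps)

lemma left_of_rotate:
  assumes "w7 ^ a * halfturn (cis x) = cis y"
  shows "left_of y (w7 ^ a * halfturn z) = Im (halfturn z * cnj (halfturn (cis x)))"
proof -
  have 1: "cis (- y) = cnj (w7 ^ a) * cnj (halfturn (cis x))"
    by (metis assms cis_cnj complex_cnj_mult)
  have 2: "w7 ^ a * cnj (w7 ^ a) = 1" by (simp add: w7_pow_cis cis_cnj cis_mult)
  have "w7 ^ a * halfturn z * cis (- y) = (w7 ^ a * cnj (w7 ^ a)) * (halfturn z * cnj (halfturn (cis x)))"
    unfolding 1 by (simp only: mult_ac)
  then show ?thesis unfolding left_of_def 2 by (simp only: mult_1_left)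
qed

lemma sin_chi: "0 < sin chi" "sin (16 * pi / 7 - chi) < 0" "sin (2 * pi - chi) < 0"
proof -
  show *: "0 < sin chi" by (rule sin_gt_zero) (use chi_bounds pi_gt_zero in linarith)+
  then show "sin (2 * pi - chi) < 0" by (simp add: sin_diff)
  have "0 < sin (chi - 2 * pi / 7)" by (rule sin_gt_zero) (use chi_bounds pi_gt_zero in linarith)+
  moreover have "sin (16 * pi / 7 - chi) = - sin (chi - 2 * pi / 7)"
    using sin_periodic[of "2 * pi / 7 - chi"] sin_minus[of "chi - 2 * pi / 7"] by (simp add: algebra_simps)
  ultimately show "sin (16 * pi / 7 - chi) < 0" by simp
qed

lemma w7_mult_cis: "w7 ^ a * cis x = cis (x + 2 * pi * a / 7)"
  by (simp add: w7_pow_cis cis_mult algebra_simps)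

lemma ang_mono:
  assumes "a < b" "b \<le> nkids r"
  shows "0 < sin (ang r b - ang r a)"
proof -
  have "0 < ang r b - ang r a \<and> ang r b - ang r a < pi"
    using assms chi_bounds pi_gt_zero
    by (auto simp: ang_def nkids_def numeral_eq_Suc less_Suc_eq le_Suc_eq split: if_splits)
  then show ?thesis by (intro sin_gt_zero) auto
qed

lemma ang_mono': "a \<le> b \<Longrightarrow> b \<le> nkids r \<Longrightarrow> 0 \<le> sin (ang r b - ang r a)"
  using ang_mono[of a b r] by (cases "a = b") auto

lemma norm_kid: "cmod z < 1 \<Longrightarrow> cmod (w7 ^ a * halfturn z) < 1"
  by (simp add: norm_mult norm_power w7_pow norm_halfturn)

text \<open>The rays bounding the child's sector end, at infinity, where the rays bounding its slot
  end, so \<open>left_of_halfturn\<close> yields strict inequalities. On the right, children with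
  one parent use \<open>halfturn_chi_right\<close>, shared ones
  \<open>halfturn_chi_cnj\<close>.\<close>

lemma kid_sector:
  assumes "j < nkids r" "z \<in> sector (kid_role r j)"
  shows "0 < left_of (ang r j) (w7 ^ (3 + j) * halfturn z)" "left_of (ang r (Suc j)) (w7 ^ (3 + j) * halfturn z) < 0"
proof -
  have z: "cmod z < 1" "0 \<le> left_of chi z" using assms(2) by (auto simp: sector_def)
  have e: "w7 ^ (3 + j) * halfturn (cis chi) = cis (chi + 2 * pi * j / 7)"
    using arg_cong[OF halfturn_chi, of "\<lambda>x. w7 ^ j * x"] by (simp add: power_add w7_mult_cis mult.left_commute mult.assoc)
  have "ang r j = chi + 2 * pi * j / 7"
    using assms(1) by (auto elim!: kid_role_cases simp: ang_def)
  then show "0 < left_of (ang r j) (w7 ^ (3 + j) * halfturn z)"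
    using left_of_rotate[OF e, of z] left_of_halfturn(1)[OF z] sin_chi by simp
  show "left_of (ang r (Suc j)) (w7 ^ (3 + j) * halfturn z) < 0"
  proof (cases "is_A (kid_role r j)")
    case True
    then have l: "left_of (16 * pi / 7 - chi) z \<le> 0" using assms(2) by (auto simp: sector_def ang_def nkids_def)
    have e: "w7 ^ (3 + j) * halfturn (cis (16 * pi / 7 - chi)) = cis (chi + 2 * pi * real (Suc j) / 7)"
    proof -
      have "w7 ^ (3 + j) = w7 ^ Suc j * w7 ^ 2" by (simp add: power_add power2_eq_square power3_eq_cube)
      then show ?thesis using arg_cong[OF halfturn_chi_right, of "\<lambda>x. w7 ^ Suc j * x"] by (simp add: w7_mult_cis mult.assoc del: power_Suc)
    qed
    have "ang r (Suc j) = chi + 2 * pi * real (Suc j) / 7"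
      using assms(1) True by (auto elim!: kid_role_cases simp: ang_def)
    then show ?thesis
      using left_of_rotate[OF e, of z] left_of_halfturn(2)[OF z(1) l] sin_chi by simp
  next
    case False
    then have l: "left_of (2 * pi - chi) z \<le> 0" using assms(2) by (auto simp: sector_def ang_def nkids_def)
    have j: "j = (if is_A r then 2 else 1)" using assms(1) False by (auto elim!: kid_role_cases)
    have e: "w7 ^ (3 + j) * halfturn (cis (2 * pi - chi)) = cis (ang r (Suc j))"
    proof (cases "is_A r")
      case True
      have "w7 ^ (3 + 2) = w7 ^ 1 * w7 ^ 4" using power_add[of w7 1 4] by simp
      then have "w7 ^ (3 + 2) * halfturn (cis (2 * pi - chi)) = w7 ^ 1 * cis (2 * pi - chi)"
        by (simp only: mult.assoc halfturn_chi_cnj)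
      also have "\<dots> = cis (16 * pi / 7 - chi)" unfolding w7_mult_cis by (simp add: algebra_simps)
      finally show ?thesis using True j by (simp add: ang_def)
    next
      case False
      then show ?thesis using halfturn_chi_cnj j by (simp add: ang_def)
    qed
    show ?thesis
      using left_of_rotate[OF e, of z] left_of_halfturn(2)[OF z(1) l] sin_chi by simp
  qed
qed

lemma between:
  assumes "j < nkids r" "0 < left_of (ang r j) z" "left_of (ang r (Suc j)) z < 0"
  shows "i \<le> j \<Longrightarrow> 0 \<le> left_of (ang r i) z" "Suc j \<le> i \<Longrightarrow> i \<le> nkids r \<Longrightarrow> left_of (ang r i) z \<le> 0"
proof -
  have p: "0 < sin (ang r (Suc j) - ang r j)" using assms(1) by (intro ang_mono) auto
  show "0 \<le> left_of (ang r i) z" if "i \<le> j"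
  proof -
    have "0 \<le> left_of (ang r j) z * sin (ang r (Suc j) - ang r i)"
      using assms that by (intro mult_nonneg_nonneg ang_mono') auto
    moreover have "left_of (ang r (Suc j)) z * sin (ang r j - ang r i) \<le> 0"
      using assms that by (intro mult_nonpos_nonneg ang_mono') auto
    ultimately have "0 \<le> left_of (ang r i) z * sin (ang r (Suc j) - ang r j)"
      using left_of_between[of "ang r i" z "ang r (Suc j)" "ang r j"] by linarith
    then show ?thesis using p by (simp add: zero_le_mult_iff)
  qed
  show "left_of (ang r i) z \<le> 0" if "Suc j \<le> i" "i \<le> nkids r"
  proof -
    have s: "0 \<le> sin (ang r i - ang r j)" "0 \<le> sin (ang r i - ang r (Suc j))"
      using that by (auto intro!: ang_mono')
    have "sin (ang r (Suc j) - ang r i) = - sin (ang r i - ang r (Suc j))" "sin (ang r j - ang r i) = - sin (ang r i - ang r j)"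
      by (simp_all flip: sin_minus)
    then have "left_of (ang r j) z * sin (ang r (Suc j) - ang r i) \<le> 0" "0 \<le> left_of (ang r (Suc j)) z * sin (ang r j - ang r i)"
      using s assms by (simp_all add: mult_nonneg_nonneg mult_nonpos_nonneg)
    then have "left_of (ang r i) z * sin (ang r (Suc j) - ang r j) \<le> 0"
      using left_of_between[of "ang r i" z "ang r (Suc j)" "ang r j"] by linarith
    then show ?thesis using p by (simp add: mult_le_0_iff)
  qed
qed

section \<open>Paths of descendants and their separation\<close>

fun run :: "int \<times> real \<times> role \<times> (complex \<Rightarrow> complex) \<Rightarrow> nat list \<Rightarrow> int \<times> real \<times> role \<times> (complex \<Rightarrow> complex)" where
  "run s [] = s"
| "run (t, p, r, g) (j # u) = run (t + 1, lam * p + j * gphi, kid_role r j, nb (3 + j) g) u"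

fun valid_path :: "role \<Rightarrow> nat list \<Rightarrow> bool" where
  "valid_path r [] = True"
| "valid_path r (j # u) \<longleftrightarrow> j < nkids r \<and> valid_path (kid_role r j) u"

abbreviation frame_of :: "int \<times> real \<times> role \<times> (complex \<Rightarrow> complex) \<Rightarrow> complex \<Rightarrow> complex" where
  "frame_of s \<equiv> snd (snd (snd s))"

lemma kid_in_sector:
  assumes "j < nkids r" "z \<in> sector (kid_role r j)"
  shows "w7 ^ (3 + j) * halfturn z \<in> sector r"
proof -
  have "cmod z < 1" using assms(2) by (simp add: sector_def)
  then show ?thesis
    using between(1)[OF assms(1) kid_sector[OF assms], of 0] between(2)[OF assms(1) kid_sector[OF assms], of "nkids r"]
      norm_kid[of z] assms(1) by (simp add: sector_def Suc_leI)
qed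

lemma zero_in_sector: "0 \<in> sector r"
  by (simp add: sector_def left_of_alt)

lemma run_center:
  "valid_path r u \<Longrightarrow> \<exists>z\<in>sector r. frame_of (run (t, p, r, g) u) 0 = g z"
proof (induction u arbitrary: t p r g)
  case Nil
  show ?case by (intro bexI[of _ 0]) (auto simp: zero_in_sector)
next
  case (Cons j u)
  then have "valid_path (kid_role r j) u" by simp
  from Cons.IH[OF this, of "t + 1" "lam * p + j * gphi" "nb (3 + j) g"]
  obtain z where z: "z \<in> sector (kid_role r j)" "frame_of (run (t, p, r, g) (j # u)) 0 = nb (3 + j) g z"
    by auto
  then have "cmod z < 1" by (simp add: sector_def)
  then show ?case using z Cons.prems kid_in_sector[of j r z]
    by (intro bexI[of _ "w7 ^ (3 + j) * halfturn z"]) (simp_all add: nb_apply)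
qed

text \<open>Where two paths part they enter disjoint open wedges, none of which contains 0. As
  frames are injective on the disk, the centres differ too.\<close>

lemma run_inj:
  assumes "g \<in> frames" "valid_path r u" "valid_path r v" "frame_of (run (t, p, r, g) u) 0 = frame_of (run (t, p, r, g) v) 0"
  shows "u = v"
proof -
  have pt: "\<exists>z. cmod z < 1 \<and> 0 < left_of (ang r j) z \<and> left_of (ang r (Suc j)) z < 0 \<and> frame_of (run (t, p, r, g) (j # u)) 0 = g z"
    if v: "valid_path r (j # u)" for t p r g j u
  proof -
    obtain z where z: "z \<in> sector (kid_role r j)" "frame_of (run (t, p, r, g) (j # u)) 0 = nb (3 + j) g z"
      using run_center[of "kid_role r j" u "t + 1" "lam * p + j * gphi" "nb (3 + j) g"] v by auto
    then have "cmod z < 1" by (simp add: sector_def)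
    then show ?thesis using z kid_sector[of j r z] v norm_kid[of z "3 + j"]
      by (intro exI[of _ "w7 ^ (3 + j) * halfturn z"]) (simp add: nb_apply)
  qed
  have pt0: "frame_of (run (t, p, r, g) []) 0 \<noteq> frame_of (run (t, p, r, g) (j # u)) 0"
    if g: "g \<in> frames" "valid_path r (j # u)" for t p r g j u
  proof
    assume e: "frame_of (run (t, p, r, g) []) 0 = frame_of (run (t, p, r, g) (j # u)) 0"
    obtain z where z: "cmod z < 1" "0 < left_of (ang r j) z" "frame_of (run (t, p, r, g) (j # u)) 0 = g z"
      using pt[OF g(2), of t p g] by blast
    have "g 0 = g z" using e unfolding z(3) by simp
    from frame_inj[OF g(1) _ z(1) this] have "z = 0" by simp
    with z(2) show False by (simp add: left_of_alt)
  qed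
  show ?thesis using assms
  proof (induction u arbitrary: v t p r g)
    case Nil
    then show ?case using pt0 by (cases v) metis+
  next
    case (Cons i u)
    show ?case
    proof (cases v)
      case Nil
      then show ?thesis using Cons.prems pt0 by metis
    next
      case v: (Cons j v')
      obtain z where z: "cmod z < 1" "0 < left_of (ang r i) z" "left_of (ang r (Suc i)) z < 0" "frame_of (run (t, p, r, g) (i # u)) 0 = g z"
        using pt[OF Cons.prems(2), of t p g] by blast
      obtain z' where z': "cmod z' < 1" "0 < left_of (ang r j) z'" "left_of (ang r (Suc j)) z' < 0" "frame_of (run (t, p, r, g) (j # v')) 0 = g z'"
        using pt[OF Cons.prems(3)[unfolded v], of t p g] by blast
      have "g z = g z'" using Cons.prems(4) unfolding v z(4) z'(4) .
      then have zz: "z = z'" using z(1) z'(1) frame_inj[OF Cons.prems(1)] by blast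
      have ij: "i < nkids r" "j < nkids r" using Cons.prems v by auto
      have "i = j"
      proof (rule ccontr)
        assume "i \<noteq> j"
        then consider "Suc i \<le> j" | "Suc j \<le> i" by linarith
        then show False
          using between(1)[OF ij(2) z'(2,3), of "Suc i"] between(1)[OF ij(1) z(2,3), of "Suc j"] z(3) z'(3) zz
          by cases auto
      qed
      moreover have "u = v'"
      proof (rule Cons.IH)
        show "nb (3 + i) g \<in> frames" using Cons.prems(1) by (rule frames_nb)
        show "valid_path (kid_role r i) u" using Cons.prems(2) by simp
        show "valid_path (kid_role r i) v'" using Cons.prems(3) v \<open>i = j\<close> by simp
        show "frame_of (run (t + 1, lam * p + i * gphi, kid_role r i, nb (3 + i) g) u) 0 =
          frame_of (run (t + 1, lam * p + i * gphi, kid_role r i, nb (3 + i) g) v') 0"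
          using Cons.prems(4) unfolding v \<open>i = j\<close> run.simps .
      qed
      ultimately show ?thesis using v by simp
    qed
  qed
qed

lemma run_append: "run s (u @ v) = run (run s u) v"
  by (induction s u rule: run.induct) auto

lemma cell_run: "cell t p r g \<Longrightarrow> \<exists>m u. valid_path P2 u \<and> (t, p, r, g) = run (- int m, - 1, P2, root_frame m) u"
proof (induction rule: cell.induct)
  case (root m)
  show ?case by (intro exI[of _ m] exI[of _ "[]"]) simp
next
  case (kid t p r g j)
  then obtain m u where u: "valid_path P2 u" "(t, p, r, g) = run (- int m, - 1, P2, root_frame m) u" by blast
  have "valid_path r' (u @ v) \<longleftrightarrow> valid_path r' u \<and> valid_path (fst (snd (snd (run (t', p', r', g') u)))) v" for r' v t' p' g'
    by (induction u arbitrary: r' t' p' g') auto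
  from this[of P2 "[j]" "- int m" "- 1" "root_frame m"] have "valid_path P2 (u @ [j])"
    using u kid.hyps by (metis fst_conv snd_conv valid_path.simps)
  moreover have "run (- int m, - 1, P2, root_frame m) (u @ [j]) = (t + 1, lam * p + j * gphi, kid_role r j, nb (3 + j) g)"
    unfolding run_append u(2)[symmetric] by simp
  ultimately show ?case by metis
qed

text \<open>Since each root is child number 1 of the next, any two cells can be reached from a
  common root, and \<open>run_inj\<close> then compares them.\<close>

lemma run_deeper: "valid_path P2 u \<Longrightarrow> \<exists>u'. valid_path P2 u' \<and> run (- int m, - 1, P2, root_frame m) u = run (- int (m + l), - 1, P2, root_frame (m + l)) u'"
proof (induction l)
  case (Suc l)
  then obtain u' where u': "valid_path P2 u'" "run (- int m, - 1, P2, root_frame m) u = run (- int (m + l), - 1, P2, root_frame (m + l)) u'" by blast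
  have "run (- int (Suc (m + l)), - 1, P2, root_frame (Suc (m + l))) (1 # u') = run (- int (m + l), - 1, P2, root_frame (m + l)) u'"
    using root_kid[of "m + l"] by (simp add: kid_role_def lam_def)
  moreover have "valid_path P2 (1 # u')" using u'(1) by (simp add: nkids_def kid_role_def)
  ultimately show ?case
    by (intro exI[of _ "1 # u'"]) (simp only: u'(2) add_Suc_right simp_thms)
qed (intro exI[of _ u], simp)

theorem cell_unique:
  assumes "cell t p r g" "cell t' p' r' g'" "g 0 = g' 0"
  shows "t = t' \<and> p = p' \<and> r = r' \<and> g = g'"
proof -
  obtain m u where u: "valid_path P2 u" "(t, p, r, g) = run (- int m, - 1, P2, root_frame m) u" using cell_run[OF assms(1)] by blast
  obtain m' u' where u': "valid_path P2 u'" "(t', p', r', g') = run (- int m', - 1, P2, root_frame m') u'" using cell_run[OF assms(2)] by blast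
  obtain v where v: "valid_path P2 v" "(t, p, r, g) = run (- int (m + m'), - 1, P2, root_frame (m + m')) v"
    using run_deeper[OF u(1), of m m'] unfolding u(2) by blast
  obtain v' where v': "valid_path P2 v'" "(t', p', r', g') = run (- int (m + m'), - 1, P2, root_frame (m + m')) v'"
    using run_deeper[OF u'(1), of m' m] unfolding u'(2) add.commute[of m' m] by blast
  have "frame_of (run (- int (m + m'), - 1, P2, root_frame (m + m')) v) 0 = frame_of (run (- int (m + m'), - 1, P2, root_frame (m + m')) v') 0"
    unfolding v(2)[symmetric] v'(2)[symmetric] using assms(3) by simp
  from run_inj[OF frames_root v(1) v'(1) this] have "v = v'" .
  then have "(t, p, r, g) = (t', p', r', g')" unfolding v(2) v'(2) by simp
  then show ?thesis by simp
qed

section \<open>Computable functions and codes of tile sets\<close>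

text \<open>Total functions of a fixed number of arguments: the values are given by a HOL function,
  so compositions carry no definedness conditions.\<close>

definition cmp :: "nat \<Rightarrow> (nat list \<Rightarrow> nat) \<Rightarrow> bool" where
  "cmp k F \<longleftrightarrow> (\<exists>r. \<forall>xs. length xs = k \<longrightarrow> eval r xs (F xs))"

lemma cmp_nth: "i < k \<Longrightarrow> cmp k (\<lambda>xs. xs ! i)"
  unfolding cmp_def by (auto intro!: exI[of _ "Id i"] ev_Id)

lemma eval_Cn1: "eval g xs y \<Longrightarrow> eval f [y] z \<Longrightarrow> eval (Cn f [g]) xs z"
  by (rule ev_Cn[of _ _ "[y]"]) auto

lemma eval_Cn2: "eval g xs y \<Longrightarrow> eval g' xs y' \<Longrightarrow> eval f [y, y'] z \<Longrightarrow> eval (Cn f [g, g']) xs z"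
  by (rule ev_Cn[of _ _ "[y, y']"]) auto

lemma cmp_c1: "computable f \<Longrightarrow> cmp k G \<Longrightarrow> cmp k (\<lambda>xs. f (G xs))"
  unfolding cmp_def computable_def by (metis eval_Cn1)

lemma cmp_c2:
  assumes "cmp 2 (\<lambda>xs. f (xs ! 0) (xs ! 1))" "cmp k G" "cmp k G'"
  shows "cmp k (\<lambda>xs. f (G xs) (G' xs))"
proof -
  obtain rf where rf: "\<And>xs. length xs = 2 \<Longrightarrow> eval rf xs (f (xs ! 0) (xs ! 1))" using assms(1) unfolding cmp_def by blast
  have "eval rf [x, y] (f x y)" for x y using rf[of "[x, y]"] by simp
  moreover obtain r r' where "\<And>xs. length xs = k \<Longrightarrow> eval r xs (G xs)" "\<And>xs. length xs = k \<Longrightarrow> eval r' xs (G' xs)"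
    using assms(2,3) unfolding cmp_def by blast
  ultimately have "\<forall>xs. length xs = k \<longrightarrow> eval (Cn rf [r, r']) xs (f (G xs) (G' xs))" by (auto intro!: eval_Cn2)
  then show ?thesis unfolding cmp_def by (rule exI)
qed

lemma computable_cmp: "computable f \<longleftrightarrow> cmp 1 (\<lambda>xs. f (xs ! 0))"
proof
  assume "computable f"
  then show "cmp 1 (\<lambda>xs. f (xs ! 0))" by (rule cmp_c1) (rule cmp_nth, simp)
next
  assume "cmp 1 (\<lambda>xs. f (xs ! 0))"
  then obtain r where "\<And>xs. length xs = 1 \<Longrightarrow> eval r xs (f (xs ! 0))" unfolding cmp_def by blast
  from this[of "[n]" for n] show "computable f" unfolding computable_def by (intro exI[of _ r]) simp
qed

lemma computable_Suc: "computable Suc"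
  unfolding computable_def by (rule exI[of _ Sc]) (auto intro: ev_S)

lemma cmp_Suc: "cmp k G \<Longrightarrow> cmp k (\<lambda>xs. Suc (G xs))"
  using computable_Suc by (rule cmp_c1)

lemma cmp_const: "cmp k (\<lambda>xs. c)"
proof (induction c)
  case 0
  show ?case unfolding cmp_def by (rule exI[of _ Zr]) (auto intro: ev_Z)
qed (rule cmp_Suc)

lemma cmp_rec:
  assumes "cmp k F" "cmp (Suc (Suc k)) G" "cmp k N"
  shows "cmp k (\<lambda>xs. rec_nat (F xs) (\<lambda>i a. G (i # a # xs)) (N xs))"
proof -
  obtain rf rg rn where r: "\<And>xs. length xs = k \<Longrightarrow> eval rf xs (F xs)" "\<And>xs. length xs = Suc (Suc k) \<Longrightarrow> eval rg xs (G xs)"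
    "\<And>xs. length xs = k \<Longrightarrow> eval rn xs (N xs)" using assms unfolding cmp_def by metis
  have p: "eval (Pr rf rg) (n # xs) (rec_nat (F xs) (\<lambda>i a. G (i # a # xs)) n)" if "length xs = k" for n xs
  proof (induction n)
    case 0
    show ?case using r(1)[OF that] by (auto intro: ev_Pr0)
  next
    case (Suc n)
    then show ?case using r(2)[of "n # _ # xs"] that by (auto intro: ev_PrS)
  qed
  have "eval (Cn (Pr rf rg) (rn # map Id [0..<k])) xs (rec_nat (F xs) (\<lambda>i a. G (i # a # xs)) (N xs))" if l: "length xs = k" for xs
  proof (rule ev_Cn[of _ _ "N xs # xs"])
    show "list_all2 (\<lambda>g. eval g xs) (rn # map Id [0..<k]) (N xs # xs)"
      using r(3)[OF l] l ev_Id[of _ xs] by (simp add: list_all2_conv_all_nth All_less_Suc2)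
  qed (rule p[OF l])
  then show ?thesis unfolding cmp_def by blast
qed

lemma cmp_if: "cmp k A \<Longrightarrow> cmp k F \<Longrightarrow> cmp k G \<Longrightarrow> cmp k (\<lambda>xs. if A xs = 0 then F xs else G xs)"
proof -
  assume a: "cmp k A" "cmp k F" "cmp k G"
  obtain rg where rg: "\<And>xs. length xs = k \<Longrightarrow> eval rg xs (G xs)" using a(3) unfolding cmp_def by blast
  have "cmp (Suc (Suc k)) (\<lambda>xs. G (drop 2 xs))"
  proof -
    have "eval (Cn rg (map Id [2..<Suc (Suc k)])) xs (G (drop 2 xs))" if "length xs = Suc (Suc k)" for xs
    proof (rule ev_Cn[of _ _ "drop 2 xs"])
      show "list_all2 (\<lambda>g. eval g xs) (map Id [2..<Suc (Suc k)]) (drop 2 xs)"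
        using that by (auto simp: list_all2_conv_all_nth intro!: ev_Id simp del: upt_Suc) 
      show "eval rg (drop 2 xs) (G (drop 2 xs))" using that by (intro rg) simp
    qed
    then show ?thesis unfolding cmp_def by blast
  qed
  from cmp_rec[OF a(2) this a(1)] have "cmp k (\<lambda>xs. rec_nat (F xs) (\<lambda>i b. G xs) (A xs))" by simp
  moreover have "rec_nat (F xs) (\<lambda>i b. G xs) (A xs) = (if A xs = 0 then F xs else G xs)" for xs
    by (cases "A xs") auto
  ultimately show ?thesis by simp
qed

lemma cmp_Mn:
  assumes "cmp (Suc k) F" "\<And>xs. length xs = k \<Longrightarrow> \<exists>s. F (s # xs) = 0"
  shows "cmp k (\<lambda>xs. LEAST s. F (s # xs) = 0)"
proof -
  obtain r where r: "\<And>xs. length xs = Suc k \<Longrightarrow> eval r xs (F xs)" using assms(1) unfolding cmp_def by blast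
  have "eval (Mn r) xs (LEAST s. F (s # xs) = 0)" if l: "length xs = k" for xs
  proof (rule ev_Mn)
    have "F ((LEAST s. F (s # xs) = 0) # xs) = 0" using assms(2)[OF l] by (rule LeastI_ex)
    then show "eval r ((LEAST s. F (s # xs) = 0) # xs) 0" using r[of "(LEAST s. F (s # xs) = 0) # xs"] l by simp
    show "\<forall>m<LEAST s. F (s # xs) = 0. \<exists>y>0. eval r (m # xs) y"
    proof (intro allI impI)
      fix m assume "m < (LEAST s. F (s # xs) = 0)"
      then have "F (m # xs) \<noteq> 0" by (rule not_less_Least)
      then show "\<exists>y>0. eval r (m # xs) y" using r[of "m # xs"] l by auto
    qed
  qed
  then show ?thesis unfolding cmp_def by blast
qed

lemma cmp_add: "cmp k G \<Longrightarrow> cmp k G' \<Longrightarrow> cmp k (\<lambda>xs. G xs + G' xs)"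
proof (rule cmp_c2[where f = "(+)"])
  have "cmp 2 (\<lambda>xs. rec_nat (xs ! 0) (\<lambda>i a. Suc ((i # a # xs) ! 1)) (xs ! 1))"
    by (intro cmp_rec cmp_nth cmp_Suc) auto
  moreover have "rec_nat x (\<lambda>i a. Suc a) y = x + y" for x y by (induction y) auto
  ultimately show "cmp 2 (\<lambda>xs. xs ! 0 + xs ! 1)" by simp
qed

lemma cmp_mult: "cmp k G \<Longrightarrow> cmp k G' \<Longrightarrow> cmp k (\<lambda>xs. G xs * G' xs)"
proof (rule cmp_c2[where f = times])
  have "cmp 2 (\<lambda>xs. rec_nat 0 (\<lambda>i a. (i # a # xs) ! 1 + (i # a # xs) ! 2) (xs ! 1))"
    by (intro cmp_rec cmp_nth cmp_add cmp_const) auto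
  moreover have "rec_nat 0 (\<lambda>i a. a + x) y = x * y" for x y by (induction y) auto
  ultimately show "cmp 2 (\<lambda>xs. xs ! 0 * xs ! 1)" by simp
qed

lemma computable_pred: "computable (\<lambda>n. n - 1)"
  unfolding computable_cmp
proof -
  have "cmp 1 (\<lambda>xs. rec_nat 0 (\<lambda>i a. (i # a # xs) ! 0) (xs ! 0))"
    by (intro cmp_rec cmp_nth cmp_const) auto
  moreover have "rec_nat 0 (\<lambda>i a. i) y = y - 1" for y :: nat by (cases y) auto
  ultimately show "cmp 1 (\<lambda>xs. xs ! 0 - 1)" by simp
qed

lemma cmp_diff: "cmp k G \<Longrightarrow> cmp k G' \<Longrightarrow> cmp k (\<lambda>xs. G xs - G' xs)"
proof (rule cmp_c2[where f = "(-)"])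
  have "cmp 2 (\<lambda>xs. rec_nat (xs ! 0) (\<lambda>i a. (i # a # xs) ! 1 - 1) (xs ! 1))"
    by (intro cmp_rec cmp_nth cmp_c1[OF computable_pred]) auto
  moreover have "rec_nat x (\<lambda>i a. a - 1) y = x - y" for x y :: nat by (induction y) auto
  ultimately show "cmp 2 (\<lambda>xs. xs ! 0 - xs ! 1)" by simp
qed

lemma computable_triangle: "computable triangle"
  unfolding computable_cmp
proof -
  have "cmp 1 (\<lambda>xs. rec_nat 0 (\<lambda>i a. (i # a # xs) ! 1 + Suc ((i # a # xs) ! 0)) (xs ! 0))"
    by (intro cmp_rec cmp_nth cmp_add cmp_Suc cmp_const) auto
  moreover have "rec_nat 0 (\<lambda>i a. a + Suc i) y = triangle y" for y by (induction y) auto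
  ultimately show "cmp 1 (\<lambda>xs. triangle (xs ! 0))" by simp
qed

lemma cmp_prod_encode: "cmp k G \<Longrightarrow> cmp k G' \<Longrightarrow> cmp k (\<lambda>xs. prod_encode (G xs, G' xs))"
  unfolding prod_encode_def by (simp, intro cmp_add cmp_c1[OF computable_triangle])

lemma triangle_mono: "a \<le> b \<Longrightarrow> triangle a \<le> triangle b"
  by (induction b) (auto simp: le_Suc_eq)

text \<open>The Cantor pairing is decoded by searching for the diagonal: the truncated difference is
  0 exactly when the code lies below \<open>triangle (Suc s)\<close>.\<close>

lemma diagonal_of_prod_encode: "(LEAST s. Suc (prod_encode (m, n)) - triangle (Suc s) = 0) = m + n"
proof (rule Least_equality)
  show "Suc (prod_encode (m, n)) - triangle (Suc (m + n)) = 0" by (simp add: prod_encode_def)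
next
  fix s assume s: "Suc (prod_encode (m, n)) - triangle (Suc s) = 0"
  show "m + n \<le> s"
  proof (rule ccontr)
    assume "\<not> m + n \<le> s"
    then have "triangle (Suc s) \<le> triangle (m + n)" by (intro triangle_mono) simp
    with s show False by (simp add: prod_encode_def)
  qed
qed

lemma computable_diagonal: "computable (\<lambda>z. LEAST s. Suc z - triangle (Suc s) = 0)"
  unfolding computable_cmp
proof -
  have "cmp 1 (\<lambda>xs. LEAST s. Suc ((s # xs) ! 1) - triangle (Suc ((s # xs) ! 0)) = 0)"
  proof (rule cmp_Mn)
    show "cmp (Suc 1) (\<lambda>xs. Suc (xs ! 1) - triangle (Suc (xs ! 0)))"
      by (intro cmp_diff cmp_Suc cmp_nth cmp_c1[OF computable_triangle]) auto
    fix xs :: "nat list" assume "length xs = 1"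
    obtain m n where "prod_encode (m, n) = xs ! 0" by (metis prod_decode_inverse surj_pair)
    then have "Suc (xs ! 0) - triangle (Suc (m + n)) = 0" by (auto simp: prod_encode_def)
    then show "\<exists>s. Suc ((s # xs) ! 1) - triangle (Suc ((s # xs) ! 0)) = 0" by auto
  qed
  then show "cmp 1 (\<lambda>xs. LEAST s. Suc (xs ! 0) - triangle (Suc s) = 0)" by simp
qed

definition left_code :: "nat \<Rightarrow> nat" where "left_code z = z - triangle (LEAST s. Suc z - triangle (Suc s) = 0)"
definition right_code :: "nat \<Rightarrow> nat" where "right_code z = (LEAST s. Suc z - triangle (Suc s) = 0) - left_code z"

lemma left_right_code: "left_code (prod_encode (m, n)) = m" "right_code (prod_encode (m, n)) = n"
  by (simp_all only: left_code_def right_code_def diagonal_of_prod_encode) (simp_all add: prod_encode_def)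

lemma cmp_left: "cmp k G \<Longrightarrow> cmp k (\<lambda>xs. left_code (G xs))"
  unfolding left_code_def by (intro cmp_diff cmp_c1[OF computable_triangle] cmp_c1[OF computable_diagonal])

lemma cmp_right: "cmp k G \<Longrightarrow> cmp k (\<lambda>xs. right_code (G xs))"
  unfolding right_code_def by (intro cmp_diff cmp_left cmp_c1[OF computable_diagonal])

section \<open>Computing with codes of lists\<close>

definition hd_code :: "nat \<Rightarrow> nat" where "hd_code z = left_code (z - 1)"
definition tl_code :: "nat \<Rightarrow> nat" where "tl_code z = right_code (z - 1)"
definition cons_code :: "nat \<Rightarrow> nat \<Rightarrow> nat" where "cons_code x z = Suc (prod_encode (x, z))"
definition drop_code :: "nat \<Rightarrow> nat \<Rightarrow> nat" where "drop_code j z = rec_nat z (\<lambda>_. tl_code) j"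

lemma hd_tl_code: "hd_code (list_encode (x # xs)) = x" "tl_code (list_encode (x # xs)) = list_encode xs"
  by (simp_all add: hd_code_def tl_code_def left_right_code)

lemma cons_code: "cons_code x (list_encode xs) = list_encode (x # xs)"
  by (simp add: cons_code_def)

lemma drop_code: "j \<le> length xs \<Longrightarrow> drop_code j (list_encode xs) = list_encode (drop j xs)"
proof (induction j)
  case (Suc j)
  then have "drop j xs = xs ! j # drop (Suc j) xs" by (simp add: Cons_nth_drop_Suc)
  then show ?case using Suc hd_tl_code by (simp add: drop_code_def)
qed (simp add: drop_code_def)

lemma cmp_hd: "cmp k G \<Longrightarrow> cmp k (\<lambda>xs. hd_code (G xs))"
  unfolding hd_code_def by (intro cmp_left cmp_c1[OF computable_pred])

lemma cmp_tl: "cmp k G \<Longrightarrow> cmp k (\<lambda>xs. tl_code (G xs))"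
  unfolding tl_code_def by (intro cmp_right cmp_c1[OF computable_pred])

lemma cmp_cons: "cmp k G \<Longrightarrow> cmp k G' \<Longrightarrow> cmp k (\<lambda>xs. cons_code (G xs) (G' xs))"
  unfolding cons_code_def by (intro cmp_Suc cmp_prod_encode)

lemma cmp_drop: "cmp k G \<Longrightarrow> cmp k G' \<Longrightarrow> cmp k (\<lambda>xs. drop_code (G xs) (G' xs))"
proof (rule cmp_c2[where f = "drop_code"])
  have "cmp 2 (\<lambda>xs. rec_nat (xs ! 1) (\<lambda>i a. tl_code ((i # a # xs) ! 1)) (xs ! 0))"
    by (intro cmp_rec cmp_nth cmp_tl) auto
  then show "cmp 2 (\<lambda>xs. drop_code (xs ! 0) (xs ! 1))" by (simp add: drop_code_def)
qed

definition nth_code :: "nat \<Rightarrow> nat \<Rightarrow> nat" where "nth_code j z = hd_code (drop_code j z)"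

lemma nth_code: "j < length xs \<Longrightarrow> nth_code j (list_encode xs) = xs ! j"
  unfolding nth_code_def by (simp only: drop_code less_imp_le) (metis Cons_nth_drop_Suc hd_tl_code(1))

lemma cmp_nth_code: "cmp k G \<Longrightarrow> cmp k G' \<Longrightarrow> cmp k (\<lambda>xs. nth_code (G xs) (G' xs))"
  unfolding nth_code_def by (intro cmp_hd cmp_drop)

text \<open>A template lists seven pairs of numbers; its \<open>i\<close>-th instance has the labels \<open>x + y * i\<close>.\<close>

definition instance_of :: "nat list \<Rightarrow> nat \<Rightarrow> nat list" where
  "instance_of t i = map (\<lambda>j. t ! (2 * j) + t ! (2 * j + 1) * i) [0..<7]"

definition instance_code :: "nat \<Rightarrow> nat \<Rightarrow> nat" where
  "instance_code z i = foldr (\<lambda>j. cons_code (nth_code (2 * j) z + nth_code (2 * j + 1) z * i)) [0..<7] 0"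

lemma instance_code: "length t = 14 \<Longrightarrow> instance_code (list_encode t) i = list_encode (instance_of t i)"
proof -
  assume t: "length t = 14"
  have "foldr (\<lambda>j. cons_code (nth_code (2 * j) (list_encode t) + nth_code (2 * j + 1) (list_encode t) * i)) js 0 =
    list_encode (map (\<lambda>j. t ! (2 * j) + t ! (2 * j + 1) * i) js)" if "set js \<subseteq> {..<7}" for js
    using that
  proof (induction js)
    case (Cons j js)
    then have "2 * j < length t" "2 * j + 1 < length t" using t by auto
    then show ?case using Cons by (simp add: nth_code cons_code del: list_encode.simps)
  qed simp
  moreover have "set [0..<7] \<subseteq> {..<7::nat}" by auto
  ultimately show ?thesis unfolding instance_code_def instance_of_def by blast
qed

lemma cmp_instance: "cmp k G \<Longrightarrow> cmp k G' \<Longrightarrow> cmp k (\<lambda>xs. instance_code (G xs) (G' xs))"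
proof -
  assume a: "cmp k G" "cmp k G'"
  have "cmp k (\<lambda>xs. foldr (\<lambda>j. cons_code (nth_code (2 * j) (G xs) + nth_code (2 * j + 1) (G xs) * G' xs)) js 0)" for js
    by (induction js) (simp_all, auto intro!: cmp_const cmp_cons cmp_add cmp_mult cmp_nth_code a)
  then show ?thesis unfolding instance_code_def .
qed

text \<open>Reversed because the recursive program builds its list by prepending.\<close>

definition instances_at :: "nat list list \<Rightarrow> nat \<Rightarrow> nat list list" where
  "instances_at T i = rev (map (\<lambda>t. instance_of t i) T)"

definition all_instances :: "nat list list \<Rightarrow> nat \<Rightarrow> nat list list" where
  "all_instances T n = rec_nat [] (\<lambda>i acc. instances_at T i @ acc) n"

lemma set_all_instances: "set (all_instances T n) = {instance_of t i | t i. t \<in> set T \<and> i < n}"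
  by (induction n) (auto simp: all_instances_def instances_at_def less_Suc_eq)

definition template_code :: "nat list list \<Rightarrow> nat" where
  "template_code T = list_encode (map list_encode T)"

text \<open>Only the empty list has code 0, so \<open>drop_code j n = 0\<close> detects the end of
  the template list. Looping up to \<open>n\<close> covers it, since a list is no longer than its
  code.\<close>

definition add_instances :: "nat \<Rightarrow> nat \<Rightarrow> nat \<Rightarrow> nat" where
  "add_instances n i a = rec_nat a (\<lambda>j a'. if drop_code j n = 0 then a' else cons_code (instance_code (nth_code j n) i) a') n"

definition tileset_code :: "nat \<Rightarrow> nat" where
  "tileset_code n = rec_nat 0 (add_instances n) (Suc n)"

lemma cmp_add_instances: "cmp 3 (\<lambda>ys. add_instances (ys ! 2) (ys ! 0) (ys ! 1))"
proof -
  let ?G = "\<lambda>zs. if drop_code (zs ! 0) (zs ! 4) = 0 then zs ! 1 else cons_code (instance_code (nth_code (zs ! 0) (zs ! 4)) (zs ! 2)) (zs ! 1)"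
  have "cmp 3 (\<lambda>ys. rec_nat (ys ! 1) (\<lambda>j a. ?G (j # a # ys)) (ys ! 2))"
    by (intro cmp_rec cmp_nth cmp_if cmp_cons cmp_instance cmp_nth_code cmp_drop) auto
  moreover have "(j # a # ys) ! 4 = ys ! 2" "(j # a # ys) ! 2 = ys ! 0" "(j # a # ys) ! 1 = a" for j a and ys :: "nat list"
    by (simp_all add: numeral_eq_Suc)
  ultimately show ?thesis unfolding add_instances_def by (simp only: nth_Cons_0)
qed

lemma computable_tileset_code: "computable tileset_code"
  unfolding computable_cmp
proof -
  have "cmp 1 (\<lambda>xs. rec_nat 0 (\<lambda>i a. add_instances ((i # a # xs) ! 2) ((i # a # xs) ! 0) ((i # a # xs) ! 1)) (Suc (xs ! 0)))"
    using cmp_add_instances by (intro cmp_rec[where G = "\<lambda>ys. add_instances (ys ! 2) (ys ! 0) (ys ! 1)"] cmp_const cmp_Suc cmp_nth) (simp_all add: numeral_eq_Suc)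
  moreover have "(i # a # xs) ! 2 = xs ! 0" "(i # a # xs) ! 1 = a" for i a and xs :: "nat list"
    by (simp_all add: numeral_eq_Suc)
  ultimately show "cmp 1 (\<lambda>xs. tileset_code (xs ! 0))" unfolding tileset_code_def by (simp only: nth_Cons_0)
qed

lemma length_le_list_encode: "length xs \<le> list_encode xs"
proof (induction xs)
  case (Cons x xs)
  then show ?case using le_prod_encode_2[of "list_encode xs" x] by simp
qed simp

text \<open>The number \<open>n\<close> both codes the templates and bounds the instance index. This
  double use provides the self-reference of the diagonal argument.\<close>

lemma tileset_code:
  assumes T: "\<And>t. t \<in> set T \<Longrightarrow> length t = 14" and n: "n = template_code T"
  shows "tileset_code n = encode_tiles (all_instances T (Suc n))"
proof -
  let ?l = "map list_encode T"
  have len: "length T \<le> n" using length_le_list_encode[of ?l] by (simp add: n template_code_def)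
  have inner: "rec_nat (encode_tiles acc) (\<lambda>j a'. if drop_code j n = 0 then a' else cons_code (instance_code (nth_code j n) i) a') m
    = encode_tiles (instances_at (take m T) i @ acc)" for m i acc
  proof (induction m)
    case 0
    then show ?case by (simp add: instances_at_def)
  next
    case (Suc m)
    show ?case
    proof (cases "m < length T")
      case True
      have "drop_code m n = list_encode (drop m ?l)" unfolding n template_code_def using True by (intro drop_code) simp
      then have "drop_code m n \<noteq> 0" using True by (cases "drop m ?l") auto
      moreover have "nth_code m n = list_encode (T ! m)" unfolding n template_code_def using True nth_code[of m ?l] by simp
      ultimately show ?thesis
        using Suc True T[of "T ! m"] by (simp add: instance_code encode_tiles_def instances_at_def take_Suc_conv_app_nth cons_code del: list_encode.simps)
    next
      case False
      \<comment> \<open>Past the end the tail of code 0 is 0 again.\<close>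
      have z: "drop_code j n = 0" if "length T \<le> j" for j
        using that
      proof (induction j rule: dec_induct)
        case base
        show ?case using drop_code[of "length T" ?l] by (simp add: n template_code_def)
      next
        case (step j)
        have "right_code 0 = 0" using left_right_code(2)[of 0 0] by (simp add: prod_encode_def)
        then show ?case using step by (simp add: drop_code_def tl_code_def)
      qed
      then show ?thesis using Suc False by simp
    qed
  qed
  have "rec_nat 0 (add_instances n) m = encode_tiles (all_instances T m)" for m
  proof (induction m)
    case 0
    then show ?case by (simp add: all_instances_def encode_tiles_def)
  next
    case (Suc m)
    have "rec_nat 0 (add_instances n) (Suc m) = add_instances n m (rec_nat 0 (add_instances n) m)" by simp
    also have "\<dots> = encode_tiles (instances_at (take n T) m @ all_instances T m)" unfolding Suc add_instances_def inner ..
    also have "instances_at (take n T) m @ all_instances T m = all_instances T (Suc m)" using len by (simp add: all_instances_def)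
    finally show ?case .
  qed
  then show ?thesis unfolding tileset_code_def .
qed

section \<open>Tiles for the faces of the rows\<close>

text \<open>Edges between rows (\<open>V\<close>) bear the state of the child's row and the digit vector of the child (none on
  \<open>PR\<close> edges); edges within a row (\<open>H\<close>) bear the rule applied to that row and a carry for each constraint.\<close>

datatype hty = HAA | HAB | HBA
datatype ('q, 'b) lab = H hty 'q 'b 'q "int list" | V role 'q "nat list"

text \<open>The two letters say whether the faces on the left and on the right of the edge have one
  parent (A) or two (B). Two faces with two parents are never adjacent in a row.\<close>

fun left_type :: "role \<Rightarrow> hty" where
  "left_type P1 = HBA" | "left_type P2 = HAA" | "left_type P3 = HBA" | "left_type PL = HAB" | "left_type PR = HAA"
fun right_type :: "role \<Rightarrow> hty" where
  "right_type P1 = HAA" | "right_type P2 = HAB" | "right_type P3 = HAB" | "right_type PL = HBA" | "right_type PR = HAA"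

text \<open>Edge 2 leads to the child shared with the left neighbour. It bears no digits, because
  that child is counted by the left neighbour alone.\<close>

definition tile :: "role \<Rightarrow> 'q \<Rightarrow> 'b \<Rightarrow> 'q \<Rightarrow> nat list \<Rightarrow> nat list list \<Rightarrow> int list \<Rightarrow> int list \<Rightarrow> ('q, 'b) lab list" where
  "tile r q b q' v ws cL cR =
    [V r q v, H (left_type r) q b q' cL, V PR q' []] @ map (\<lambda>j. V (kid_role r j) q' (ws ! j)) [0..<nkids r] @
    [H (right_type r) q b q' cR] @ (if is_A r then [] else [V PR q []])"

lemma tile_A: "is_A r \<Longrightarrow> tile r q b q' v ws cL cR =
    [V r q v, H (left_type r) q b q' cL, V PR q' [], V P1 q' (ws ! 0), V P2 q' (ws ! 1), V PL q' (ws ! 2), H (right_type r) q b q' cR]"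
  by (simp add: tile_def nkids_def kid_role_def numeral_eq_Suc)

lemma tile_PL: "tile PL q b q' v ws cL cR =
    [V PL q v, H HAB q b q' cL, V PR q' [], V P3 q' (ws ! 0), V PL q' (ws ! 1), H HBA q b q' cR, V PR q []]"
  by (simp add: tile_def nkids_def kid_role_def numeral_eq_Suc)

lemma length_tile [simp]: "length (tile r q b q' v ws cL cR) = 7"
  by (cases r) (simp_all add: tile_def nkids_def)

lemma tile_0: "tile r q b q' v ws cL cR ! 0 = V r q v" "tile r q b q' v ws cL cR ! 1 = H (left_type r) q b q' cL"
    "tile r q b q' v ws cL cR ! 2 = V PR q' []"
  by (auto simp: tile_def)

lemma tile_kid: "j < nkids r \<Longrightarrow> tile r q b q' v ws cL cR ! (3 + j) = V (kid_role r j) q' (ws ! j)"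
  by (auto simp: tile_def nth_append)

lemma tile_right: "tile r q b q' v ws cL cR ! right_index r = H (right_type r) q b q' cR"
  by (auto simp: tile_def nth_append right_index_def nkids_def)

lemma tile_last: "\<not> is_A r \<Longrightarrow> tile r q b q' v ws cL cR ! 6 = V PR q []"
  by (auto simp: tile_def nth_append nkids_def)

section \<open>Cells and their neighbours\<close>

definition cell_tile :: "(int \<Rightarrow> 'q) \<Rightarrow> (int \<Rightarrow> 'b) \<Rightarrow> (int \<Rightarrow> real \<Rightarrow> role \<Rightarrow> nat list) \<Rightarrow> (int \<Rightarrow> real \<Rightarrow> int list) \<Rightarrow> int \<Rightarrow> real \<Rightarrow> role \<Rightarrow> ('q, 'b) lab list" where
  "cell_tile q b v c t p r = tile r (q t) (b t) (q (t + 1)) (v t p r)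
     (map (\<lambda>j. v (t + 1) (lam * p + j * gphi) (kid_role r j)) [0..<nkids r]) (c t p) (c t (p + len r))"

text \<open>Edges to an own child, to the right neighbour, and to the child shared with the left
  neighbour. The last case leaves positions open because that edge bears only the state of the
  row.\<close>

definition linked :: "int \<Rightarrow> real \<Rightarrow> role \<Rightarrow> nat \<Rightarrow> int \<Rightarrow> real \<Rightarrow> role \<Rightarrow> nat \<Rightarrow> bool" where
  "linked t p r i t' p' r' i' \<longleftrightarrow>
     t' = t + 1 \<and> (\<exists>j<nkids r. i = 3 + j \<and> p' = lam * p + j * gphi \<and> r' = kid_role r j) \<and> i' = 0 \<or>
     t' = t \<and> p' = p + len r \<and> r' \<in> succ_role r \<and> i = right_index r \<and> i' = 1 \<or>
     t' = t + 1 \<and> i = 2 \<and> r' = PL \<and> i' = 6"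

lemma linked_labels:
  assumes "linked t p r i t' p' r' i'"
  shows "cell_tile q b v c t p r ! i = cell_tile q b v c t' p' r' ! i'"
  using assms unfolding linked_def
proof (elim disjE conjE exE)
  fix j assume "t' = t + 1" "j < nkids r" "i = 3 + j" "p' = lam * p + j * gphi" "r' = kid_role r j" "i' = 0"
  then show ?thesis by (simp add: cell_tile_def tile_kid tile_0)
next
  assume h: "t' = t" "p' = p + len r" "r' \<in> succ_role r" "i = right_index r" "i' = 1"
  have "right_type r = left_type r'" using h(3) by (cases r) auto
  with h show ?thesis by (simp add: cell_tile_def tile_right tile_0(2)[unfolded One_nat_def])
next
  assume "t' = t + 1" "i = 2" "r' = PL" "i' = 6"
  then show ?thesis by (simp add: cell_tile_def tile_0 tile_last)
qed

lemma cell_edge: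
  assumes c: "cell t p r g" and i: "i < 7"
  shows "\<exists>t' p' r' g' i'. cell t' p' r' g' \<and> i' < 7 \<and> nb i g = (al ^^ i') g' \<and> (linked t p r i t' p' r' i' \<or> linked t' p' r' i' t p r i)"
proof -
  note f = cell_frames[OF c]
  consider (kid) j where "j < nkids r" "i = 3 + j" | (right) "i = right_index r" | (parent) "i = 0" | (left) "i = 1" | (low) "i = 2"
    | (up) "r = PL" "i = 6"
  proof -
    have "i \<in> {0,1,2,3,4,5,6}" using i by auto
    moreover have "is_A r \<or> r = PL" using cell_role[OF c] by (cases r) auto
    ultimately show thesis using that
      by (elim disjE insertE emptyE) (auto simp: nkids_def right_index_def numeral_eq_Suc)
  qed
  then show ?thesis
  proof cases
    case kid
    then show ?thesis using cell.kid[OF c kid(1)]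
      by (intro exI[of _ "t + 1"] exI[of _ "lam * p + j * gphi"] exI[of _ "kid_role r j"] exI[of _ "nb (3 + j) g"] exI[of _ 0])
        (auto simp: linked_def)
  next
    case right
    obtain r' where r': "r' \<in> succ_role r" "cell t (p + len r) r' (right_frame r g)" using cell_right[OF c] by blast
    then show ?thesis using right edge_right[OF rotation_al f, of r]
      by (intro exI[of _ t] exI[of _ "p + len r"] exI[of _ r'] exI[of _ "right_frame r g"] exI[of _ 1])
        (auto simp: linked_def)
  next
    case parent
    obtain p' r' g' j where p: "cell (t - 1) p' r' g'" "j < nkids r'" "p = lam * p' + j * gphi" "r = kid_role r' j" "g = nb (3 + j) g'"
      using cell_parent[OF c] by blast
    have "nb 0 g = (al ^^ (3 + j)) g'"
      using be_be[OF frames_al_pow[OF cell_frames[OF p(1)]]] by (simp add: p(5) nbr_def)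
    moreover have "3 + j < 7" using p(2) by (auto simp: nkids_def split: if_splits)
    ultimately show ?thesis using p parent
      by (intro exI[of _ "t - 1"] exI[of _ p'] exI[of _ r'] exI[of _ g'] exI[of _ "3 + j"]) (auto simp: linked_def)
  next
    case left
    obtain p' r' g' where l: "cell t p' r' g'" "p = p' + len r'" "g = right_frame r' g'" "r \<in> succ_role r'"
      using cell_left[OF c] by blast
    have "nb 1 g = (al ^^ right_index r') g'"
      using edge_right[OF rotation_al cell_frames[OF l(1)], of r'] be_be[OF frames_al_pow[OF cell_frames[OF l(1)]]]
      unfolding l(3) nbr_def by (simp add: nbr_def) metis
    then show ?thesis using l left
      by (intro exI[of _ t] exI[of _ p'] exI[of _ r'] exI[of _ g'] exI[of _ "right_index r'"]) (auto simp: linked_def right_index_def)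
  next
    case low
    obtain p' r' g' where l: "cell t p' r' g'" "p = p' + len r'" "g = right_frame r' g'" "r \<in> succ_role r'"
      using cell_left[OF c] by blast
    have "cell (t + 1) (lam * p' + (nkids r' - 1) * gphi) (kid_role r' (nkids r' - 1)) (nb (3 + (nkids r' - 1)) g')"
      using l(1) by (rule cell.kid) (simp add: nkids_def)
    moreover have "3 + (nkids r' - 1) = 2 + nkids r'" by (simp add: nkids_def)
    ultimately show ?thesis using edge_low[OF rotation_al cell_frames[OF l(1)], of r'] l(3) low last_kid(2)[of r']
      by (intro exI[of _ "t + 1"] exI[of _ "lam * p' + (nkids r' - 1) * gphi"] exI[of _ PL] exI[of _ "nb (2 + nkids r') g'"] exI[of _ 6])
        (auto simp: linked_def)
  next
    case up
    obtain p' r' g' j where p: "cell (t - 1) p' r' g'" "j < nkids r'" "p = lam * p' + j * gphi" "r = kid_role r' j" "g = nb (3 + j) g'"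
      using cell_parent[OF c] by blast
    have j: "3 + j = 2 + nkids r'" by (rule kid_role_cases[OF p(2)]) (use p(4) up in \<open>auto simp: nkids_def\<close>)
    obtain r2 where r2: "cell (t - 1) (p' + len r') r2 (right_frame r' g')" using cell_right[OF p(1)] by blast
    have "nb 2 (right_frame r' g') = (al ^^ 6) g" using edge_low[OF rotation_al cell_frames[OF p(1)], of r'] unfolding p(5) j .
    then have "nb 6 g = (al ^^ 2) (right_frame r' g')"
      using be_be[OF frames_al_pow[OF cell_frames[OF r2], of 2]] by (simp add: nbr_def)
    then show ?thesis using r2 up
      by (intro exI[of _ "t - 1"] exI[of _ "p' + len r'"] exI[of _ r2] exI[of _ "right_frame r' g'"] exI[of _ 2]) (auto simp: linked_def)
  qed
qed

text \<open>The group is generated by turning and crossing, and crossing any edge of a cell leads to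
  a cell.\<close>

lemma frame_cell: "g \<in> frames \<Longrightarrow> \<exists>t p r h j. cell t p r h \<and> j < 7 \<and> g = (al ^^ j) h"
proof -
  have al: "\<exists>t p r h j. cell t p r h \<and> j < 7 \<and> al ((al ^^ i) h') = (al ^^ j) h" if "cell t' p' r' h'" for i t' p' r' h'
  proof -
    have "al ((al ^^ i) h') = (al ^^ (Suc i mod 7)) h'"
      using pow_mod[OF rotation_al cell_frames[OF that], of "Suc i"] by simp
    then show ?thesis using that by (intro exI[of _ t'] exI[of _ p'] exI[of _ r'] exI[of _ h'] exI[of _ "Suc i mod 7"]) simp
  qed
  have "\<exists>t p r h j. cell t p r h \<and> j < 7 \<and> on_disk g = (al ^^ j) h" if "g \<in> symgrp" for g
    using that
  proof induction
    case 1
    show ?case using cell.root[of 0]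
      by (intro exI[of _ "- int 0"] exI[of _ "- 1"] exI[of _ P2] exI[of _ "root_frame 0"] exI[of _ 0]) (simp add: id_def)
  next
    case (2 g)
    then show ?case using al unfolding al_on_disk[symmetric] by metis
  next
    case (3 g)
    then obtain t p r h j where "cell t p r h" "j < 7" "on_disk g = (al ^^ j) h" by blast
    then show ?case using cell_edge[of t p r h j] unfolding be_on_disk[symmetric] nbr_def by metis
  qed
  then show "g \<in> frames \<Longrightarrow> \<exists>t p r h j. cell t p r h \<and> j < 7 \<and> g = (al ^^ j) h"
    unfolding frames_def by blast
qed

lemma al_pow_center: "(al ^^ j) g 0 = g 0"
  by (simp add: al_pow_apply)

text \<open>No stabiliser has to be computed: both frames are turned frames of cells, and cells with
  equal centres coincide.\<close>

lemma same_center: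
  assumes "g \<in> frames" "h \<in> frames" "g 0 = h 0"
  shows "\<exists>j. h = (al ^^ j) g"
proof -
  obtain t p r g' j where g: "cell t p r g'" "j < 7" "g = (al ^^ j) g'" using frame_cell[OF assms(1)] by blast
  obtain t' p' r' h' j' where h: "cell t' p' r' h'" "j' < 7" "h = (al ^^ j') h'" using frame_cell[OF assms(2)] by blast
  have "g' = h'" using cell_unique[OF g(1) h(1)] assms(3) g(3) h(3) by (simp add: al_pow_center)
  have "(al ^^ (j' + (7 - j))) g = (al ^^ (j' + 7)) g'"
    unfolding g(3) pow_add using g(2) by simp
  also have "\<dots> = h"
    using h(3) \<open>g' = h'\<close> al_7[OF cell_frames[OF h(1)]] by (simp add: funpow_add)
  finally show ?thesis by metis
qed

lemma nb_inj:
  assumes "g \<in> frames" "i < 7" "j < 7" "nb i g 0 = nb j g 0"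
  shows "i = j"
proof -
  have "g (w7 ^ i * halfturn 0) = g (w7 ^ j * halfturn 0)" using assms(4) by (simp add: nb_apply)
  from frame_inj[OF assms(1) norm_kid norm_kid this] have "w7 ^ i * halfturn 0 = w7 ^ j * halfturn 0" by simp
  moreover have "halfturn 0 \<noteq> 0" using nbr_dist by (simp add: halfturn_eq)
  ultimately have "cis (2 * pi * real i / real 7) = cis (2 * pi * real j / real 7)" by (simp add: w7_pow_cis)
  then show ?thesis
    using bij_betw_imp_inj_on[OF bij_betw_roots_unity[of 7]] assms(2,3) by (auto dest: inj_onD)
qed

section \<open>Tiles carrying affine constraints\<close>

text \<open>Each pair in \<open>cons b\<close> consists of a linear form for the vectors of a row
  and one for those of the next. The bounds on digits and carries keep the alphabet finite.\<close>

locale kari =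
  fixes d :: nat and cons :: "'b \<Rightarrow> ((nat \<Rightarrow> int) \<times> (nat \<Rightarrow> int)) list"
    and rules :: "('q \<times> 'b \<times> 'q) set" and Bv :: nat and Bc :: int
begin

definition dot :: "(nat \<Rightarrow> int) \<Rightarrow> nat list \<Rightarrow> int" where
  "dot f v = (\<Sum>i<d. f i * int (v ! i))"

text \<open>Positivity of entry 0 makes its sum along a row at least the number of faces, so that it
  can serve as denominator.\<close>

definition okv :: "nat list \<Rightarrow> bool" where
  "okv v \<longleftrightarrow> length v = d \<and> 0 < v ! 0 \<and> (\<forall>i<d. v ! i \<le> Bv)"

definition okc :: "'b \<Rightarrow> int list \<Rightarrow> bool" where
  "okc b c \<longleftrightarrow> length c = length (cons b) \<and> (\<forall>k<length (cons b). \<bar>c ! k\<bar> \<le> Bc)"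

text \<open>An inequality, since the defect will be the increment of a rounded slope, which is known
  only to be nonnegative. Equations are imposed as two opposite inequalities.\<close>

definition balanced :: "'b \<Rightarrow> nat list \<Rightarrow> nat list list \<Rightarrow> int list \<Rightarrow> int list \<Rightarrow> bool" where
  "balanced b v ws cL cR \<longleftrightarrow> (\<forall>k<length (cons b).
     0 \<le> dot (fst (cons b ! k)) v + (\<Sum>w\<leftarrow>ws. dot (snd (cons b ! k)) w) + cL ! k - cR ! k)"

definition tiles :: "('q, 'b) lab list set" where
  "tiles = {tile r q b q' v ws cL cR | r q b q' v ws cL cR. r \<noteq> PR \<and> (q, b, q') \<in> rules \<and> okv v \<and>
     length ws = nkids r \<and> (\<forall>w\<in>set ws. okv w) \<and> okc b cL \<and> okc b cR \<and> balanced b v ws cL cR}"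

definition labels :: "('q, 'b) lab set" where "labels = (\<Union>\<tau>\<in>tiles. set \<tau>)"

lemma tilesE:
  assumes "\<tau> \<in> tiles"
  obtains r q b q' v ws cL cR where "\<tau> = tile r q b q' v ws cL cR" "r \<noteq> PR" "(q, b, q') \<in> rules" "okv v"
     "length ws = nkids r" "\<forall>w\<in>set ws. okv w" "okc b cL" "okc b cR" "balanced b v ws cL cR"
  using assms unfolding tiles_def by blast

lemma length_tiles: "\<tau> \<in> tiles \<Longrightarrow> length \<tau> = 7"
  by (auto elim: tilesE)

lemma less_7_cases: "k < 7 \<Longrightarrow> k = 0 \<or> k = 1 \<or> k = 2 \<or> k = 3 \<or> k = 4 \<or> k = 5 \<or> k = (6::nat)"
  by auto

text \<open>A vertical label occurs at the child (position 0) and at the parent. The labels on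
  either side tell the two apart.\<close>

lemma around_P1:
  assumes "\<tau> \<in> tiles" "k < 7" "\<tau> ! k = V P1 q v"
  shows "k = 0 \<and> (\<exists>b q' c c'. \<tau> ! ((k + 1) mod 7) = H HBA q b q' c \<and> \<tau> ! ((k + 6) mod 7) = H HAA q b q' c') \<or>
    k \<noteq> 0 \<and> (\<exists>u u'. \<tau> ! ((k + 1) mod 7) = V P2 q u \<and> \<tau> ! ((k + 6) mod 7) = V PR q u')"
  using assms(1)
proof (rule tilesE)
  fix r q1 b q1' v1 ws cL cR assume "\<tau> = tile r q1 b q1' v1 ws cL cR" "r \<noteq> PR"
  then show ?thesis using assms(2,3) less_7_cases[OF assms(2)]
    by (cases r) (auto simp: tile_A tile_PL)
qed

lemma around_P2:
  assumes "\<tau> \<in> tiles" "k < 7" "\<tau> ! k = V P2 q v"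
  shows "k = 0 \<and> (\<exists>b q' c c'. \<tau> ! ((k + 1) mod 7) = H HAA q b q' c \<and> \<tau> ! ((k + 6) mod 7) = H HAB q b q' c') \<or>
    k \<noteq> 0 \<and> (\<exists>u u'. \<tau> ! ((k + 1) mod 7) = V PL q u \<and> \<tau> ! ((k + 6) mod 7) = V P1 q u')"
  using assms(1)
proof (rule tilesE)
  fix r q1 b q1' v1 ws cL cR assume "\<tau> = tile r q1 b q1' v1 ws cL cR" "r \<noteq> PR"
  then show ?thesis using assms(2,3) less_7_cases[OF assms(2)]
    by (cases r) (auto simp: tile_A tile_PL)
qed

lemma around_P3:
  assumes "\<tau> \<in> tiles" "k < 7" "\<tau> ! k = V P3 q v"
  shows "k = 0 \<and> (\<exists>b q' c c'. \<tau> ! ((k + 1) mod 7) = H HBA q b q' c \<and> \<tau> ! ((k + 6) mod 7) = H HAB q b q' c') \<or>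
    k \<noteq> 0 \<and> (\<exists>u u'. \<tau> ! ((k + 1) mod 7) = V PL q u \<and> \<tau> ! ((k + 6) mod 7) = V PR q u')"
  using assms(1)
proof (rule tilesE)
  fix r q1 b q1' v1 ws cL cR assume "\<tau> = tile r q1 b q1' v1 ws cL cR" "r \<noteq> PR"
  then show ?thesis using assms(2,3) less_7_cases[OF assms(2)]
    by (cases r) (auto simp: tile_A tile_PL)
qed

text \<open>At the parent this label is flanked by a horizontal one as well, but of the parent's
  row, with \<open>q\<close> as second state. The rule is recorded so that equal states can be
  excluded.\<close>

lemma around_PL:
  assumes "\<tau> \<in> tiles" "k < 7" "\<tau> ! k = V PL q v"
  shows "k = 0 \<and> (\<exists>b q' c u. \<tau> ! ((k + 1) mod 7) = H HAB q b q' c \<and> \<tau> ! ((k + 6) mod 7) = V PR q u) \<or>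
    k \<noteq> 0 \<and> (\<exists>q0 b c u h. (q0, b, q) \<in> rules \<and> \<tau> ! ((k + 1) mod 7) = H h q0 b q c \<and>
      (\<tau> ! ((k + 6) mod 7) = V P2 q u \<or> \<tau> ! ((k + 6) mod 7) = V P3 q u \<and> h = HBA))"
  using assms(1)
proof (rule tilesE)
  fix r q1 b q1' v1 ws cL cR assume "\<tau> = tile r q1 b q1' v1 ws cL cR" "r \<noteq> PR" "(q1, b, q1') \<in> rules"
  then show ?thesis using assms(2,3) less_7_cases[OF assms(2)]
    by (cases r) (auto simp: tile_A tile_PL)
qed

lemma around_H:
  assumes "\<tau> \<in> tiles" "k < 7" "\<tau> ! k = H h q b q' c"
  shows "\<tau> ! ((k + 1) mod 7) \<noteq> H h2 q2 b2 q2' c2" "\<tau> ! ((k + 6) mod 7) \<noteq> H h2 q2 b2 q2' c2"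
  using assms(1)
proof (rule_tac [!] tilesE)
  fix r q1 b1 q1' v1 ws cL cR assume t: "\<tau> = tile r q1 b1 q1' v1 ws cL cR" "r \<noteq> PR"
  then show "\<tau> ! ((k + 1) mod 7) \<noteq> H h2 q2 b2 q2' c2" using assms(2,3) less_7_cases[OF assms(2)]
    by (cases r) (auto simp: tile_A tile_PL)
  show "\<tau> ! ((k + 6) mod 7) \<noteq> H h2 q2 b2 q2' c2" using assms(2,3) less_7_cases[OF assms(2)] t
    by (cases r) (auto simp: tile_A tile_PL)
qed

end

section \<open>From tilings to orbits\<close>

context kari
begin

context
  fixes num :: "('q, 'b) lab \<Rightarrow> nat" and L :: "complex \<Rightarrow> complex \<Rightarrow> nat"
  assumes inj: "inj_on num labels" and patch: "valid_patch (map num ` tiles) centers L"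
    and noloop: "\<And>q b. (q, b, q) \<notin> rules"
begin

text \<open>Reading labels through frames turns the matching condition into invariance under
  \<open>be\<close>, and the edges of a face into powers of \<open>al\<close>.\<close>

definition ell :: "(complex \<Rightarrow> complex) \<Rightarrow> ('q, 'b) lab" where
  "ell g = inv_into labels num (L (g 0) (be g 0))"

lemma frame_in_centers: "g \<in> frames \<Longrightarrow> g 0 \<in> centers"
  by (auto simp: frames_def centers_def frame_center)

lemma ell_be: "g \<in> frames \<Longrightarrow> ell (be g) = ell g"
proof -
  assume g: "g \<in> frames"
  have "adjacent (g 0) (be g 0)"
    unfolding adjacent_frame using g by (intro bexI[of _ g] exI[of _ 0]) (auto simp: nbr_def)
  then have "L (g 0) (be g 0) = L (be g 0) (g 0)"
    using patch frame_in_centers[OF g] frame_in_centers[OF frames_be[OF g]] unfolding valid_patch_def by blast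
  then show ?thesis using g by (simp add: ell_def be_be)
qed

lemma ell_num: "\<tau> \<in> tiles \<Longrightarrow> m < 7 \<Longrightarrow> L (g 0) (be g 0) = num (\<tau> ! m) \<Longrightarrow> ell g = \<tau> ! m"
  unfolding ell_def using inj length_tiles[of \<tau>]
  by (auto simp: labels_def intro!: inv_into_f_eq)

text \<open>Multiplication by 6 is negation modulo 7, that is, the reading of a reflected
  copy.\<close>

lemma tile_at_al:
  assumes g: "g \<in> frames"
  shows "\<exists>\<tau>\<in>tiles. \<exists>k. (\<forall>i. ell ((al ^^ i) g) = \<tau> ! ((i + k) mod 7)) \<or> (\<forall>i. ell ((al ^^ i) g) = \<tau> ! ((6 * i + k) mod 7))"
proof -
  obtain h where h: "h \<in> symgrp" "h 0 = g 0" "map (L (g 0)) (face_nbrs h) \<in> copies (map num ` tiles)"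
    using patch frame_in_centers[OF g] unfolding valid_patch_def by blast
  have h': "on_disk h \<in> frames" using h(1) by (auto simp: frames_def)
  obtain j where j: "g = (al ^^ j) (on_disk h)"
    using same_center[OF h' g] h(2) by (auto simp: on_disk_def)
  let ?l = "map (L (g 0)) (face_nbrs h)"
  have at: "L ((al ^^ i) g 0) (be ((al ^^ i) g) 0) = ?l ! ((i + j) mod 7)" for i
  proof -
    have "(al ^^ i) g = (al ^^ ((i + j) mod 7)) (on_disk h)"
      unfolding j pow_add using pow_mod[OF rotation_al h'] by blast
    then show ?thesis unfolding face_nbrs_frame[OF h(1)] by (simp add: nbr_def al_pow_center) (simp add: j al_pow_center)
  qed
  obtain \<tau> k where \<tau>: "\<tau> \<in> tiles" and "?l = rotate k (map num \<tau>) \<or> ?l = rotate k (rev (map num \<tau>))"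
    using h(3) unfolding copies_def by auto
  then show ?thesis
  proof (elim disjE)
    assume l: "?l = rotate k (map num \<tau>)"
    have "ell ((al ^^ i) g) = \<tau> ! ((i + (j + k)) mod 7)" for i
    proof (rule ell_num[OF \<tau>])
      have "?l ! ((i + j) mod 7) = num (\<tau> ! (((i + j) mod 7 + k) mod 7))"
        unfolding l using length_tiles[OF \<tau>] by (subst nth_rotate) (auto simp: add.commute)
      then show "L ((al ^^ i) g 0) (be ((al ^^ i) g) 0) = num (\<tau> ! ((i + (j + k)) mod 7))"
        unfolding at by (simp add: mod_add_left_eq add.assoc)
    qed simp
    with \<tau> show ?thesis by blast
  next
    assume l: "?l = rotate k (rev (map num \<tau>))"
    have "ell ((al ^^ i) g) = \<tau> ! ((6 * i + (6 * (j + k) + 6)) mod 7)" for i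
    proof (rule ell_num[OF \<tau>])
      have "?l ! ((i + j) mod 7) = rev (map num \<tau>) ! (((i + j) mod 7 + k) mod 7)"
        unfolding l using length_tiles[OF \<tau>] by (subst nth_rotate) (auto simp: add.commute)
      also have "\<dots> = num (\<tau> ! (6 - ((i + j) mod 7 + k) mod 7))"
      proof -
        have "rev (map num \<tau>) ! m = num (\<tau> ! (6 - m))" if "m < 7" for m
          using that length_tiles[OF \<tau>] rev_nth[of m "map num \<tau>"] by simp
        then show ?thesis by simp
      qed
      also have "6 - ((i + j) mod 7 + k) mod 7 = (6 * i + (6 * (j + k) + 6)) mod 7"
      proof -
        have "6 - x mod 7 = (6 * x + 6) mod 7" for x :: nat
        proof -
          have "(6 * x + 6) mod 7 = (6 * (x mod 7) + 6) mod 7"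
            by (metis mod_add_left_eq mod_mult_right_eq)
          moreover have "6 - r = (6 * r + 6) mod 7" if "r < 7" for r :: nat
            using less_7_cases[OF that] by auto
          ultimately show ?thesis by simp
        qed
        from this[of "i + j + k"] have "6 - (i + j + k) mod 7 = (6 * (i + j + k) + 6) mod 7" .
        moreover have "((i + j) mod 7 + k) mod 7 = (i + j + k) mod 7" by (rule mod_add_left_eq)
        moreover have "6 * i + (6 * (j + k) + 6) = 6 * (i + j + k) + 6" by simp
        ultimately show ?thesis by (simp only:)
      qed
      finally show "L ((al ^^ i) g 0) (be ((al ^^ i) g) 0) = num (\<tau> ! ((6 * i + (6 * (j + k) + 6)) mod 7))"
        unfolding at .
    qed simp
    with \<tau> show ?thesis by blast
  qed
qed

text \<open>The frame agrees with its tile in position and, relative to the turn \<open>A\<close>,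
  in orientation.\<close>

definition anchored :: "((complex \<Rightarrow> complex) \<Rightarrow> complex \<Rightarrow> complex) \<Rightarrow> (complex \<Rightarrow> complex) \<Rightarrow> ('q, 'b) lab list \<Rightarrow> bool" where
  "anchored A g \<tau> \<longleftrightarrow> g \<in> frames \<and> \<tau> \<in> tiles \<and> (\<forall>i<7. ell ((A ^^ i) g) = \<tau> ! i)"

lemma tile_at:
  assumes A: "A = al \<or> A = al ^^ 6" and g: "g \<in> frames"
  shows "\<exists>\<tau>\<in>tiles. \<exists>k<7. (\<forall>i. ell ((A ^^ i) g) = \<tau> ! ((i + k) mod 7)) \<or> (\<forall>i. ell ((A ^^ i) g) = \<tau> ! ((6 * i + k) mod 7))"
proof -
  obtain \<tau> k where \<tau>: "\<tau> \<in> tiles" and "(\<forall>i. ell ((al ^^ i) g) = \<tau> ! ((i + k) mod 7)) \<or> (\<forall>i. ell ((al ^^ i) g) = \<tau> ! ((6 * i + k) mod 7))"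
    using tile_at_al[OF g] by blast
  then have k: "(\<forall>i. ell ((al ^^ i) g) = \<tau> ! ((i + k mod 7) mod 7)) \<or> (\<forall>i. ell ((al ^^ i) g) = \<tau> ! ((6 * i + k mod 7) mod 7))"
    by (simp add: mod_add_right_eq)
  from A show ?thesis
  proof
    assume "A = al"
    then show ?thesis using k \<tau> by (intro bexI[of _ \<tau>] exI[of _ "k mod 7"]) auto
  next
    assume A: "A = al ^^ 6"
    have p: "(A ^^ i) g = (al ^^ (6 * i)) g" for i unfolding A by (simp add: funpow_mult)
    have "6 * (6 * i) + k mod 7 = i + k mod 7 + 7 * (5 * i)" for i by simp
    then have "(6 * (6 * i) + k mod 7) mod 7 = (i + k mod 7) mod 7" for i by (metis mod_mult_self2)
    then show ?thesis using k \<tau> unfolding p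
      by (intro bexI[of _ \<tau>] exI[of _ "k mod 7"]) auto
  qed
qed

text \<open>One face decides the orientation: \<open>A\<close> becomes \<open>al\<close> or its
  inverse and then stays fixed, the children inheriting the orientation.\<close>

lemma start: "\<exists>A g \<tau>. (A = al \<or> A = al ^^ 6) \<and> anchored A g \<tau>"
proof -
  let ?g = "root_frame 0"
  obtain \<tau> k where \<tau>: "\<tau> \<in> tiles" and "(\<forall>i. ell ((al ^^ i) ?g) = \<tau> ! ((i + k) mod 7)) \<or> (\<forall>i. ell ((al ^^ i) ?g) = \<tau> ! ((6 * i + k) mod 7))"
    using tile_at_al[OF frames_root] by blast
  then show ?thesis
  proof (elim disjE)
    assume e: "\<forall>i. ell ((al ^^ i) ?g) = \<tau> ! ((i + k) mod 7)"
    \<comment> \<open>Turning by \<open>6 * k\<close> cancels the offset \<open>k\<close> modulo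
      7.\<close>
    have "ell ((al ^^ i) ((al ^^ (6 * k)) ?g)) = \<tau> ! i" if "i < 7" for i
    proof -
      have "i + 6 * k + k = i + 7 * k" by simp
      then have "(i + 6 * k + k) mod 7 = i" using that by (metis mod_mult_self2 mod_less)
      then show ?thesis unfolding pow_add using e by simp
    qed
    then have "anchored al ((al ^^ (6 * k)) ?g) \<tau>" using \<tau> frames_al_pow[OF frames_root] unfolding anchored_def by blast
    then show ?thesis by blast
  next
    assume e: "\<forall>i. ell ((al ^^ i) ?g) = \<tau> ! ((6 * i + k) mod 7)"
    have "ell (((al ^^ 6) ^^ i) ((al ^^ k) ?g)) = \<tau> ! i" if "i < 7" for i
    proof -
      have "6 * (6 * i + k) + k = i + 7 * (5 * i + k)" by simp
      then have "(6 * (6 * i + k) + k) mod 7 = i" using that by (metis mod_mult_self2 mod_less)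
      then show ?thesis unfolding funpow_mult pow_add using e by (simp add: algebra_simps)
    qed
    then have "anchored (al ^^ 6) ((al ^^ k) ?g) \<tau>" using \<tau> frames_al_pow[OF frames_root] unfolding anchored_def by blast
    then show ?thesis by blast
  qed
qed

context
  fixes A assumes A: "A = al \<or> A = al ^^ 6"
begin

lemma rot: "rotation A"
  using A rotation_al rotation_al_inverse by auto

lemma look:
  assumes "g \<in> frames" "ell g = l"
  shows "\<exists>\<tau>\<in>tiles. \<exists>k<7. \<tau> ! k = l \<and>
    ((ell (A g) = \<tau> ! ((k + 1) mod 7) \<and> ell ((A ^^ 6) g) = \<tau> ! ((k + 6) mod 7) \<and> (k = 0 \<longrightarrow> anchored A g \<tau>)) \<or>
     (ell (A g) = \<tau> ! ((k + 6) mod 7) \<and> ell ((A ^^ 6) g) = \<tau> ! ((k + 1) mod 7)))"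
proof -
  obtain \<tau> k where \<tau>: "\<tau> \<in> tiles" "k < 7" and e: "(\<forall>i. ell ((A ^^ i) g) = \<tau> ! ((i + k) mod 7)) \<or> (\<forall>i. ell ((A ^^ i) g) = \<tau> ! ((6 * i + k) mod 7))"
    using tile_at[OF A assms(1)] by blast
  from e show ?thesis
  proof
    assume e: "\<forall>i. ell ((A ^^ i) g) = \<tau> ! ((i + k) mod 7)"
    have "\<tau> ! k = l" using e[rule_format, of 0] assms(2) \<tau>(2) by simp
    moreover have "ell (A g) = \<tau> ! ((k + 1) mod 7)" using e[rule_format, of 1] by (simp add: add.commute)
    moreover have "ell ((A ^^ 6) g) = \<tau> ! ((k + 6) mod 7)" using e[rule_format, of 6] by (simp add: add.commute)
    moreover have "k = 0 \<longrightarrow> anchored A g \<tau>" using e \<tau> assms(1) by (auto simp: anchored_def)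
    ultimately show ?thesis using \<tau> by blast
  next
    assume e: "\<forall>i. ell ((A ^^ i) g) = \<tau> ! ((6 * i + k) mod 7)"
    have "\<tau> ! k = l" using e[rule_format, of 0] assms(2) \<tau>(2) by simp
    moreover have "ell (A g) = \<tau> ! ((k + 6) mod 7)" using e[rule_format, of 1] by (simp add: add.commute)
    moreover have "ell ((A ^^ 6) g) = \<tau> ! ((k + 1) mod 7)"
    proof -
      have "6 * 6 + k = k + 1 + 7 * 5" by simp
      then have "(6 * 6 + k) mod 7 = (k + 1) mod 7" by (metis mod_mult_self2)
      then show ?thesis using e[rule_format, of 6] by simp
    qed
    ultimately show ?thesis using \<tau> by blast
  qed
qed

definition anch :: "(complex \<Rightarrow> complex) \<Rightarrow> bool" where "anch g \<longleftrightarrow> (\<exists>\<tau>. anchored A g \<tau>)"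

lemma look_P1:
  assumes "g \<in> frames" "ell g = V P1 q v"
  shows "\<exists>b q' c c' u u'. anch g \<and> ell (A g) = H HBA q b q' c \<and> ell ((A ^^ 6) g) = H HAA q b q' c' \<or>
    ell (A g) = H HAA q b q' c' \<and> ell ((A ^^ 6) g) = H HBA q b q' c \<or>
    ell (A g) = V P2 q u \<and> ell ((A ^^ 6) g) = V PR q u' \<or>
    ell (A g) = V PR q u' \<and> ell ((A ^^ 6) g) = V P2 q u"
proof -
  obtain \<tau> k where "\<tau> \<in> tiles" "k < 7" "\<tau> ! k = V P1 q v" and
    h: "(ell (A g) = \<tau> ! ((k + 1) mod 7) \<and> ell ((A ^^ 6) g) = \<tau> ! ((k + 6) mod 7) \<and> (k = 0 \<longrightarrow> anchored A g \<tau>)) \<or>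
     (ell (A g) = \<tau> ! ((k + 6) mod 7) \<and> ell ((A ^^ 6) g) = \<tau> ! ((k + 1) mod 7))"
    using look[OF assms] by blast
  from around_P1[OF this(1-3)] h show ?thesis unfolding anch_def by metis
qed

lemma look_P2:
  assumes "g \<in> frames" "ell g = V P2 q v"
  shows "\<exists>b q' c c' u u'. anch g \<and> ell (A g) = H HAA q b q' c \<and> ell ((A ^^ 6) g) = H HAB q b q' c' \<or>
    ell (A g) = H HAB q b q' c' \<and> ell ((A ^^ 6) g) = H HAA q b q' c \<or>
    ell (A g) = V PL q u \<and> ell ((A ^^ 6) g) = V P1 q u' \<or>
    ell (A g) = V P1 q u' \<and> ell ((A ^^ 6) g) = V PL q u"
proof -
  obtain \<tau> k where "\<tau> \<in> tiles" "k < 7" "\<tau> ! k = V P2 q v" and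
    h: "(ell (A g) = \<tau> ! ((k + 1) mod 7) \<and> ell ((A ^^ 6) g) = \<tau> ! ((k + 6) mod 7) \<and> (k = 0 \<longrightarrow> anchored A g \<tau>)) \<or>
     (ell (A g) = \<tau> ! ((k + 6) mod 7) \<and> ell ((A ^^ 6) g) = \<tau> ! ((k + 1) mod 7))"
    using look[OF assms] by blast
  from around_P2[OF this(1-3)] h show ?thesis unfolding anch_def by metis
qed

lemma look_P3:
  assumes "g \<in> frames" "ell g = V P3 q v"
  shows "\<exists>b q' c c' u u'. anch g \<and> ell (A g) = H HBA q b q' c \<and> ell ((A ^^ 6) g) = H HAB q b q' c' \<or>
    ell (A g) = H HAB q b q' c' \<and> ell ((A ^^ 6) g) = H HBA q b q' c \<or>
    ell (A g) = V PL q u \<and> ell ((A ^^ 6) g) = V PR q u' \<or>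
    ell (A g) = V PR q u' \<and> ell ((A ^^ 6) g) = V PL q u"
proof -
  obtain \<tau> k where "\<tau> \<in> tiles" "k < 7" "\<tau> ! k = V P3 q v" and
    h: "(ell (A g) = \<tau> ! ((k + 1) mod 7) \<and> ell ((A ^^ 6) g) = \<tau> ! ((k + 6) mod 7) \<and> (k = 0 \<longrightarrow> anchored A g \<tau>)) \<or>
     (ell (A g) = \<tau> ! ((k + 6) mod 7) \<and> ell ((A ^^ 6) g) = \<tau> ! ((k + 1) mod 7))"
    using look[OF assms] by blast
  from around_P3[OF this(1-3)] h show ?thesis unfolding anch_def by metis
qed

lemma look_PL:
  assumes "g \<in> frames" "ell g = V PL q v"
  obtains (anchored) b q' c u where "anch g" "ell (A g) = H HAB q b q' c" "ell ((A ^^ 6) g) = V PR q u"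
  | (mirror) b q' c u where "ell (A g) = V PR q u" "ell ((A ^^ 6) g) = H HAB q b q' c"
  | (kid) q0 b c h u where "(q0, b, q) \<in> rules"
      "ell (A g) = H h q0 b q c \<and> (ell ((A ^^ 6) g) = V P2 q u \<or> ell ((A ^^ 6) g) = V P3 q u \<and> h = HBA) \<or>
       ell ((A ^^ 6) g) = H h q0 b q c \<and> (ell (A g) = V P2 q u \<or> ell (A g) = V P3 q u \<and> h = HBA)"
proof -
  obtain \<tau> k where "\<tau> \<in> tiles" "k < 7" "\<tau> ! k = V PL q v" and
    h: "(ell (A g) = \<tau> ! ((k + 1) mod 7) \<and> ell ((A ^^ 6) g) = \<tau> ! ((k + 6) mod 7) \<and> (k = 0 \<longrightarrow> anchored A g \<tau>)) \<or>
     (ell (A g) = \<tau> ! ((k + 6) mod 7) \<and> ell ((A ^^ 6) g) = \<tau> ! ((k + 1) mod 7))"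
    using look[OF assms] by blast
  from around_PL[OF this(1-3)] h that show thesis unfolding anch_def by metis
qed

text \<open>Consecutive faces around \<open>g\<close> share an edge, which is edge 6 of the former
  and edge 1 of the latter.\<close>

lemma edge_next:
  assumes "g \<in> frames"
  shows "ell ((A ^^ 6) (nbr A i g)) = ell (A (nbr A (Suc i) g))"
proof -
  have f: "nbr A i g \<in> frames" using frames_nbr[OF rot assms] .
  have "be ((A ^^ 6) (nbr A i g)) = A (right_of A P1 (nbr A i g))"
    using edge_right[OF rot f, of P1] by (simp add: nbr_def right_index_def)
  also have "right_of A P1 (nbr A i g) = nbr A (Suc i) g" by (rule right_of_sibling[OF rot assms]) simp
  finally show ?thesis using ell_be[OF frames_pow[OF rot f, of 6]] by simp
qed

text \<open>Here the labels force the orientation. A priori a face below could be reflected, or be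
  itself a parent meeting this one head-on; the edges between consecutive children exclude
  both.\<close>

lemma kid_anchored:
  assumes a: "anchored A g \<tau>" and \<tau>: "\<tau> = tile r q b q' v ws cL cR" "r \<noteq> PR" and j: "j < nkids r"
  shows "anch (nbr A (3 + j) g)" "ell (nbr A (3 + j) g) = V (kid_role r j) q' (ws ! j)"
proof -
  have g: "g \<in> frames" using a by (simp add: anchored_def)
  note f = frames_nbr[OF rot g]
  have l: "ell (nbr A i g) = \<tau> ! i" if "i < 7" for i
    using a that ell_be[OF frames_pow[OF rot g]] by (simp add: anchored_def nbr_def)
  have "3 + j < 7" using j by (auto simp: nkids_def split: if_splits)
  then show "ell (nbr A (3 + j) g) = V (kid_role r j) q' (ws ! j)"
    using l[of "3 + j"] tile_kid[OF j] \<tau>(1) by simp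
  have e34: "ell ((A ^^ 6) (nbr A 3 g)) = ell (A (nbr A 4 g))" and e45: "ell ((A ^^ 6) (nbr A 4 g)) = ell (A (nbr A 5 g))"
    using edge_next[OF g, of 3] edge_next[OF g, of 4] by simp_all
  show "anch (nbr A (3 + j) g)"
  proof (cases "is_A r")
    case True
    have l3: "ell (nbr A 3 g) = V P1 q' (ws ! 0)" and l4: "ell (nbr A 4 g) = V P2 q' (ws ! 1)" and l5: "ell (nbr A 5 g) = V PL q' (ws ! 2)"
      using l[of 3] l[of 4] l[of 5] \<tau>(1) True by (simp_all add: tile_A)
    note k3 = look_P1[OF f l3] and k4 = look_P2[OF f l4]
    \<comment> \<open>Among the labels possible for the edge between the two children, only the type
      \<open>HAA\<close> occurs on both sides, and there both are anchored.\<close>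
    from k3 k4 e34 have a3: "anch (nbr A 3 g)" by auto
    from k3 k4 e34 obtain b2 q2 c2 where a4: "anch (nbr A 4 g)" "ell ((A ^^ 6) (nbr A 4 g)) = H HAB q' b2 q2 c2" by auto
    \<comment> \<open>Were this face a parent, its horizontal label would have \<open>q'\<close> as
      second state, while the sibling demands \<open>q'\<close> as first one: a rule with equal
      ends.\<close>
    have a5: "anch (nbr A 5 g)"
      using f l5
      by (rule look_PL) (use a4(2) e45 noloop in auto)
    have "j = 0 \<or> j = 1 \<or> j = 2" using j True by (auto simp: nkids_def)
    with a3 a4(1) a5 show ?thesis by auto
  next
    case False
    then have r: "r = PL" using \<tau>(2) by (cases r) auto
    have l3: "ell (nbr A 3 g) = V P3 q' (ws ! 0)" and l4: "ell (nbr A 4 g) = V PL q' (ws ! 1)" and l5: "ell (nbr A 5 g) = H HBA q b q' cR"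
      using l[of 3] l[of 4] l[of 5] \<tau>(1) r by (simp_all add: tile_PL)
    note k3 = look_P3[OF f l3]
    \<comment> \<open>On the right neighbour, which shares a horizontal label with \<open>g\<close>,
      the next edges bear no horizontal label. This rules out the remaining readings of the last
      child.\<close>
    have nh: "ell (A (nbr A 5 g)) \<noteq> H h2 q2 b2 q2' c2" for h2 q2 b2 q2' c2
    proof -
      obtain \<tau>' k where "\<tau>' \<in> tiles" "k < 7" "\<tau>' ! k = H HBA q b q' cR" and
        h: "ell (A (nbr A 5 g)) = \<tau>' ! ((k + 1) mod 7) \<or> ell (A (nbr A 5 g)) = \<tau>' ! ((k + 6) mod 7)"
        using look[OF f l5] by blast
      from around_H[OF this(1-3)] h show ?thesis by metis
    qed
    have "anch (nbr A 4 g) \<and> (\<exists>b2 q2 c2. ell (A (nbr A 4 g)) = H HAB q' b2 q2 c2)"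
      using f l4
    proof (rule look_PL)
      fix q0 b2 c h u assume "(q0, b2, q') \<in> rules" and
        "ell (A (nbr A 4 g)) = H h q0 b2 q' c \<and> (ell ((A ^^ 6) (nbr A 4 g)) = V P2 q' u \<or> ell ((A ^^ 6) (nbr A 4 g)) = V P3 q' u \<and> h = HBA) \<or>
       ell ((A ^^ 6) (nbr A 4 g)) = H h q0 b2 q' c \<and> (ell (A (nbr A 4 g)) = V P2 q' u \<or> ell (A (nbr A 4 g)) = V P3 q' u \<and> h = HBA)"
      then show ?thesis using k3 e34 e45 nh noloop by auto
    qed (use e45 nh in auto)
    with k3 e34 have a: "anch (nbr A 3 g)" "anch (nbr A 4 g)" by auto
    have "j = 0 \<or> j = 1" using j r by (auto simp: nkids_def)
    with a show ?thesis by auto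
  qed
qed

section \<open>Rows of anchored faces\<close>

definition ro :: "(complex \<Rightarrow> complex) \<Rightarrow> role" where "ro g = (case ell g of V r q v \<Rightarrow> r | _ \<Rightarrow> PR)"
definition vc :: "(complex \<Rightarrow> complex) \<Rightarrow> nat list" where "vc g = (case ell g of V r q v \<Rightarrow> v | _ \<Rightarrow> [])"
definition kids :: "(complex \<Rightarrow> complex) \<Rightarrow> (complex \<Rightarrow> complex) list" where
  "kids g = map (\<lambda>j. nbr A (3 + j) g) [0..<nkids (ro g)]"

lemma anchE:
  assumes "anch g"
  obtains r q b q' v ws cL cR where "g \<in> frames" "r \<noteq> PR" "(q, b, q') \<in> rules" "okv v"
    "length ws = nkids r" "\<forall>w\<in>set ws. okv w" "okc b cL" "okc b cR" "balanced b v ws cL cR"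
    "ell g = V r q v" "ell (A g) = H (left_type r) q b q' cL" "ell ((A ^^ right_index r) g) = H (right_type r) q b q' cR"
    "ro g = r" "vc g = v" "\<And>j. j < nkids r \<Longrightarrow> anch (nbr A (3 + j) g) \<and> ell (nbr A (3 + j) g) = V (kid_role r j) q' (ws ! j)"
proof -
  obtain \<tau> where \<tau>: "anchored A g \<tau>" using assms by (auto simp: anch_def)
  then have "\<tau> \<in> tiles" by (simp add: anchored_def)
  then obtain r q b q' v ws cL cR where t: "\<tau> = tile r q b q' v ws cL cR" "r \<noteq> PR" "(q, b, q') \<in> rules" "okv v"
     "length ws = nkids r" "\<forall>w\<in>set ws. okv w" "okc b cL" "okc b cR" "balanced b v ws cL cR" by (rule tilesE)
  have g: "g \<in> frames" and l: "\<And>i. i < 7 \<Longrightarrow> ell ((A ^^ i) g) = \<tau> ! i" using \<tau> by (auto simp: anchored_def)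
  have l0: "ell g = V r q v" using l[of 0] t(1) tile_0(1) by simp
  have l1: "ell (A g) = H (left_type r) q b q' cL" using l[of 1] t(1) tile_0(2)[of r q b q' v ws cL cR] by simp
  have lr: "ell ((A ^^ right_index r) g) = H (right_type r) q b q' cR"
    using l[OF last_kid_index(2)] t(1) tile_right by simp
  show thesis
    using that[OF g t(2-9) l0 l1 lr] l0 kid_anchored[OF \<tau> t(1,2)] by (simp add: ro_def vc_def)
qed

abbreviation chain :: "(complex \<Rightarrow> complex) list \<Rightarrow> bool" where
  "chain \<equiv> successively (\<lambda>g h. h = right_of A (ro g) g)"

lemma kids_props:
  assumes "anch g"
  shows "\<forall>h\<in>set (kids g). anch h" "chain (kids g)" "kids g \<noteq> []" "hd (kids g) = nbr A 3 g"
    "last (kids g) = nbr A (2 + nkids (ro g)) g" "ro (last (kids g)) = PL"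
    "2 \<le> length (kids g)" "length (kids g) \<le> 3"
proof -
  obtain r q' ws where g: "g \<in> frames" "ro g = r" and
    k: "\<And>j. j < nkids r \<Longrightarrow> anch (nbr A (3 + j) g) \<and> ell (nbr A (3 + j) g) = V (kid_role r j) q' (ws ! j)"
    using assms by (elim anchE) blast
  have rk: "ro (nbr A (3 + j) g) = kid_role r j" if "j < nkids r" for j using k[OF that] by (simp add: ro_def)
  show "\<forall>h\<in>set (kids g). anch h" using k g by (auto simp: kids_def)
  show "kids g \<noteq> []" "hd (kids g) = nbr A 3 g" "2 \<le> length (kids g)" "length (kids g) \<le> 3"
    by (auto simp: kids_def nkids_def upt_rec)
  show l: "last (kids g) = nbr A (2 + nkids (ro g)) g"
    by (simp add: kids_def nkids_def last_map)
  have "nkids r - 1 < nkids r" "3 + (nkids r - 1) = 2 + nkids r" by (auto simp: nkids_def)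
  then show "ro (last (kids g)) = PL" using rk[of "nkids r - 1"] last_kid(2)[of r] g(2) l by metis
  show "chain (kids g)"
    unfolding successively_conv_nth
  proof (intro allI impI)
    fix i assume "Suc i < length (kids g)"
    then have i: "Suc i < nkids r" using g by (simp add: kids_def)
    have A': "is_A (kid_role r i)"
      using i by (auto simp: nkids_def kid_role_def less_Suc_eq numeral_eq_Suc split: if_splits)
    have "kids g ! i = nbr A (3 + i) g" "kids g ! Suc i = nbr A (Suc (3 + i)) g"
      using i g by (simp_all add: kids_def)
    then show "kids g ! Suc i = right_of A (ro (kids g ! i)) (kids g ! i)"
      using right_of_sibling[OF rot g(1) A', of "3 + i"] rk[of i] i by simp
  qed
qed

lemma kids_row:
  assumes "chain xs" "\<forall>g\<in>set xs. anch g"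
  shows "chain (concat (map kids xs))" "\<forall>g\<in>set (concat (map kids xs)). anch g"
    "2 * length xs \<le> length (concat (map kids xs))" "length (concat (map kids xs)) \<le> 3 * length xs"
proof -
  show "\<forall>g\<in>set (concat (map kids xs)). anch g" using assms(2) kids_props(1) by auto
  show "2 * length xs \<le> length (concat (map kids xs))" using assms(2)
  proof (induction xs)
    case (Cons x xs) then show ?case using kids_props(7)[of x] by simp
  qed simp
  show "length (concat (map kids xs)) \<le> 3 * length xs" using assms(2)
  proof (induction xs)
    case (Cons x xs) then show ?case using kids_props(8)[of x] by simp
  qed simp
  show "chain (concat (map kids xs))" using assms
  proof (induction xs)
    case (Cons x xs)
    show ?case
    proof (cases xs)
      case Nil
      then show ?thesis using kids_props(2)[of x] Cons.prems by simp
    next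
      case (Cons y ys)
      have x: "anch x" "anch y" and y: "y = right_of A (ro x) x" using Cons.prems Cons by auto
      have xf: "x \<in> frames" using x(1) by (elim anchE)
      have "hd (concat (map kids xs)) = nbr A 3 y" using kids_props(3,4)[OF x(2)] Cons by simp
      also have "\<dots> = right_of A PL (nbr A (2 + nkids (ro x)) x)"
        using right_of_last[OF rot xf, of PL "ro x"] y by simp
      also have "\<dots> = right_of A (ro (last (kids x))) (last (kids x))"
        using kids_props(5,6)[OF x(1)] by simp
      finally have "hd (concat (map kids xs)) = right_of A (ro (last (kids x))) (last (kids x))" .
      moreover have "chain xs" using Cons.prems(1) unfolding Cons by (metis successively.simps(3))
      then have "chain (concat (map kids xs))" using Cons.IH Cons.prems(2) by simp
      ultimately show ?thesis
        using kids_props(2)[OF x(1)] by (simp add: successively_append_iff)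
    qed
  qed simp
qed

text \<open>Adjacent faces share their horizontal label: this spreads one rule over the whole chain
  and makes the carries telescope.\<close>

lemma row_sum:
  assumes "chain xs" "\<forall>g\<in>set xs. anch g" "xs \<noteq> []"
  shows "\<exists>q b q' cL cR. (q, b, q') \<in> rules \<and> okc b cL \<and> okc b cR \<and>
    (\<exists>t. ell (A (hd xs)) = H t q b q' cL) \<and> (\<exists>r v. ell (hd xs) = V r q v) \<and> (\<exists>r v. ell (nbr A 3 (hd xs)) = V r q' v) \<and>
    (\<forall>k<length (cons b). 0 \<le> (\<Sum>g\<leftarrow>xs. dot (fst (cons b ! k)) (vc g)) +
      (\<Sum>h\<leftarrow>concat (map kids xs). dot (snd (cons b ! k)) (vc h)) + cL ! k - cR ! k)"
  using assms
proof (induction xs)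
  case (Cons x xs)
  have "anch x" using Cons.prems by simp
  then obtain r q b q' v ws cL cR where x: "x \<in> frames" "(q, b, q') \<in> rules" "length ws = nkids r" "okc b cL" "okc b cR" "balanced b v ws cL cR"
    "ell x = V r q v" "ell (A x) = H (left_type r) q b q' cL" "ell ((A ^^ right_index r) x) = H (right_type r) q b q' cR"
    "ro x = r" "vc x = v" and k: "\<And>j. j < nkids r \<Longrightarrow> anch (nbr A (3 + j) x) \<and> ell (nbr A (3 + j) x) = V (kid_role r j) q' (ws ! j)"
    by (rule anchE) blast
  have k0: "ell (nbr A 3 x) = V (kid_role r 0) q' (ws ! 0)" using k[of 0] by (simp add: nkids_def)
  have ws: "map vc (kids x) = ws"
  proof (rule nth_equalityI)
    fix i assume "i < length (map vc (kids x))"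
    then have "i < nkids r" using x(10) by (simp add: kids_def)
    then show "map vc (kids x) ! i = ws ! i" using k[of i] x(10) by (simp add: kids_def vc_def)
  qed (simp add: kids_def x(3,10))
  have s: "(\<Sum>h\<leftarrow>kids x. dot f (vc h)) = (\<Sum>w\<leftarrow>ws. dot f w)" for f
    unfolding ws[symmetric] by (simp add: comp_def)
  have bal: "0 \<le> dot (fst (cons b ! k)) (vc x) + (\<Sum>h\<leftarrow>kids x. dot (snd (cons b ! k)) (vc h)) + cL ! k - cR ! k"
    if "k < length (cons b)" for k
    using x(6,11) that unfolding s by (simp add: balanced_def)
  show ?case
  proof (cases xs)
    case Nil
    then show ?thesis using x k0 bal
      by (intro exI[of _ q] exI[of _ b] exI[of _ q'] exI[of _ cL] exI[of _ cR]) auto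
  next
    case (Cons y ys)
    then have y: "y = right_of A (ro x) x" using Cons.prems by simp
    have "chain xs" using Cons.prems(1) unfolding Cons by (metis successively.simps(3))
    then obtain q2 b2 q2' cL2 cR2 t where IH: "(q2, b2, q2') \<in> rules" "okc b2 cL2" "okc b2 cR2"
      "ell (A (hd xs)) = H t q2 b2 q2' cL2"
      "\<forall>k<length (cons b2). 0 \<le> (\<Sum>g\<leftarrow>xs. dot (fst (cons b2 ! k)) (vc g)) +
      (\<Sum>h\<leftarrow>concat (map kids xs). dot (snd (cons b2 ! k)) (vc h)) + cL2 ! k - cR2 ! k"
      using Cons.IH Cons.prems(2) Cons by auto
    have "ell (A y) = ell ((A ^^ right_index r) x)"
      using edge_right[OF rot x(1), of r] ell_be[OF frames_pow[OF rot x(1), of "right_index r"]] y x(10)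
      by (simp add: nbr_def)
    then have e: "q2 = q" "b2 = b" "q2' = q'" "cL2 = cR" using IH(4) x(9) Cons by auto
    have fin: "0 \<le> (\<Sum>g\<leftarrow>x # xs. dot (fst (cons b ! k)) (vc g)) +
      (\<Sum>h\<leftarrow>concat (map kids (x # xs)). dot (snd (cons b ! k)) (vc h)) + cL ! k - cR2 ! k" if "k < length (cons b)" for k
      using bal[OF that] IH(5)[unfolded e, rule_format, OF that] by simp
    show ?thesis
    proof (intro exI conjI allI impI)
      show "(q, b, q') \<in> rules" "okc b cL" "okc b cR2" using x(2,4) IH(3) e by auto
      show "ell (A (hd (x # xs))) = H (left_type r) q b q' cL" "ell (hd (x # xs)) = V r q v"
        "ell (nbr A 3 (hd (x # xs))) = V (kid_role r 0) q' (ws ! 0)" using x(7,8) k0 by auto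
    qed (rule fin)
  qed
qed simp

end

text \<open>The rows are the generations of descendants of one anchored face. Only the two outermost
  carries survive, whence the error \<open>2 * Bc\<close>, while the rows grow at least like
  2^n.\<close>

theorem row_densities:
  assumes d: "0 < d"
  shows "\<exists>Q b VV. (\<forall>n::nat. (Q n, b n, Q (Suc n)) \<in> rules \<and> 2 ^ n \<le> VV n 0 \<and>
    (\<forall>i<d. 0 \<le> VV n i \<and> VV n i \<le> int Bv * VV n 0) \<and> VV (Suc n) 0 \<le> 3 * int Bv * VV n 0 \<and>
    (\<forall>(f, g)\<in>set (cons (b n)). - 2 * Bc \<le> (\<Sum>i<d. f i * VV n i) + (\<Sum>i<d. g i * VV (Suc n) (i::nat))))"
proof -
  obtain A g0 \<tau> where A: "A = al \<or> A = al ^^ 6" and a0: "anchored A g0 \<tau>" using start by blast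
  define row where "row n = ((\<lambda>xs. concat (map (kids A) xs)) ^^ n) [g0]" for n
  have row_Suc: "row (Suc n) = concat (map (kids A) (row n))" for n by (simp add: row_def)
  have row: "chain A (row n) \<and> (\<forall>g\<in>set (row n). anch A g) \<and> 2 ^ n \<le> length (row n)" for n
  proof (induction n)
    case 0
    then show ?case using a0 by (auto simp: row_def anch_def[OF A])
  next
    case (Suc n)
    then have c: "chain A (row n)" "\<forall>g\<in>set (row n). anch A g" and l: "2 ^ n \<le> length (row n)" by blast+
    have "2 ^ Suc n \<le> 2 * length (row n)" using l by simp
    also note kids_row(3)[OF A c]
    finally show ?case unfolding row_Suc using kids_row(1,2)[OF A c] by blast
  qed
  have ne: "row n \<noteq> []" for n
  proof
    assume "row n = []"
    then have "(2::nat) ^ n \<le> 0" using row[of n] by simp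
    then show False by simp
  qed
  define VV where "VV n i = (\<Sum>g\<leftarrow>row n. int (vc g ! i))" for n i
  have swap: "(\<Sum>g\<leftarrow>xs. dot f (vc g)) = (\<Sum>i<d. f i * (\<Sum>g\<leftarrow>xs. int (vc g ! i)))" for f xs
    by (induction xs) (simp_all add: dot_def distrib_left sum.distrib)
  define Q where "Q n = (case ell (hd (row n)) of V r q v \<Rightarrow> q)" for n
  define good where "good n b \<longleftrightarrow> (Q n, b, Q (Suc n)) \<in> rules \<and> (\<forall>(f, g)\<in>set (cons b). - 2 * Bc \<le> (\<Sum>i<d. f i * VV n i) + (\<Sum>i<d. g i * VV (Suc n) i))" for n b
  have ex: "\<exists>b. good n b" for n
  proof -
    obtain q b q' cL cR where h: "(q, b, q') \<in> rules" "okc b cL" "okc b cR" "\<exists>r v. ell (hd (row n)) = V r q v"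
      "\<exists>r v. ell (nbr A 3 (hd (row n))) = V r q' v"
      "\<forall>k<length (cons b). 0 \<le> (\<Sum>g\<leftarrow>row n. dot (fst (cons b ! k)) (vc g)) +
      (\<Sum>h\<leftarrow>concat (map (kids A) (row n)). dot (snd (cons b ! k)) (vc h)) + cL ! k - cR ! k"
      using row_sum[OF A conjunct1[OF row] conjunct1[OF conjunct2[OF row]] ne, of n] by blast
    have "hd (row (Suc n)) = nbr A 3 (hd (row n))"
      using kids_props(3,4)[OF A, of "hd (row n)"] row[of n] ne[of n] unfolding row_Suc by (cases "row n") auto
    then have "Q n = q" "Q (Suc n) = q'" using h(4,5) by (auto simp: Q_def)
    moreover have "- 2 * Bc \<le> (\<Sum>i<d. fst (cons b ! k) i * VV n i) + (\<Sum>i<d. snd (cons b ! k) i * VV (Suc n) i)"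
      if k: "k < length (cons b)" for k
    proof -
      have "\<bar>cL ! k\<bar> \<le> Bc" "\<bar>cR ! k\<bar> \<le> Bc" using h(2,3) k by (auto simp: okc_def)
      then show ?thesis using h(6)[rule_format, OF k] unfolding row_Suc[symmetric] swap VV_def[symmetric] by linarith
    qed
    then have "\<forall>(f, g)\<in>set (cons b). - 2 * Bc \<le> (\<Sum>i<d. f i * VV n i) + (\<Sum>i<d. g i * VV (Suc n) i)"
      by (fastforce simp: in_set_conv_nth)
    ultimately show ?thesis using h(1) unfolding good_def by blast
  qed
  obtain b where "\<And>n. good n (b n)" using ex by metis
  then have b: "\<forall>n. (Q n, b n, Q (Suc n)) \<in> rules \<and> (\<forall>(f, g)\<in>set (cons (b n)). - 2 * Bc \<le> (\<Sum>i<d. f i * VV n i) + (\<Sum>i<d. g i * VV (Suc n) i))"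
    unfolding good_def by (rule allI)
  have ok: "okv (vc g)" if g: "g \<in> set (row n)" for g n
  proof -
    have "anch A g" using row[of n] g by blast
    then show ?thesis by (rule anchE[OF A]) simp
  qed
  have low: "int (length xs) \<le> (\<Sum>g\<leftarrow>xs. int (vc g ! 0))" if "\<forall>g\<in>set xs. okv (vc g)" for xs
    using that by (induction xs) (auto simp: okv_def)
  have up: "0 \<le> (\<Sum>g\<leftarrow>xs. int (vc g ! i)) \<and> (\<Sum>g\<leftarrow>xs. int (vc g ! i)) \<le> int Bv * int (length xs)" if "\<forall>g\<in>set xs. okv (vc g)" "i < d" for xs i
    using that by (induction xs) (fastforce simp: okv_def algebra_simps)+
  have len: "int (length (row n)) \<le> VV n 0" for n unfolding VV_def using low ok by blast
  have "2 ^ n \<le> VV n 0" for n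
    using len[of n] row[of n] by (metis of_nat_le_iff of_nat_numeral of_nat_power order_trans)
  moreover have "0 \<le> VV n i \<and> VV n i \<le> int Bv * VV n 0" if "i < d" for n i
  proof -
    have "0 \<le> VV n i \<and> VV n i \<le> int Bv * int (length (row n))" unfolding VV_def using up ok that by blast
    moreover have "int Bv * int (length (row n)) \<le> int Bv * VV n 0" using len by (intro mult_left_mono) auto
    ultimately show ?thesis by linarith
  qed
  moreover have "VV (Suc n) 0 \<le> 3 * int Bv * VV n 0" for n
  proof -
    have "VV (Suc n) 0 \<le> int Bv * int (length (row (Suc n)))" unfolding VV_def using up ok d by blast
    also have "\<dots> \<le> int Bv * (3 * int (length (row n)))"
      using kids_row(4)[OF A, of "row n"] row[of n] unfolding row_Suc by (intro mult_left_mono) (simp_all flip: of_nat_le_iff)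
    also have "\<dots> \<le> int Bv * (3 * VV n 0)" using len[of n] by (intro mult_left_mono) auto
    finally show ?thesis by (simp add: algebra_simps)
  qed
  ultimately show ?thesis using b by (intro exI[of _ Q] exI[of _ b] exI[of _ VV]) blast
qed

end

end

section \<open>Passage to limit densities\<close>

lemma common_convergent_subseq:
  fixes F :: "nat \<Rightarrow> nat \<Rightarrow> real"
  assumes "\<And>k N. \<bar>F k N\<bar> \<le> Bd k"
  shows "\<exists>s. strict_mono s \<and> (\<forall>k. convergent (\<lambda>N. F k (s N)))"
proof -
  interpret subseqs "\<lambda>k s. convergent (\<lambda>N. F k (s N))"
  proof
    fix k s assume "strict_mono (s :: nat \<Rightarrow> nat)"
    obtain r where r: "strict_mono r" "monoseq (\<lambda>N. F k (s (r N)))"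
      using seq_monosub[of "\<lambda>N. F k (s N)"] by auto
    have "Bseq (\<lambda>N. F k (s (r N)))"
      by (rule BseqI'[of _ "Bd k"]) (use assms in auto)
    then have "convergent (\<lambda>N. F k (s (r N)))" using r(2) by (rule Bseq_monoseq_convergent)
    then show "\<exists>r'. strict_mono r' \<and> convergent (\<lambda>N. F k ((s \<circ> r') N))" using r(1) by auto
  qed
  have "convergent (\<lambda>N. F k (diagseq N))" for k
  proof -
    have "convergent (\<lambda>N. F k ((diagseq \<circ> ((+) (Suc k))) N))"
    proof (rule diagseq_holds)
      fix r s n assume "strict_mono (r :: nat \<Rightarrow> nat)" "convergent (\<lambda>N. F n (s N))"
      then show "convergent (\<lambda>N. F n ((s \<circ> r) N))"
        using convergent_subseq_convergent[of "\<lambda>N. F n (s N)" r] by (simp add: comp_def)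
    qed
    then show ?thesis
      using convergent_ignore_initial_segment[of "\<lambda>N. F k (diagseq N)" "Suc k"] by (simp add: add.commute)
  qed
  then show ?thesis using subseq_diagseq by blast
qed

text \<open>Lets the rules, numbered by naturals, take part in the same diagonal argument as the
  densities.\<close>

lemma nat_convergent_eventually_const:
  fixes u :: "nat \<Rightarrow> nat"
  assumes "convergent (\<lambda>N. real (u N))"
  shows "\<exists>c. \<forall>\<^sub>F N in sequentially. u N = c"
proof -
  have "Cauchy (\<lambda>N. real (u N))" using assms by (rule convergent_Cauchy)
  from CauchyD[OF this, of 1] obtain M where M: "\<forall>m\<ge>M. \<forall>n\<ge>M. \<bar>real (u m) - real (u n)\<bar> < 1"
    by auto
  have "u N = u M" if "N \<ge> M" for N
    using M[rule_format, OF that, of M] by linarith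
  then show ?thesis by (auto simp: eventually_sequentially)
qed

context kari
begin

text \<open>Row \<open>n\<close> of the orbit is the limit of the rows \<open>N + n\<close>,
  normalised by entry 0, along a subsequence of \<open>N\<close> on which all ratios converge and
  all rules stabilise. Entry 0 tends to infinity with \<open>N\<close>, so the bounded error
  vanishes.\<close>

lemma limit_orbit:
  fixes VV :: "nat \<Rightarrow> nat \<Rightarrow> int"
  assumes fin: "finite rules"
    and h: "\<And>n. (Q n, b n, Q (Suc n)) \<in> rules" "\<And>n. 2 ^ n \<le> VV n 0" "\<And>n i. i < d \<Longrightarrow> 0 \<le> VV n i \<and> VV n i \<le> int Bv * VV n 0"
      "\<And>n. VV (Suc n) 0 \<le> 3 * int Bv * VV n 0"
      "\<And>n f g. (f, g) \<in> set (cons (b n)) \<Longrightarrow> - 2 * Bc \<le> (\<Sum>i<d. f i * VV n i) + (\<Sum>i<d. g i * VV (Suc n) i)"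
  shows "\<exists>Q b x m. \<forall>n::nat. (Q n, b n, Q (Suc n)) \<in> rules \<and> x n 0 = (1::real) \<and> (\<forall>i<d. 0 \<le> x n i) \<and>
    (\<forall>(f, g)\<in>set (cons (b n)). 0 \<le> (\<Sum>i<d. real_of_int (f i) * x n i) + m n * (\<Sum>i<d. real_of_int (g i) * x (Suc n) (i::nat)))"
proof -
  obtain e :: "'q \<times> 'b \<times> 'q \<Rightarrow> nat" and E where e: "e ` rules = {i. i < E}" "inj_on e rules"
    using finite_imp_inj_to_nat_seg[OF fin] by metis
  let ?R = "\<lambda>n. (Q n, b n, Q (Suc n))"
  have pos: "0 < VV n 0" for n
    using h(2)[of n] zero_less_power[of "2::int" n] by linarith
  define y where "y n i N = real_of_int (VV (N + n) i) / real_of_int (VV (N + n) 0)" for n i N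
  define mm where "mm n N = real_of_int (VV (Suc (N + n)) 0) / real_of_int (VV (N + n) 0)" for n N
  \<comment> \<open>One enumeration of all sequences that must converge: growth ratios, numbers of
    rules, and densities.\<close>
  define F where "F k N = (case prod_decode k of (n, j) \<Rightarrow> if j = 0 then mm n N else if j = 1 then real (e (?R (N + n)))
    else if j - 2 < d then y n (j - 2) N else 0)" for k N
  have bd: "\<bar>F k N\<bar> \<le> 3 * real Bv + real E + real Bv" for k N
  proof -
    obtain n j where k: "prod_decode k = (n, j)" by (cases "prod_decode k")
    have "0 \<le> VV (Suc (N + n)) 0" using pos[of "Suc (N + n)"] by simp
    then have "0 \<le> mm n N" "mm n N \<le> 3 * real Bv"
    proof -
      show "0 \<le> mm n N" using pos[of "N + n"] pos[of "Suc (N + n)"] by (simp add: mm_def)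
      have "real_of_int (VV (Suc (N + n)) 0) \<le> real_of_int (3 * int Bv * VV (N + n) 0)" using h(4) by (simp only: of_int_le_iff)
      then show "mm n N \<le> 3 * real Bv" using pos[of "N + n"] by (simp add: mm_def divide_le_eq)
    qed
    moreover have "0 \<le> y n i N \<and> y n i N \<le> real Bv" if "i < d" for i
    proof -
      have "real_of_int (VV (N + n) i) \<le> real_of_int (int Bv * VV (N + n) 0)" using h(3)[OF that] by (simp only: of_int_le_iff)
      then show ?thesis using pos[of "N + n"] h(3)[OF that, of "N + n"] by (simp add: y_def divide_le_eq)
    qed
    moreover have "e (?R (N + n)) < E" using e(1) h(1)[of "N + n"] by blast
    ultimately show ?thesis unfolding F_def k by (auto simp: abs_le_iff)
      (smt (verit) of_nat_0_le_iff)+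
  qed
  obtain s where s: "strict_mono s" and conv: "\<And>k. convergent (\<lambda>N. F k (s N))"
    using common_convergent_subseq[of F, OF bd] by blast
  have c0: "convergent (\<lambda>N. mm n (s N))" for n using conv[of "prod_encode (n, 0)"] by (simp add: F_def)
  have c1: "convergent (\<lambda>N. real (e (?R (s N + n))))" for n using conv[of "prod_encode (n, 1)"] by (simp add: F_def)
  have c2: "convergent (\<lambda>N. y n i (s N))" if "i < d" for n i
    using conv[of "prod_encode (n, i + 2)"] that by (simp add: F_def)
  define m where "m n = lim (\<lambda>N. mm n (s N))" for n
  define x where "x n i = lim (\<lambda>N. y n i (s N))" for n i
  have m: "(\<lambda>N. mm n (s N)) \<longlonglongrightarrow> m n" for n using c0 by (simp add: m_def convergent_LIMSEQ_iff)
  have x: "(\<lambda>N. y n i (s N)) \<longlonglongrightarrow> x n i" if "i < d" for n i using c2[OF that] by (simp add: x_def convergent_LIMSEQ_iff)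
  define const where "const n R \<longleftrightarrow> (\<forall>\<^sub>F N in sequentially. ?R (s N + n) = R)" for n R
  have "\<exists>R. const n R" for n
  proof -
    obtain c where c: "\<forall>\<^sub>F N in sequentially. e (?R (s N + n)) = c"
      using nat_convergent_eventually_const[OF c1] by blast
    then have "\<forall>\<^sub>F N in sequentially. ?R (s N + n) = inv_into rules e c"
      by eventually_elim (use e(2) h(1) inv_into_f_f in metis)
    then show ?thesis unfolding const_def by blast
  qed
  then obtain R where "\<And>n. const n (R n)" by metis
  then have R: "\<forall>\<^sub>F N in sequentially. ?R (s N + n) = R n" for n by (simp add: const_def)
  have s_ge: "N \<le> s N" for N using s by (rule strict_mono_imp_increasing)
  show ?thesis
  proof (rule exI[of _ "\<lambda>n. fst (R n)"], rule exI[of _ "\<lambda>n. fst (snd (R n))"], rule exI[of _ x], rule exI[of _ m], intro allI conjI impI)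
    fix n
    have "\<forall>\<^sub>F N in sequentially. (fst (R n), fst (snd (R n)), fst (R (Suc n))) \<in> rules"
      using R[of n] R[of "Suc n"] by eventually_elim (metis h(1) add_Suc_right fst_conv snd_conv)
    then show "(fst (R n), fst (snd (R n)), fst (R (Suc n))) \<in> rules" by simp
    show "x n 0 = 1"
      unfolding x_def y_def using pos by (simp add: less_imp_neq[symmetric])
    show "0 \<le> x n i" if "i < d" for i
    proof (rule LIMSEQ_le_const[OF x[OF that]])
      show "\<exists>N. \<forall>k\<ge>N. 0 \<le> y n i (s k)" using h(3)[OF that] pos by (auto simp: y_def less_imp_le)
    qed
    show "\<forall>(f, g)\<in>set (cons (fst (snd (R n)))). 0 \<le> (\<Sum>i<d. real_of_int (f i) * x n i) + m n * (\<Sum>i<d. real_of_int (g i) * x (Suc n) i)"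
    proof (clarify)
      fix f g assume fg: "(f, g) \<in> set (cons (fst (snd (R n))))"
      let ?l = "\<lambda>N. (\<Sum>i<d. real_of_int (f i) * y n i (s N)) + mm n (s N) * (\<Sum>i<d. real_of_int (g i) * y (Suc n) i (s N))"
      let ?e = "\<lambda>N. - 2 * real_of_int \<bar>Bc\<bar> * (1 / 2) ^ N"
      have l: "?l \<longlonglongrightarrow> (\<Sum>i<d. real_of_int (f i) * x n i) + m n * (\<Sum>i<d. real_of_int (g i) * x (Suc n) i)"
        by (intro tendsto_intros m x) auto
      have z: "?e \<longlonglongrightarrow> - 2 * real_of_int \<bar>Bc\<bar> * 0"
        by (intro tendsto_intros LIMSEQ_power_zero) auto
      have "\<forall>\<^sub>F N in sequentially. ?e N \<le> ?l N"
        using R[of n]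
      proof eventually_elim
        case (elim N)
        let ?E = "real_of_int (VV (s N + n) 0)" and ?E' = "real_of_int (VV (Suc (s N + n)) 0)"
        have E: "0 < ?E" "0 < ?E'" using pos by auto
        have "(f, g) \<in> set (cons (b (s N + n)))" using elim fg by (metis fst_conv snd_conv)
        then have "real_of_int (- 2 * Bc) \<le> real_of_int ((\<Sum>i<d. f i * VV (s N + n) i) + (\<Sum>i<d. g i * VV (Suc (s N + n)) i))"
          using h(5) by (simp only: of_int_le_iff)
        then have "- 2 * real_of_int \<bar>Bc\<bar> \<le> (\<Sum>i<d. real_of_int (f i) * real_of_int (VV (s N + n) i)) + (\<Sum>i<d. real_of_int (g i) * real_of_int (VV (Suc (s N + n)) i))"
          by simp
        then have "- 2 * real_of_int \<bar>Bc\<bar> / ?E \<le> ((\<Sum>i<d. real_of_int (f i) * real_of_int (VV (s N + n) i)) + (\<Sum>i<d. real_of_int (g i) * real_of_int (VV (Suc (s N + n)) i))) / ?E"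
          using E by (intro divide_right_mono) auto
        also have "\<dots> = ?l N"
          using E by (simp add: add_divide_distrib sum_divide_distrib y_def mm_def sum_distrib_left add.assoc)
        finally have "- 2 * real_of_int \<bar>Bc\<bar> / ?E \<le> ?l N" .
        moreover have "?e N \<le> - 2 * real_of_int \<bar>Bc\<bar> / ?E"
        proof -
          have "2 ^ N \<le> (2::int) ^ (s N + n)" using s_ge[of N] by (intro power_increasing) auto
          then have "(2::int) ^ N \<le> VV (s N + n) 0" using h(2)[of "s N + n"] by linarith
          then have "real_of_int (2 ^ N) \<le> ?E" by (simp only: of_int_le_iff)
          then have "1 / ?E \<le> 1 / 2 ^ N" by (intro divide_left_mono) (use E in auto)
          then have "2 * real_of_int \<bar>Bc\<bar> * (1 / ?E) \<le> 2 * real_of_int \<bar>Bc\<bar> * (1 / 2 ^ N)" by (intro mult_left_mono) auto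
          then show ?thesis by (simp add: power_one_over)
        qed
        ultimately show ?case by linarith
      qed
      then have "- 2 * real_of_int \<bar>Bc\<bar> * 0 \<le> (\<Sum>i<d. real_of_int (f i) * x n i) + m n * (\<Sum>i<d. real_of_int (g i) * x (Suc n) i)"
        by (rule tendsto_le[OF sequentially_bot l z])
      then show "0 \<le> (\<Sum>i<d. real_of_int (f i) * x n i) + m n * (\<Sum>i<d. real_of_int (g i) * x (Suc n) i)" by simp
    qed
  qed
qed

theorem tiling_imp_orbit:
  assumes "finite rules" "0 < d" "inj_on num labels" "\<And>q b. (q, b, q) \<notin> rules" "tiles_plane (map num ` tiles)"
  shows "\<exists>Q b x m. \<forall>n::nat. (Q n, b n, Q (Suc n)) \<in> rules \<and> x n 0 = (1::real) \<and> (\<forall>i<d. 0 \<le> x n i) \<and>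
    (\<forall>(f, g)\<in>set (cons (b n)). 0 \<le> (\<Sum>i<d. real_of_int (f i) * x n i) + m n * (\<Sum>i<d. real_of_int (g i) * x (Suc n) (i::nat)))"
proof -
  obtain L where L: "valid_patch (map num ` tiles) centers L" using assms(5) by (auto simp: tiles_plane_def)
  from row_densities[OF assms(3) L assms(4,2)] obtain Q b VV where
    *: "\<forall>n::nat. (Q n, b n, Q (Suc n)) \<in> rules \<and> 2 ^ n \<le> VV n 0 \<and>
    (\<forall>i<d. 0 \<le> VV n i \<and> VV n i \<le> int Bv * VV n 0) \<and> VV (Suc n) 0 \<le> 3 * int Bv * VV n 0 \<and>
    (\<forall>(f, g)\<in>set (cons (b n)). - 2 * Bc \<le> (\<Sum>i<d. f i * VV n i) + (\<Sum>i<d. g i * VV (Suc n) (i::nat)))"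
    by blast
  show ?thesis
    by (rule limit_orbit[OF assms(1), of Q b VV]) (use * in blast)+
qed

end

section \<open>Cells within a ball\<close>

lemma lam_bounds: "0 < lam" "gphi \<le> 2" "1 \<le> len r" "len r \<le> 2"
  using gphi by (auto simp: lam_def len_def)

lemma adjacent_cells:
  assumes "cell t p r g" "adjacent (g 0) y"
  obtains m t' p' r' g' i' where "m < 7" "cell t' p' r' g'" "i' < 7" "nb m g = (al ^^ i') g'" "y = nb m g 0" "y = g' 0" "nb i' g' 0 = g 0"
    "linked t p r m t' p' r' i' \<or> linked t' p' r' i' t p r m"
proof -
  have g: "g \<in> frames" using assms(1) by (rule cell_frames)
  obtain h i where h: "h \<in> frames" "i < 7" "h 0 = g 0" "y = nb i h 0" using assms(2) unfolding adjacent_frame by blast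
  obtain j where j: "h = (al ^^ j) g" using same_center[OF g h(1)] h(3) by metis
  have y: "y = nb ((i + j) mod 7) g 0"
    unfolding h(4) j nbr_def pow_add using pow_mod[OF rotation_al g, of "i + j"] by simp
  obtain t' p' r' g' i' where e: "cell t' p' r' g'" "i' < 7" "nb ((i + j) mod 7) g = (al ^^ i') g'"
    "linked t p r ((i + j) mod 7) t' p' r' i' \<or> linked t' p' r' i' t p r ((i + j) mod 7)"
    using cell_edge[OF assms(1), of "(i + j) mod 7"] by auto
  have "y = g' 0" unfolding y e(3) by (rule al_pow_center)
  moreover have "nb i' g' 0 = g 0"
  proof -
    have "nb i' g' = be (nb ((i + j) mod 7) g)" unfolding e(3) by (simp add: nbr_def)
    also have "\<dots> = (al ^^ ((i + j) mod 7)) g" using be_be[OF frames_al_pow[OF g]] by (simp add: nbr_def)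
    finally show ?thesis by (simp add: al_pow_center)
  qed
  ultimately show thesis using that[of "(i + j) mod 7" t' p' r' g' i'] e y by simp
qed

lemma linked_level: "linked t p r i t' p' r' i' \<Longrightarrow> t \<le> t' \<and> t' \<le> t + 1"
  by (auto simp: linked_def)

text \<open>Crossing an edge changes the row by at most one.\<close>

lemma ball_cell: "y \<in> ball k \<Longrightarrow> \<exists>t p r g. cell t p r g \<and> g 0 = y \<and> \<bar>t\<bar> \<le> int k"
proof (induction k arbitrary: y)
  case 0
  have "root_frame 0 0 = 0" by (simp add: on_disk_def)
  then show ?case using 0 cell.root[of 0] by (metis abs_0 ball.simps(1) minus_zero of_nat_0 order_refl singletonD)
next
  case (Suc k)
  then consider "y \<in> ball k" | x where "x \<in> ball k" "adjacent x y" by auto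
  then show ?case
  proof cases
    case 1
    then show ?thesis using Suc.IH[of y] by fastforce
  next
    case 2
    obtain t p r g where c: "cell t p r g" "g 0 = x" "\<bar>t\<bar> \<le> int k" using Suc.IH[OF 2(1)] by blast
    obtain m t' p' r' g' i' where e: "cell t' p' r' g'" "y = g' 0" "linked t p r m t' p' r' i' \<or> linked t' p' r' i' t p r m"
      using adjacent_cells[OF c(1)] 2(2) c(2) by metis
    have "\<bar>t'\<bar> \<le> int (Suc k)" using e(3) c(3) linked_level[of t p r m t' p' r' i'] linked_level[of t' p' r' i' t p r m] by auto
    with e show ?thesis by metis
  qed
qed

section \<open>From orbits to patches\<close>

context kari
begin

context
  fixes k :: nat and Q :: "int \<Rightarrow> 'q" and b :: "int \<Rightarrow> 'b" and X :: "int \<Rightarrow> nat \<Rightarrow> real" and num :: "('q, 'b) lab \<Rightarrow> nat"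
  assumes d: "0 < d" and rule: "\<And>t. \<bar>t\<bar> \<le> int k \<Longrightarrow> (Q t, b t, Q (t + 1)) \<in> rules"
    and X0: "\<And>t. \<bar>t\<bar> \<le> int k + 1 \<Longrightarrow> 1 \<le> X t 0"
    and X: "\<And>t i. \<bar>t\<bar> \<le> int k + 1 \<Longrightarrow> i < d \<Longrightarrow> 0 \<le> X t i \<and> 2 * X t i + 1 \<le> real Bv"
    and cons: "\<And>t f g. \<bar>t\<bar> \<le> int k \<Longrightarrow> (f, g) \<in> set (cons (b t)) \<Longrightarrow>
      0 \<le> (\<Sum>i<d. real_of_int (f i) * X t i) + lam * (\<Sum>i<d. real_of_int (g i) * X (t + 1) i)"
    and Bc: "\<And>t f g. \<bar>t\<bar> \<le> int k \<Longrightarrow> (f, g) \<in> set (cons (b t)) \<Longrightarrow> (\<Sum>i<d. \<bar>f i\<bar>) + (\<Sum>i<d. \<bar>g i\<bar>) + 1 \<le> Bc"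
begin

definition fl :: "int \<Rightarrow> nat \<Rightarrow> real \<Rightarrow> int" where "fl t i p = \<lfloor>X t i * p\<rfloor>"
definition vec :: "int \<Rightarrow> real \<Rightarrow> role \<Rightarrow> nat list" where
  "vec t p r = map (\<lambda>i. nat (fl t i (p + len r) - fl t i p)) [0..<d]"
text \<open>Total of a constraint per unit of length. The factor \<open>lam\<close> appears because
  position \<open>p\<close> of a row lies above \<open>lam * p\<close> of the next.\<close>

definition slope :: "int \<Rightarrow> (nat \<Rightarrow> int) \<times> (nat \<Rightarrow> int) \<Rightarrow> real" where
  "slope t = (\<lambda>(f, g). (\<Sum>i<d. real_of_int (f i) * X t i) + lam * (\<Sum>i<d. real_of_int (g i) * X (t + 1) i))"
definition cum :: "int \<Rightarrow> real \<Rightarrow> (nat \<Rightarrow> int) \<times> (nat \<Rightarrow> int) \<Rightarrow> int" where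
  "cum t p = (\<lambda>(f, g). (\<Sum>i<d. f i * fl t i p) + (\<Sum>i<d. g i * fl (t + 1) i (lam * p)))"
text \<open>Subtracting the rounded slope keeps the carry bounded and reduces the balance of a tile
  to the increment of a floor.\<close>

definition carry :: "int \<Rightarrow> real \<Rightarrow> int list" where
  "carry t p = map (\<lambda>fg. cum t p fg - \<lfloor>slope t fg * p\<rfloor>) (cons (b t))"

lemma fl_diff: "\<bar>t\<bar> \<le> int k + 1 \<Longrightarrow> i < d \<Longrightarrow> 0 \<le> fl t i (p + len r) - fl t i p"
proof -
  assume "\<bar>t\<bar> \<le> int k + 1" "i < d"
  then have "X t i * p \<le> X t i * (p + len r)" using X[of t i] lam_bounds(3)[of r] by (intro mult_left_mono) auto
  then show ?thesis unfolding fl_def using floor_mono by fastforce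
qed

lemma vec_nth: "\<bar>t\<bar> \<le> int k + 1 \<Longrightarrow> i < d \<Longrightarrow> int (vec t p r ! i) = fl t i (p + len r) - fl t i p"
  using fl_diff[of t i p r] by (simp add: vec_def)

lemma okv_vec:
  assumes t: "\<bar>t\<bar> \<le> int k + 1"
  shows "okv (vec t p r)"
  unfolding okv_def
proof (intro conjI allI impI)
  show "length (vec t p r) = d" by (simp add: vec_def)
  have "X t 0 * p + 1 \<le> X t 0 * (p + len r)"
    using mult_mono[of 1 "X t 0" 1 "len r"] X0[OF t] lam_bounds(3)[of r] by (simp add: distrib_left)
  then have "fl t 0 p + 1 \<le> fl t 0 (p + len r)" unfolding fl_def by linarith
  then show "0 < vec t p r ! 0" using d by (simp add: vec_def)
  fix i assume i: "i < d"
  have "X t i * len r \<le> X t i * 2" using X[OF t i] lam_bounds(4)[of r] by (intro mult_left_mono) auto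
  then have "real_of_int (fl t i (p + len r) - fl t i p) < 2 * X t i + 1"
    unfolding fl_def distrib_left by linarith
  then have "real_of_int (int (vec t p r ! i)) \<le> real Bv" using X[OF t i] vec_nth[OF t i, of p r] by linarith
  then show "vec t p r ! i \<le> Bv" by simp
qed

text \<open>Rounding a term costs at most the absolute value of its coefficient, rounding the slope
  at most 1.\<close>

lemma okc_carry:
  assumes t: "\<bar>t\<bar> \<le> int k"
  shows "okc (b t) (carry t p)"
  unfolding okc_def
proof (intro conjI allI impI)
  show "length (carry t p) = length (cons (b t))" by (simp add: carry_def)
  fix j assume j: "j < length (cons (b t))"
  obtain f g where fg: "cons (b t) ! j = (f, g)" by (cases "cons (b t) ! j")
  then have mem: "(f, g) \<in> set (cons (b t))" using j by (metis nth_mem)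
  have fr: "\<bar>real_of_int (h i) * x - real_of_int (h i * \<lfloor>x\<rfloor>)\<bar> \<le> \<bar>real_of_int (h i)\<bar>" for h :: "nat \<Rightarrow> int" and i x
  proof -
    have "\<bar>real_of_int (h i) * x - real_of_int (h i * \<lfloor>x\<rfloor>)\<bar> = \<bar>real_of_int (h i)\<bar> * \<bar>x - real_of_int \<lfloor>x\<rfloor>\<bar>"
      unfolding abs_mult[symmetric] by (simp add: right_diff_distrib)
    also have "\<dots> \<le> \<bar>real_of_int (h i)\<bar> * 1" by (intro mult_left_mono) linarith+
    finally show ?thesis by simp
  qed
  have s: "\<bar>(\<Sum>i<d. real_of_int (h i) * x i) - real_of_int (\<Sum>i<d. h i * \<lfloor>x i\<rfloor>)\<bar> \<le> real_of_int (\<Sum>i<d. \<bar>h i\<bar>)" for h :: "nat \<Rightarrow> int" and x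
  proof -
    have "(\<Sum>i<d. real_of_int (h i) * x i) - real_of_int (\<Sum>i<d. h i * \<lfloor>x i\<rfloor>) = (\<Sum>i<d. real_of_int (h i) * x i - real_of_int (h i * \<lfloor>x i\<rfloor>))"
      by (simp add: sum_subtractf)
    also have "\<bar>\<dots>\<bar> \<le> (\<Sum>i<d. \<bar>real_of_int (h i)\<bar>)" by (rule order_trans[OF sum_abs sum_mono]) (rule fr)
    finally show ?thesis by simp
  qed
  have "slope t (f, g) * p = (\<Sum>i<d. real_of_int (f i) * (X t i * p)) + (\<Sum>i<d. real_of_int (g i) * (X (t + 1) i * (lam * p)))"
    unfolding slope_def prod.case distrib_right sum_distrib_left sum_distrib_right by (simp only: mult_ac)
  then have "\<bar>slope t (f, g) * p - real_of_int (cum t p (f, g))\<bar> \<le> real_of_int ((\<Sum>i<d. \<bar>f i\<bar>) + (\<Sum>i<d. \<bar>g i\<bar>))"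
    using s[of f "\<lambda>i. X t i * p"] s[of g "\<lambda>i. X (t + 1) i * (lam * p)"] by (simp add: cum_def fl_def)
  then have "\<bar>cum t p (f, g) - \<lfloor>slope t (f, g) * p\<rfloor>\<bar> \<le> (\<Sum>i<d. \<bar>f i\<bar>) + (\<Sum>i<d. \<bar>g i\<bar>) + 1" by linarith
  then show "\<bar>carry t p ! j\<bar> \<le> Bc" using Bc[OF t mem] j fg by (simp add: carry_def)
qed

lemma dot_vec: "\<bar>t\<bar> \<le> int k + 1 \<Longrightarrow> dot f (vec t p r) = (\<Sum>i<d. f i * fl t i (p + len r)) - (\<Sum>i<d. f i * fl t i p)"
  unfolding dot_def by (simp add: vec_nth right_diff_distrib sum_subtractf)

lemma kids_telescope:
  fixes G :: "real \<Rightarrow> int"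
  shows "(\<Sum>j\<leftarrow>[0..<nkids r]. G (lam * p + real j * gphi + len (kid_role r j)) - G (lam * p + real j * gphi)) = G (lam * (p + len r)) - G (lam * p)"
proof (cases "is_A r")
  case True
  have "lam * (p + len r) = lam * p + 2 * gphi + 1" using True lam_gphi gphi(1) by (simp add: len_def distrib_left)
  then show ?thesis using True by (simp add: nkids_def kid_role_def len_def numeral_eq_Suc upt_rec algebra_simps)
next
  case False
  have "lam * (p + len r) = lam * p + gphi + 1" using False lam_gphi by (simp add: len_def distrib_left)
  then show ?thesis using False by (simp add: nkids_def kid_role_def len_def numeral_eq_Suc upt_rec algebra_simps)
qed

lemma cell_tile_in_tiles:
  assumes t: "\<bar>t\<bar> \<le> int k" and r: "r \<noteq> PR"
  shows "cell_tile Q b vec carry t p r \<in> tiles"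
proof -
  have t1: "\<bar>t\<bar> \<le> int k + 1" "\<bar>t + 1\<bar> \<le> int k + 1" using t by auto
  let ?ws = "map (\<lambda>j. vec (t + 1) (lam * p + j * gphi) (kid_role r j)) [0..<nkids r]"
  have "balanced (b t) (vec t p r) ?ws (carry t p) (carry t (p + len r))"
    unfolding balanced_def
  proof (intro allI impI)
    fix j assume j: "j < length (cons (b t))"
    obtain f g where fg: "cons (b t) ! j = (f, g)" by (cases "cons (b t) ! j")
    then have mem: "(f, g) \<in> set (cons (b t))" using j by (metis nth_mem)
    have "(\<Sum>w\<leftarrow>?ws. dot g w) = (\<Sum>i<d. g i * fl (t + 1) i (lam * (p + len r))) - (\<Sum>i<d. g i * fl (t + 1) i (lam * p))"
      using kids_telescope[of "\<lambda>u. \<Sum>i<d. g i * fl (t + 1) i u" p r] by (simp add: comp_def dot_vec[OF t1(2)])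
    moreover have "slope t (f, g) * p \<le> slope t (f, g) * (p + len r)"
      using cons[OF t mem] lam_bounds(3)[of r] by (intro mult_left_mono) (auto simp: slope_def)
    then have "\<lfloor>slope t (f, g) * p\<rfloor> \<le> \<lfloor>slope t (f, g) * (p + len r)\<rfloor>" by (rule floor_mono)
    ultimately show "0 \<le> dot (fst (cons (b t) ! j)) (vec t p r) + (\<Sum>w\<leftarrow>?ws. dot (snd (cons (b t) ! j)) w) + carry t p ! j - carry t (p + len r) ! j"
      using j by (simp add: fg dot_vec[OF t1(1)] carry_def cum_def del: map_map)
  qed
  then show ?thesis
    unfolding tiles_def cell_tile_def
    by (rule_tac CollectI, (rule_tac exI)+, rule_tac conjI[OF refl])
      (use rule[OF t] r okv_vec[OF t1(1)] okv_vec[OF t1(2)] okc_carry[OF t] in auto)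
qed

text \<open>The choice is unambiguous: a centre determines its cell and, by \<open>nb_inj\<close>,
  two centres determine the edge.\<close>

definition lay :: "complex \<Rightarrow> complex \<Rightarrow> nat" where
  "lay x y = num (SOME l. \<exists>t p r g i. cell t p r g \<and> i < 7 \<and> g 0 = x \<and> nb i g 0 = y \<and> l = cell_tile Q b vec carry t p r ! i)"

lemma lay_eq:
  assumes "cell t p r g" "i < 7"
  shows "lay (g 0) (nb i g 0) = num (cell_tile Q b vec carry t p r ! i)"
proof -
  let ?P = "\<lambda>l. \<exists>t' p' r' g' i'. cell t' p' r' g' \<and> i' < 7 \<and> g' 0 = g 0 \<and> nb i' g' 0 = nb i g 0 \<and> l = cell_tile Q b vec carry t' p' r' ! i'"
  have "?P (cell_tile Q b vec carry t p r ! i)" using assms by blast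
  then have "?P (SOME l. ?P l)" by (rule someI)
  then obtain t' p' r' g' i' where h: "cell t' p' r' g'" "i' < 7" "g' 0 = g 0" "nb i' g' 0 = nb i g 0"
    "(SOME l. ?P l) = cell_tile Q b vec carry t' p' r' ! i'" by blast
  have u: "t' = t" "p' = p" "r' = r" "g' = g" using cell_unique[OF h(1) assms(1) h(3)] by auto
  have "i' = i" using nb_inj[OF cell_frames[OF assms(1)] h(2) assms(2)] h(4) u by simp
  then show ?thesis using h(5) u unfolding lay_def by simp
qed

theorem orbit_imp_surroundable: "surroundable (map num ` tiles) k"
  unfolding surroundable_def valid_patch_def
proof (intro exI[of _ lay] conjI ballI impI)
  fix x assume "x \<in> ball k"
  then obtain t p r g where c: "cell t p r g" "g 0 = x" "\<bar>t\<bar> \<le> int k" using ball_cell by blast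
  obtain h where h: "h \<in> symgrp" "g = on_disk h" using cell_frames[OF c(1)] by (auto simp: frames_def)
  have ct: "cell_tile Q b vec carry t p r \<in> tiles" using cell_tile_in_tiles[OF c(3) cell_role[OF c(1)]] .
  have "map (lay x) (face_nbrs h) = map num (cell_tile Q b vec carry t p r)"
    unfolding face_nbrs_frame[OF h(1)] h(2)[symmetric] c(2)[symmetric]
    using lay_eq[OF c(1)] length_tiles[OF ct] by (auto intro!: nth_equalityI)
  then have "map (lay x) (face_nbrs h) \<in> copies (map num ` tiles)"
    unfolding copies_def using ct by (auto intro!: exI[of _ "0::nat"])
  then show "\<exists>g\<in>symgrp. g 0 = x \<and> map (lay x) (face_nbrs g) \<in> copies (map num ` tiles)"
    using h c(2) by (intro bexI[of _ h]) (auto simp: on_disk_def)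
next
  fix x y assume "x \<in> ball k" "y \<in> ball k" and adj: "adjacent x y"
  then obtain t p r g where c: "cell t p r g" "g 0 = x" using ball_cell by blast
  obtain m t' p' r' g' i' where e: "m < 7" "cell t' p' r' g'" "i' < 7" "y = nb m g 0" "y = g' 0" "nb i' g' 0 = g 0"
    "linked t p r m t' p' r' i' \<or> linked t' p' r' i' t p r m"
    using adjacent_cells[OF c(1), of y] adj c(2) by metis
  have "lay x y = num (cell_tile Q b vec carry t p r ! m)" using lay_eq[OF c(1) e(1)] c(2) e(4) by simp
  also have "\<dots> = num (cell_tile Q b vec carry t' p' r' ! i')" using e(7) linked_labels by metis
  also have "\<dots> = lay y x" using lay_eq[OF e(2,3)] c(2) e(5,6) by simp
  finally show "lay x y = lay y x" .
qed

end

end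

section \<open>A mortal machine with long runs\<close>

datatype op = Keep | Push nat | Pop nat
datatype 'm marker = MB | MF 'm
datatype 'm ctl = FL nat bool | F 'm bool | Z nat 'm bool | Cal "'m marker" bool | B bool | RB bool | E "'m marker" bool
datatype mop = MInc nat | MDec nat | MZero nat

text \<open>Digit 0 is the unit of fuel, so markers are coded by positive digits.\<close>

fun mdig :: "'m::countable marker \<Rightarrow> nat" where
  "mdig MB = 1" | "mdig (MF q) = Suc (Suc (to_nat q))"

lemma mdig_inj [simp]: "mdig m = mdig m' \<longleftrightarrow> m = m'"
  by (cases m; cases m') auto

lemma mdig_pos [simp]: "mdig m \<noteq> 0" "0 \<noteq> mdig m"
  by (cases m; auto)+

text \<open>Stacks are addressed relative to the direction \<open>d\<close>; a nested execution
  exchanges their roles by negating it.\<close>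

definition tp :: "bool \<Rightarrow> 'a \<Rightarrow> 'a \<Rightarrow> bool \<Rightarrow> 'a" where
  "tp d x y = (\<lambda>b. if b = d then x else y)"

lemma tp_swap: "tp (\<not> d) x y = tp d y x"
  by (auto simp: tp_def)

lemma tp_apply [simp]: "tp d x y d = x" "tp d x y (\<not> d) = y"
  by (auto simp: tp_def)

lemma tp_eq [simp]: "tp d x y = tp d x' y' \<longleftrightarrow> x = x' \<and> y = y'"
  by (metis tp_apply)

lemma all_bool: "(\<forall>b. P b) \<longleftrightarrow> P d \<and> P (\<not> d)"
  using bool.exhaust by (cases d; simp) metis+

lemma tp_cases: obtains x y where "T = tp d x y"
proof
  show "T = tp d (T d) (T (\<not> d))" by (auto simp: tp_def fun_eq_iff)
qed

abbreviation all_counters :: "nat \<Rightarrow> op \<Rightarrow> nat \<Rightarrow> op" where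
  "all_counters k u \<equiv> \<lambda>j. if j < k then u else Keep"

text \<open>Stack \<open>d\<close> holds the fuel, each unit being a digit 0, and the opposite stack the units already spent;
  a counter is a stack of 0s above a digit 1. \<open>FL\<close> loads the input and \<open>F\<close> executes the counter machine.
  Before every step \<open>Cal\<close> starts a nested execution in the opposite direction, fuelled by the
  spent units. When the fuel ends at a marker, \<open>E\<close> and \<open>B\<close> walk back the same way, again with nested
  executions, and return to the caller named by the marker (\<open>RB\<close> if the caller was itself walking
  back). Since nested executions start with proper counters, they halt, which stops an execution
  that has spent too much, even on stacks without marker.\<close>

inductive_set hooper_rules :: "('m::countable \<times> mop \<times> 'm) set \<Rightarrow> nat \<Rightarrow> nat \<Rightarrow> 'm \<Rightarrow> 'm marker set \<Rightarrow> ('m ctl \<times> (bool \<Rightarrow> op) \<times> (nat \<Rightarrow> op) \<times> 'm ctl) set"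
  for tr k n q0 Mk where
  load: "i \<le> n \<Longrightarrow> (FL (Suc i) d, tp d (Pop 0) (Push 0), (\<lambda>_. Keep)(0 := Push 0), FL i d) \<in> hooper_rules tr k n q0 Mk"
| load_end: "i \<le> n \<Longrightarrow> m \<in> Mk \<Longrightarrow> (FL i d, tp d (Pop (mdig m)) Keep, \<lambda>_. Keep, E m d) \<in> hooper_rules tr k n q0 Mk"
| load_exit: "(FL 0 d, \<lambda>_. Keep, \<lambda>_. Keep, F q0 d) \<in> hooper_rules tr k n q0 Mk"
| inc: "(q, MInc j, q') \<in> tr \<Longrightarrow> (F q d, tp d (Pop 0) Keep, (\<lambda>_. Keep)(j := Push 0), Cal (MF q') d) \<in> hooper_rules tr k n q0 Mk"
| dec: "(q, MDec j, q') \<in> tr \<Longrightarrow> (F q d, tp d (Pop 0) Keep, (\<lambda>_. Keep)(j := Pop 0), Cal (MF q') d) \<in> hooper_rules tr k n q0 Mk"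
| zero: "(q, MZero j, q') \<in> tr \<Longrightarrow> (F q d, tp d (Pop 0) Keep, (\<lambda>_. Keep)(j := Pop 1), Z j q' d) \<in> hooper_rules tr k n q0 Mk"
| zero2: "(q, MZero j, q') \<in> tr \<Longrightarrow> (Z j q' d, \<lambda>_. Keep, (\<lambda>_. Keep)(j := Push 1), Cal (MF q') d) \<in> hooper_rules tr k n q0 Mk"
| call: "i \<le> n \<Longrightarrow> m \<in> Mk \<Longrightarrow> (Cal m d, tp d (Push (mdig m)) Keep, all_counters k (Push 1), FL i (\<not> d)) \<in> hooper_rules tr k n q0 Mk"
| fuel_end: "MF q \<in> Mk \<Longrightarrow> m \<in> Mk \<Longrightarrow> (F q d, tp d (Pop (mdig m)) Keep, \<lambda>_. Keep, E m d) \<in> hooper_rules tr k n q0 Mk"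
| turn: "m \<in> Mk \<Longrightarrow> (E m d, tp d (Push (mdig m)) Keep, \<lambda>_. Keep, B d) \<in> hooper_rules tr k n q0 Mk"
| walk: "J \<subseteq> {..<k} \<Longrightarrow> (B d, tp d Keep (Pop 0), \<lambda>j. if j \<in> J then Pop 0 else Keep, Cal MB d) \<in> hooper_rules tr k n q0 Mk"
| retF: "MF q \<in> Mk \<Longrightarrow> (B d, tp d (Push 0) (Pop (mdig (MF q))), all_counters k (Pop 1), F q (\<not> d)) \<in> hooper_rules tr k n q0 Mk"
| retB: "(B d, tp d Keep (Pop 1), all_counters k (Pop 1), RB (\<not> d)) \<in> hooper_rules tr k n q0 Mk"
| rewind: "(RB d, tp d (Push 0) Keep, \<lambda>_. Keep, B d) \<in> hooper_rules tr k n q0 Mk"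

locale hooper =
  fixes push :: "nat \<Rightarrow> 's \<Rightarrow> 's"
    and tr :: "('m::countable \<times> mop \<times> 'm) set" and k n :: nat and q0 :: 'm and Mk :: "'m marker set"
  assumes push_inj [simp]: "push a x = push b y \<longleftrightarrow> a = b \<and> x = y"
    and k_pos: "0 < k"
    and tr_reg: "(q, MInc j, q') \<in> tr \<or> (q, MDec j, q') \<in> tr \<or> (q, MZero j, q') \<in> tr \<Longrightarrow> j < k"
    and tr_Mk: "(q, u, q') \<in> tr \<Longrightarrow> MF q' \<in> Mk"
    and MB_Mk: "MB \<in> Mk" and q0_Mk: "MF q0 \<in> Mk"
begin

definition opr :: "op \<Rightarrow> 's \<Rightarrow> 's \<Rightarrow> bool" where
  "opr o' x y = (case o' of Keep \<Rightarrow> y = x | Push a \<Rightarrow> y = push a x | Pop a \<Rightarrow> x = push a y)"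

lemma opr_simps [simp]: "opr Keep x y \<longleftrightarrow> y = x" "opr (Push a) x y \<longleftrightarrow> y = push a x" "opr (Pop a) x y \<longleftrightarrow> x = push a y"
  by (auto simp: opr_def)


abbreviation dg :: "'m marker \<Rightarrow> nat" where "dg \<equiv> mdig"

abbreviation "HR \<equiv> hooper_rules tr k n q0 Mk"

definition step :: "'m ctl \<times> (bool \<Rightarrow> 's) \<times> (nat \<Rightarrow> 's) \<Rightarrow> 'm ctl \<times> (bool \<Rightarrow> 's) \<times> (nat \<Rightarrow> 's) \<Rightarrow> bool" where
  "step = (\<lambda>(c, T, C) (c', T', C'). \<exists>t g. (c, t, g, c') \<in> HR \<and> (\<forall>b. opr (t b) (T b) (T' b)) \<and> (\<forall>j. opr (g j) (C j) (C' j)))"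

text \<open>Every run from the configuration is finite. Accessibility copes with the nondeterminism
  of the machine and lets termination be proved backwards, one step at a time.\<close>

definition SN :: "'m ctl \<times> (bool \<Rightarrow> 's) \<times> (nat \<Rightarrow> 's) \<Rightarrow> bool" where
  "SN = Wellfounded.accp (\<lambda>y x. step x y)"

lemma SN_I: "(\<And>y. step x y \<Longrightarrow> SN y) \<Longrightarrow> SN x"
  unfolding SN_def by (rule accp.intros)

lemma step_ex:
  assumes "step (c, tp d x y, C) z"
  shows "\<exists>t g c' x' y' C'. (c, t, g, c') \<in> HR \<and> z = (c', tp d x' y', C') \<and>
    opr (t d) x x' \<and> opr (t (\<not> d)) y y' \<and> (\<forall>j. opr (g j) (C j) (C' j))"
proof -
  obtain c' T' C' where z: "z = (c', T', C')" by (cases z)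
  obtain x' y' where T': "T' = tp d x' y'" by (rule tp_cases)
  show ?thesis
    using assms z T' unfolding step_def
    by (auto simp: all_bool[of _ d])
qed

lemma stepI:
  assumes "(c, t, g, c') \<in> HR" "opr (t d) x x'" "opr (t (\<not> d)) y y'" "\<And>j. opr (g j) (C j) (C' j)"
  shows "step (c, tp d x y, C) (c', tp d x' y', C')"
  using assms unfolding step_def by (auto simp: all_bool[of _ d])

text \<open>The digit 1 starts a fresh counter of value 0 above the caller's.\<close>

definition psh :: "(nat \<Rightarrow> 's) \<Rightarrow> nat \<Rightarrow> 's" where
  "psh C = (\<lambda>j. if j < k then push 1 (C j) else C j)"

lemma opr_psh: "(\<forall>j. opr (if j < k then Push 1 else Keep) (C j) (C' j)) \<longleftrightarrow> C' = psh C"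
  by (auto simp: psh_def fun_eq_iff)

lemma opr_unpsh: "(\<forall>j. opr (if j < k then Pop 1 else Keep) (C j) (C' j)) \<longleftrightarrow> C = psh C'"
  by (auto simp: psh_def fun_eq_iff split: if_splits)

lemma opr_upd: "(\<forall>j. opr (((\<lambda>_. Keep)(i := o')) j) (C j) (C' j)) \<longleftrightarrow> opr o' (C i) (C' i) \<and> C' = C(i := C' i)"
  by (auto simp: fun_eq_iff)

lemma opr_keep: "(\<forall>j. opr Keep (C j) (C' j)) \<longleftrightarrow> C' = C"
  by (auto simp: fun_eq_iff)

lemma step_Cal:
  assumes "step (Cal m d, tp d x y, C) z"
  obtains i where "i \<le> n" "z = (FL i (\<not> d), tp d (push (dg m) x) y, psh C)"
  using step_ex[OF assms] by (elim exE conjE) (erule hooper_rules.cases; auto simp: opr_psh[THEN iffD1] )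

lemma step_E:
  assumes "step (E m d, tp d x y, C) z"
  shows "z = (B d, tp d (push (dg m) x) y, C)"
  using step_ex[OF assms] by (elim exE conjE) (erule hooper_rules.cases; auto)

lemma step_RB:
  assumes "step (RB d, tp d x y, C) z"
  shows "z = (B d, tp d (push 0 x) y, C)"
  using step_ex[OF assms] by (elim exE conjE) (erule hooper_rules.cases; auto)

lemma step_B:
  assumes "step (B d, tp d x y, C) z"
  obtains (walk) y' C' where "y = push 0 y'" "z = (Cal MB d, tp d x y', C')" "\<And>j. C' j = C j \<or> j < k \<and> C j = push 0 (C' j)"
  | (retF) q y' C' where "MF q \<in> Mk" "y = push (dg (MF q)) y'" "C = psh C'" "z = (F q (\<not> d), tp d (push 0 x) y', C')"
  | (retB) y' C' where "y = push 1 y'" "C = psh C'" "z = (RB (\<not> d), tp d x y', C')"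
proof -
  obtain t g c' x' y' C' where h: "(B d, t, g, c') \<in> HR" "z = (c', tp d x' y', C')"
    "opr (t d) x x'" "opr (t (\<not> d)) y y'" "\<And>j. opr (g j) (C j) (C' j)" using step_ex[OF assms] by blast
  from h(1) show thesis
  proof cases
    case (walk J)
    with h have "\<And>j. C' j = C j \<or> j < k \<and> C j = push 0 (C' j)"
      by (metis (full_types) lessThan_iff opr_simps(1,3) subsetD)
    with walk h that(1) show ?thesis by auto
  next
    case (retF q)
    with h have "C = psh C'" using opr_unpsh[of C C'] by simp
    with retF h that(2) show ?thesis by simp
  next
    case retB
    with h have "C = psh C'" using opr_unpsh[of C C'] by simp
    with retB h that(3) show ?thesis by simp
  qed
qed

lemma step_F:
  assumes "step (F q d, tp d x y, C) z"
  obtains (inc) j q' x' where "(q, MInc j, q') \<in> tr" "x = push 0 x'" "z = (Cal (MF q') d, tp d x' y, C(j := push 0 (C j)))"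
  | (dec) j q' x' u where "(q, MDec j, q') \<in> tr" "x = push 0 x'" "C j = push 0 u" "z = (Cal (MF q') d, tp d x' y, C(j := u))"
  | (zero) j q' x' u where "(q, MZero j, q') \<in> tr" "x = push 0 x'" "C j = push 1 u" "z = (Z j q' d, tp d x' y, C(j := u))"
  | (fuel_end) m x' where "m \<in> Mk" "x = push (dg m) x'" "z = (E m d, tp d x' y, C)"
proof -
  obtain t g c' x' y' C' where h: "(F q d, t, g, c') \<in> HR" "z = (c', tp d x' y', C')"
    "opr (t d) x x'" "opr (t (\<not> d)) y y'" "\<And>j. opr (g j) (C j) (C' j)" using step_ex[OF assms] by blast
  from h(1) show thesis
  proof cases
    case (inc j q')
    with h opr_upd[of j "Push 0" C C'] have "C' = C(j := push 0 (C j))" by auto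
    with h inc that(1) show ?thesis by auto
  next
    case (dec j q')
    with h opr_upd[of j "Pop 0" C C'] have "C' = C(j := C' j)" "C j = push 0 (C' j)" by auto
    with h dec that(2) show ?thesis by (metis opr_simps(1,3) tp_apply)
  next
    case (zero j q')
    with h opr_upd[of j "Pop 1" C C'] have "C' = C(j := C' j)" "C j = push 1 (C' j)" by auto
    with h zero that(3) show ?thesis by (metis opr_simps(1,3) tp_apply)
  next
    case (fuel_end m)
    with h opr_keep[of C C'] have "C' = C" by auto
    with h fuel_end that(4) show ?thesis by auto
  qed
qed

lemma step_Z:
  assumes "step (Z j q' d, tp d x y, C) z"
  shows "z = (Cal (MF q') d, tp d x y, C(j := push 1 (C j)))"
proof -
  obtain t g c' x' y' C' where h: "(Z j q' d, t, g, c') \<in> HR" "z = (c', tp d x' y', C')"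
    "opr (t d) x x'" "opr (t (\<not> d)) y y'" "\<And>j. opr (g j) (C j) (C' j)" using step_ex[OF assms] by blast
  from h(1) show ?thesis
    by cases (use h opr_upd[of j "Push 1" C C'] in auto)
qed

lemma step_FL:
  assumes "step (FL i d, tp d x y, C) z"
  obtains (load) i' x' where "i = Suc i'" "x = push 0 x'" "z = (FL i' d, tp d x' (push 0 y), C(0 := push 0 (C 0)))"
  | (load_end) m x' where "m \<in> Mk" "x = push (dg m) x'" "z = (E m d, tp d x' y, C)"
  | (load_exit) "i = 0" "z = (F q0 d, tp d x y, C)"
proof -
  obtain t g c' x' y' C' where h: "(FL i d, t, g, c') \<in> HR" "z = (c', tp d x' y', C')"
    "opr (t d) x x'" "opr (t (\<not> d)) y y'" "\<And>j. opr (g j) (C j) (C' j)" using step_ex[OF assms] by blast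
  from h(1) show thesis
  proof cases
    case (load i')
    with h opr_upd[of 0 "Push 0" C C'] have "C' = C(0 := push 0 (C 0))" by auto
    with h load that(1) show ?thesis by auto
  next
    case (load_end m)
    with h opr_keep[of C C'] have "C' = C" by auto
    with h load_end that(2) show ?thesis by auto
  next
    case load_exit
    with h opr_keep[of C C'] have "C' = C" by auto
    with h load_exit that(3) show ?thesis by auto
  qed
qed

lemma SN_Cal:
  assumes "\<And>i. i \<le> n \<Longrightarrow> SN (FL i (\<not> d), tp (\<not> d) y (push (dg m) x), psh C)"
  shows "SN (Cal m d, tp d x y, C)"
  by (rule SN_I, erule step_Cal) (use assms in \<open>simp add: tp_swap\<close>)

lemma SN_E: "SN (B d, tp d (push (dg m) x) y, C) \<Longrightarrow> SN (E m d, tp d x y, C)"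
  by (rule SN_I, drule step_E) simp

lemma SN_RB: "SN (B d, tp d (push 0 x) y, C) \<Longrightarrow> SN (RB d, tp d x y, C)"
  by (rule SN_I, drule step_RB) simp

lemma SN_Z: "SN (Cal (MF q) d, tp d x y, C(j := push 1 (C j))) \<Longrightarrow> SN (Z j q d, tp d x y, C)"
  by (rule SN_I, drule step_Z) simp

abbreviation pw :: "nat \<Rightarrow> 's \<Rightarrow> 's" where "pw e \<equiv> push 0 ^^ e"

lemma pw_push [simp]: "pw e (push 0 x) = push 0 (pw e x)"
  by (simp add: funpow_swap1)

text \<open>Walking back may remove counter units freely, but a return demands that every counter be
  empty. Hence only the caller's counters can result, see \<open>ret_cnt\<close>.\<close>

definition ret :: "(nat \<Rightarrow> 's) \<Rightarrow> (nat \<Rightarrow> 's) \<Rightarrow> bool" where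
  "ret C C' \<longleftrightarrow> (\<forall>j. if j < k then \<exists>c. C j = pw c (push 1 (C' j)) else C' j = C j)"

definition cnt :: "(nat \<Rightarrow> nat) \<Rightarrow> (nat \<Rightarrow> 's) \<Rightarrow> nat \<Rightarrow> 's" where
  "cnt c C = (\<lambda>j. if j < k then pw (c j) (push 1 (C j)) else C j)"

lemma pw_eq: "a \<noteq> 0 \<Longrightarrow> b \<noteq> 0 \<Longrightarrow> pw c (push a x) = pw c' (push b y) \<longleftrightarrow> c = c' \<and> a = b \<and> x = y"
proof (induction c arbitrary: c')
  case 0
  then show ?case by (cases c') auto
next
  case (Suc c)
  then show ?case by (cases c') auto
qed

lemma ret_cnt: "ret (cnt c C) C' \<Longrightarrow> C' = C"
proof
  fix j assume "ret (cnt c C) C'"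
  then have "if j < k then \<exists>c'. pw (c j) (push 1 (C j)) = pw c' (push 1 (C' j)) else C' j = C j"
    unfolding ret_def cnt_def by (metis (no_types, lifting))
  then show "C' j = C j" by (auto simp: pw_eq split: if_splits)
qed

lemma ret_psh: "ret (psh C) C"
  by (auto simp: ret_def psh_def intro: exI[of _ 0])

lemma ret_pop: 
  assumes "\<And>j. C1 j = C j \<or> j < k \<and> C j = push 0 (C1 j)" "ret C1 C'"
  shows "ret C C'"
  unfolding ret_def
proof
  fix j
  show "if j < k then \<exists>c. C j = pw c (push 1 (C' j)) else C' j = C j"
  proof (cases "j < k")
    case True
    with assms(2) obtain c where c: "C1 j = pw c (push 1 (C' j))" unfolding ret_def by metis
    from assms(1)[of j] have "C j = pw c (push 1 (C' j)) \<or> C j = pw (Suc c) (push 1 (C' j))"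
      using c by auto
    with True show ?thesis by metis
  next
    case False
    with assms(1)[of j] assms(2) show ?thesis by (auto simp: ret_def dest: spec[of _ j])
  qed
qed

lemma psh_cnt: "psh C = cnt (\<lambda>_. 0) C"
  by (auto simp: psh_def cnt_def)

fun resume :: "'m marker \<Rightarrow> bool \<Rightarrow> 's \<Rightarrow> 's \<Rightarrow> (nat \<Rightarrow> 's) \<Rightarrow> 'm ctl \<times> (bool \<Rightarrow> 's) \<times> (nat \<Rightarrow> 's)" where
  "resume (MF q) d x y C = (F q (\<not> d), tp d (push 0 x) y, C)"
| "resume MB d x y C = (RB (\<not> d), tp d x y, C)"

text \<open>Termination of a nested execution is reduced to that of its caller's continuation, in
  which stacks and counters are restored, up to the unit the caller then books as spent. So a nested
  execution can be treated like a single step.\<close>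

definition nest :: "nat \<Rightarrow> bool" where
  "nest e \<longleftrightarrow> (\<forall>d m el z C i. (\<forall>x. z \<noteq> push 0 x) \<longrightarrow> (\<forall>(m' :: 'm marker) r. z = push (dg m') r \<longrightarrow> SN (resume m d (pw e z) el C)) \<longrightarrow>
     i \<le> n \<longrightarrow> SN (FL i d, tp d (pw e z) (push (dg m) el), psh C))"

text \<open>A call made on the way back is fuelled only by the units not yet walked over, so
  \<open>nest\<close> is required below \<open>e\<close> only.\<close>

lemma SN_back:
  assumes "\<And>e'. e' < e \<Longrightarrow> nest e'" "\<And>x. z \<noteq> push 0 x"
    "\<And>m el C'. z = push (dg m) el \<Longrightarrow> ret C C' \<Longrightarrow> SN (resume m d (pw e x) el C')"
  shows "SN (B d, tp d x (pw e z), C)"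
  using assms
proof (induction e arbitrary: x C)
  case 0
  show ?case
  proof (rule SN_I, erule step_B)
    fix q y' C' v
    assume "pw 0 z = push (dg (MF q)) y'" "C = psh C'" "v = (F q (\<not> d), tp d (push 0 x) y', C')"
    with 0(3)[of "MF q" y' C'] show "SN v" by (simp add: ret_psh)
  next
    fix y' C' v
    assume "pw 0 z = push 1 y'" "C = psh C'" "v = (RB (\<not> d) :: 'm ctl, tp d x y', C')"
    with 0(3)[of MB y' C'] show "SN v" by (simp add: ret_psh)
  qed (use 0 in auto)
next
  case (Suc e)
  show ?case
  proof (rule SN_I, erule step_B)
    fix y' C1 v
    assume h: "pw (Suc e) z = push 0 y'" "v = (Cal (MB :: 'm marker) d, tp d x y', C1)"
      "\<And>j. C1 j = C j \<or> j < k \<and> C j = push 0 (C1 j)"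
    then have y': "y' = pw e z" by simp
    have "SN (B d, tp d (push 0 x) (pw e z), C1)"
      using Suc.prems by (intro Suc.IH) (auto simp: ret_pop[OF h(3)])
    then have "SN (RB d, tp d x (pw e z), C1)" by (rule SN_RB)
    then have "SN (resume MB (\<not> d) (pw e z) x C1)" by (simp add: tp_swap)
    moreover have "nest e" using Suc.prems by simp
    ultimately have "SN (FL i (\<not> d), tp (\<not> d) (pw e z) (push (dg MB) x), psh C1)" if "i \<le> n" for i
      using Suc.prems(2) that unfolding nest_def by blast
    then show "SN v" unfolding h y' by (rule SN_Cal)
  qed auto
qed

inductive mstep :: "'m \<times> (nat \<Rightarrow> nat) \<Rightarrow> 'm \<times> (nat \<Rightarrow> nat) \<Rightarrow> bool" where
  "(q, MInc j, q') \<in> tr \<Longrightarrow> mstep (q, c) (q', c(j := Suc (c j)))"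
| "(q, MDec j, q') \<in> tr \<Longrightarrow> c j = Suc v \<Longrightarrow> mstep (q, c) (q', c(j := v))"
| "(q, MZero j, q') \<in> tr \<Longrightarrow> c j = 0 \<Longrightarrow> mstep (q, c) (q', c)"

definition init :: "nat \<Rightarrow> nat \<Rightarrow> nat" where
  "init i = (\<lambda>_. 0)(0 := i)"

text \<open>Indexed by the fuel spent: loading an input costs its value, each program step one unit.
  All inputs up to \<open>n\<close> occur because a call picks one freely.\<close>

inductive proper :: "nat \<Rightarrow> 'm \<Rightarrow> (nat \<Rightarrow> nat) \<Rightarrow> bool" where
  "i \<le> n \<Longrightarrow> proper i q0 (init i)"
| "proper e q c \<Longrightarrow> mstep (q, c) (q', c') \<Longrightarrow> proper (Suc e) q' c'"

lemma cnt_inc: "j < k \<Longrightarrow> (cnt c C)(j := push 0 (cnt c C j)) = cnt (c(j := Suc (c j))) C"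
  by (auto simp: cnt_def fun_eq_iff)

lemma cnt_dec: "j < k \<Longrightarrow> cnt c C j = push 0 u \<Longrightarrow> \<exists>v. c j = Suc v \<and> (cnt c C)(j := u) = cnt (c(j := v)) C"
  by (cases "c j") (auto simp: cnt_def fun_eq_iff)

lemma cnt_zero: "j < k \<Longrightarrow> cnt c C j = push 1 u \<Longrightarrow> c j = 0 \<and> u = C j"
  by (cases "c j") (auto simp: cnt_def)

lemma tr_reg': "(q, MInc j, q') \<in> tr \<Longrightarrow> j < k" "(q, MDec j, q') \<in> tr \<Longrightarrow> j < k" "(q, MZero j, q') \<in> tr \<Longrightarrow> j < k"
  using tr_reg by blast+

text \<open>Either the fuel outlasts the program, whose halting leaves the machine stuck, or it ends
  above \<open>z\<close> and the walk back leads to the caller.\<close>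

lemma SN_forward:
  assumes bound: "\<And>e q c. proper e q c \<Longrightarrow> e \<le> Tm"
    and "\<And>e'. e' < e + r \<Longrightarrow> e' \<le> Tm \<Longrightarrow> nest e'"
    and "proper e q c"
    and "e + r > Tm \<or> (\<forall>x. z \<noteq> push 0 x) \<and> (\<forall>(m' :: 'm marker) r'. z = push (dg m') r' \<longrightarrow> SN (resume m d (pw (e + r) z) el C))"
  shows "SN (F q d, tp d (pw r z) (pw e (push (dg m) el)), cnt c C)"
  using assms(2-)
proof (induction r arbitrary: e q c)
  case 0
  with bound[OF 0(2)] have z: "\<And>x. z \<noteq> push 0 x"
    and ret: "\<And>(m' :: 'm marker) r'. z = push (dg m') r' \<Longrightarrow> SN (resume m d (pw e z) el C)" by auto
  show ?case
  proof (rule SN_I, erule step_F)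
    fix m' x' v
    assume h: "pw 0 z = push (dg (m' :: 'm marker)) x'" "v = (E m' d, tp d x' (pw e (push (dg m) el)), cnt c C)"
    have "SN (B d, tp d z (pw e (push (dg m) el)), cnt c C)"
    proof (rule SN_back)
      fix e' assume "e' < e"
      then show "nest e'" using 0(1)[of e'] bound[OF 0(2)] by simp
    next
      fix m1 el1 C' assume "push (dg m) el = push (dg m1) el1" "ret (cnt c C) C'"
      then show "SN (resume m1 d (pw e z) el1 C')" using ret h by (auto dest: ret_cnt)
    qed simp
    with h show "SN v" by (auto intro: SN_E)
  qed (use z in auto)
next
  case (Suc r)
  have "e \<le> Tm" using bound[OF Suc.prems(2)] .
  then have nest: "nest e" using Suc.prems(1) by simp
  have go: "SN (Cal (MF q') d, tp d (pw r z) (pw e (push (dg m) el)), cnt c' C)" if "mstep (q, c) (q', c')" for q' c'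
  proof (rule SN_Cal)
    fix i assume i: "i \<le> n"
    have "proper (Suc e) q' c'" using Suc.prems(2) that by (rule proper.intros)
    then have "SN (F q' d, tp d (pw r z) (pw (Suc e) (push (dg m) el)), cnt c' C)"
      using Suc.prems by (intro Suc.IH) auto
    \<comment> \<open>The return adds the unit just consumed to the spent ones, which gives the next
      proper configuration.\<close>
    then have "SN (resume (MF q') (\<not> d) (pw e (push (dg m) el)) (pw r z) (cnt c' C))"
      by (simp add: tp_swap)
    then show "SN (FL i (\<not> d), tp (\<not> d) (pw e (push (dg m) el)) (push (dg (MF q')) (pw r z)), psh (cnt c' C))"
      using nest i unfolding nest_def by (auto simp del: mdig.simps)
  qed
  show ?case
  proof (rule SN_I, erule step_F)
    fix j q' x' v
    assume h: "(q, MInc j, q') \<in> tr" "pw (Suc r) z = push 0 x'"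
      "v = (Cal (MF q') d, tp d x' (pw e (push (dg m) el)), (cnt c C)(j := push 0 (cnt c C j)))"
    then show "SN v" using go[OF mstep.intros(1)[OF h(1)]] tr_reg'(1)[OF h(1)] by (simp add: cnt_inc)
  next
    fix j q' x' u v
    assume h: "(q, MDec j, q') \<in> tr" "pw (Suc r) z = push 0 x'" "cnt c C j = push 0 u"
      "v = (Cal (MF q') d, tp d x' (pw e (push (dg m) el)), (cnt c C)(j := u))"
    with cnt_dec[OF tr_reg'(2)[OF h(1)] h(3)] obtain w where "c j = Suc w" "(cnt c C)(j := u) = cnt (c(j := w)) C" by blast
    then show "SN v" using go[OF mstep.intros(2)[OF h(1)]] h by simp
  next
    fix j q' x' u v
    assume h: "(q, MZero j, q') \<in> tr" "pw (Suc r) z = push 0 x'" "cnt c C j = push 1 u"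
      "v = (Z j q' d, tp d x' (pw e (push (dg m) el)), (cnt c C)(j := u))"
    from cnt_zero[OF tr_reg'(3)[OF h(1)] h(3)] have c: "c j = 0" by simp
    have "((cnt c C)(j := u))(j := push 1 (((cnt c C)(j := u)) j)) = cnt c C" using h(3) by auto
    then show "SN v" using go[OF mstep.intros(3)[of q j q' c, OF h(1) c]] h by (auto intro!: SN_Z)
  qed auto
qed

lemma SN_load:
  assumes bound: "\<And>e q c. proper e q c \<Longrightarrow> e \<le> Tm" and "n \<le> Tm"
    and "\<And>e'. e' < e + r \<Longrightarrow> e' \<le> Tm \<Longrightarrow> nest e'"
    and "e + i \<le> n"
    and "e + r > Tm \<or> (\<forall>x. z \<noteq> push 0 x) \<and> (\<forall>(m' :: 'm marker) r'. z = push (dg m') r' \<longrightarrow> SN (resume m d (pw (e + r) z) el C))"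
  shows "SN (FL i d, tp d (pw r z) (pw e (push (dg m) el)), cnt (init e) C)"
  using assms(3-)
proof (induction i arbitrary: e r)
  case 0
  have p: "proper e q0 (init e)" using 0 by (intro proper.intros) auto
  note F = SN_forward[OF bound 0(1) p 0(3)]
  show ?case
  proof (rule SN_I, erule step_FL)
    fix m' x' v
    assume h: "pw r z = push (dg (m' :: 'm marker)) x'" "v = (E m' d, tp d x' (pw e (push (dg m) el)), cnt (init e) C)"
    then have r: "r = 0" by (cases r) auto
    with 0 assms(2) have ret: "\<And>(m' :: 'm marker) r'. z = push (dg m') r' \<Longrightarrow> SN (resume m d (pw e z) el C)" by auto
    have "SN (B d, tp d z (pw e (push (dg m) el)), cnt (init e) C)"
    proof (rule SN_back)
      fix e' assume "e' < e"
      then show "nest e'" using 0 assms(2) by simp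
    next
      fix m1 el1 C' assume "push (dg m) el = push (dg m1) el1" "ret (cnt (init e) C) C'"
      then show "SN (resume m1 d (pw e z) el1 C')" using ret h r by (auto dest: ret_cnt)
    qed simp
    with h r show "SN v" by (auto intro: SN_E)
  qed (use F in auto)
next
  case (Suc i)
  show ?case
  proof (rule SN_I, erule step_FL)
    fix m' x' v
    assume h: "pw r z = push (dg (m' :: 'm marker)) x'" "v = (E m' d, tp d x' (pw e (push (dg m) el)), cnt (init e) C)"
    then have r: "r = 0" by (cases r) auto
    with Suc.prems assms(2) have ret: "\<And>(m' :: 'm marker) r'. z = push (dg m') r' \<Longrightarrow> SN (resume m d (pw e z) el C)" by auto
    have "SN (B d, tp d z (pw e (push (dg m) el)), cnt (init e) C)"
    proof (rule SN_back)
      fix e' assume "e' < e"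
      then show "nest e'" using Suc.prems assms(2) by simp
    next
      fix m1 el1 C' assume "push (dg m) el = push (dg m1) el1" "ret (cnt (init e) C) C'"
      then show "SN (resume m1 d (pw e z) el1 C')" using ret h r by (auto dest: ret_cnt)
    qed simp
    with h r show "SN v" by (auto intro: SN_E)
  next
    fix i' x' v
    assume h: "Suc i = Suc i'" "pw r z = push 0 x'"
      "v = (FL i' d :: 'm ctl, tp d x' (push 0 (pw e (push (dg m) el))), (cnt (init e) C)(0 := push 0 (cnt (init e) C 0)))"
    have "r \<noteq> 0" using h Suc.prems assms(2) by (cases r) auto
    then obtain r' where r: "r = Suc r'" by (cases r) auto
    have "init (Suc e) = (init e)(0 := Suc (init e 0))" by (auto simp: init_def)
    then have c: "(cnt (init e) C)(0 := push 0 (cnt (init e) C 0)) = cnt (init (Suc e)) C"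
      using cnt_inc[OF k_pos, of "init e" C] by simp
    have "SN (FL i d, tp d (pw r' z) (pw (Suc e) (push (dg m) el)), cnt (init (Suc e)) C)"
      using Suc.prems r by (intro Suc.IH) auto
    then show "SN v" using h r c by simp
  qed auto
qed

lemma init_0: "cnt (init 0) C = psh C"
  by (auto simp: psh_cnt init_def cnt_def)

context
  fixes Tm assumes bound: "\<And>e q c. proper e q c \<Longrightarrow> e \<le> Tm"
begin

lemma n_Tm: "n \<le> Tm"
  using bound[OF proper.intros(1)[of n]] by simp

text \<open>An execution with \<open>e\<close> units of fuel nests only executions with
  fewer.\<close>

lemma nest_all: "nest e"
proof (induction e rule: less_induct)
  case (less e)
  show ?case unfolding nest_def
  proof (intro allI impI)
    fix d m el z C i
    assume "\<forall>x. z \<noteq> push 0 x" "\<forall>(m' :: 'm marker) r. z = push (dg m') r \<longrightarrow> SN (resume m d (pw e z) el C)" "i \<le> n"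
    then show "SN (FL i d, tp d (pw e z) (push (dg m) el), psh C)"
      using SN_load[of Tm 0 e i z m d el C, OF bound n_Tm] less by (simp add: init_0)
  qed
qed

text \<open>Fresh counters start a proper execution, and more than \<open>Tm\<close> units outlast
  it, whatever lies below them.\<close>

lemma SN_kill: "i \<le> n \<Longrightarrow> r > Tm \<Longrightarrow> SN (FL i d, tp d (pw r z) (push (dg m) el), psh C)"
  using SN_load[of Tm 0 r i z m d el C, OF bound n_Tm nest_all] by (simp add: init_0)

section \<open>Termination from arbitrary configurations\<close>

definition good :: "nat \<Rightarrow> bool" where
  "good s \<longleftrightarrow> (\<forall>d x y C. SN (B d, tp d x (pw s y), C) \<and> (\<forall>q. SN (F q d, tp d x (pw s y), C)))"

lemma SN_F_via_call:
  assumes "\<And>x. SN (B d, tp d x y, C)"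
    "\<And>q' x C'. SN (Cal (MF q') d, tp d x y, C')"
  shows "SN (F q d, tp d x y, C)"
  by (rule SN_I, erule step_F) (use assms in \<open>auto intro!: SN_E SN_Z\<close>)

text \<open>With so much spent fuel the next call is killed. The walk back removes one unit before
  calling, hence \<open>Tm + 2\<close> rather than \<open>Tm + 1\<close>.\<close>

lemma good_large: "good (Suc (Suc Tm))"
proof -
  have B: "SN (B d, tp d x (pw (Suc (Suc Tm)) y), C)" for d x y C
  proof (rule SN_I, erule step_B)
    fix y' C1 v
    assume h: "pw (Suc (Suc Tm)) y = push 0 y'" "v = (Cal (MB :: 'm marker) d, tp d x y', C1 :: nat \<Rightarrow> 's)"
    then have "y' = pw (Suc Tm) y" by simp
    then show "SN v" unfolding h(2) by (intro SN_Cal) (simp only: SN_kill lessI)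
  qed auto
  moreover have "SN (F q d, tp d x (pw (Suc (Suc Tm)) y), C)" for q d x y C
    by (intro SN_F_via_call B SN_Cal SN_kill) auto
  ultimately show ?thesis unfolding good_def by blast
qed

text \<open>If another unit follows the \<open>s\<close> units, the assumption applies at once.
  Otherwise executions on them can return, and returning enlarges the spent stack. The walk back
  with a unit of fuel on top (\<open>B1\<close>) comes first, since a return to \<open>RB\<close>
  supplies just such a unit.\<close>

lemma good_Suc:
  assumes "good (Suc s)"
  shows "good s"
proof -
  have gB: "SN (B d, tp d x (pw (Suc s) y), C)" and gF: "SN (F q d, tp d x (pw (Suc s) y), C)" for d x y C q
    using assms unfolding good_def by blast+
  have B1: "SN (B d, tp d (push 0 x) (pw s y), C)" for d x y C
  proof (cases "\<exists>y'. y = push 0 y'")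
    case True
    then obtain y' where "y = push 0 y'" by blast
    then show ?thesis using gB[of d "push 0 x" y' C] by simp
  next
    case False
    show ?thesis
    proof (rule SN_back)
      fix m el C'
      show "SN (resume m d (pw s (push 0 x)) el C')"
      proof (cases m)
        case MB
        show ?thesis unfolding MB resume.simps
          using SN_RB[OF gB[of "\<not> d" "push 0 el" x C']] by (simp add: tp_swap)
      next
        case (MF q)
        show ?thesis unfolding MF resume.simps
          using gF[of q "\<not> d" el "push 0 x" C'] by (simp add: tp_swap)
      qed
    qed (use False nest_all in auto)
  qed
  have B2: "SN (B d, tp d x (pw s y), C)" for d x y C
  proof (cases "\<exists>y'. y = push 0 y'")
    case True
    then obtain y' where "y = push 0 y'" by blast
    then show ?thesis using gB[of d x y' C] by simp
  next
    case False
    show ?thesis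
    proof (rule SN_back)
      fix m el C'
      show "SN (resume m d (pw s x) el C')"
      proof (cases m)
        case MB
        show ?thesis unfolding MB resume.simps
          using SN_RB[OF B1[of "\<not> d" el x C']] by (simp add: tp_swap)
      next
        case (MF q)
        show ?thesis unfolding MF resume.simps
          using gF[of q "\<not> d" el x C'] by (simp add: tp_swap)
      qed
    qed (use False nest_all in auto)
  qed
  moreover have "SN (F q d, tp d x (pw s y), C)" for q d x y C
  proof (cases "\<exists>y'. y = push 0 y'")
    case True
    then obtain y' where "y = push 0 y'" by blast
    then show ?thesis using gF[of q d x y' C] by simp
  next
    case False
    show ?thesis
    proof (intro SN_F_via_call B2 SN_Cal)
      fix q' x C' i assume i: "i \<le> n"
      have "SN (resume (MF q') (\<not> d) (pw s y) x C')"
        using gF[of q' d x y C'] by (simp add: tp_swap)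
      then show "SN (FL i (\<not> d), tp (\<not> d) (pw s y) (push (dg (MF q')) x), psh C')"
        using nest_all[of s] i False unfolding nest_def by blast
    qed
  qed
  ultimately show ?thesis unfolding good_def by blast
qed

lemma good_0: "good 0"
proof -
  have "good (Suc (Suc Tm) - s)" if "s \<le> Suc (Suc Tm)" for s
    using that
  proof (induction s)
    case 0 then show ?case using good_large by simp
  next
    case (Suc s)
    then show ?case using good_Suc[of "Suc (Suc Tm) - Suc s"] by (simp add: Suc_diff_le)
  qed
  from this[of "Suc (Suc Tm)"] show ?thesis by simp
qed

theorem SN_all: "SN cfg"
proof -
  obtain c T C where cfg: "cfg = (c, T, C)" by (cases cfg)
  have B: "SN (B d, T, C)" for d T C
    by (rule tp_cases[of T d]) (use good_0 in \<open>auto simp: good_def\<close>)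
  have F: "SN (F q d, T, C)" for q d T C
    by (rule tp_cases[of T d]) (use good_0 in \<open>auto simp: good_def\<close>)
  have E: "SN (E m d, T, C)" for m d T C
    by (rule tp_cases[of T d]) (auto intro!: SN_E B)
  have FL: "SN (FL i d, T, C)" for i d T C
  proof (induction i arbitrary: T C)
    case 0
    obtain x y where T: "T = tp d x y" by (rule tp_cases)
    show ?case unfolding T by (rule SN_I, erule step_FL) (auto intro: E F)
  next
    case (Suc i)
    obtain x y where T: "T = tp d x y" by (rule tp_cases)
    show ?case unfolding T by (rule SN_I, erule step_FL) (auto intro: E F Suc)
  qed
  have Cal: "SN (Cal m d, T, C)" for m d T C
    by (rule tp_cases[of T d]) (auto intro!: SN_Cal FL)
  show ?thesis
  proof (cases c)
    case (Z j q d) then show ?thesis unfolding cfg by (rule_tac tp_cases[of T d]) (auto intro!: SN_Z Cal)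
  next
    case (RB d) then show ?thesis unfolding cfg by (rule_tac tp_cases[of T d]) (auto intro!: SN_RB B)
  qed (use B F E FL Cal cfg in auto)
qed

theorem no_infinite_run: "\<not> (\<forall>i. step (f i) (f (Suc i)))"
proof
  assume run: "\<forall>i. step (f i) (f (Suc i))"
  have "\<not> (\<exists>i. f i = x)" for x
    using SN_all[of x] unfolding SN_def
  proof (induction rule: accp.induct)
    case (accI x)
    then show ?case using run by blast
  qed
  then show False by blast
qed

end

section \<open>Successful nested executions and long runs\<close>

context
  fixes qs :: "nat \<Rightarrow> 'm" and cs :: "nat \<Rightarrow> nat \<Rightarrow> nat" and N :: nat
  assumes qs0: "qs n = q0" and cs0: "cs n = init n"
    and run: "\<And>e. n \<le> e \<Longrightarrow> e < N \<Longrightarrow> mstep (qs e, cs e) (qs (Suc e), cs (Suc e))"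
begin

lemma stepI':
  assumes "(c, t, g, c') \<in> HR" "opr (t d) x x'" "opr (t (\<not> d)) y y'" "\<forall>j. opr (g j) (C j) (C' j)"
  shows "step (c, tp d x y, C) (c', tp d x' y', C')"
  using assms by (intro stepI) auto

text \<open>A counter never exceeds the fuel spent, so the walk back, which may decrement counters
  at every unit, can empty them all before the return.\<close>

lemma cs_le: "n \<le> e \<Longrightarrow> e \<le> N \<Longrightarrow> cs e j \<le> e \<and> MF (qs e) \<in> Mk"
proof (induction e rule: dec_induct)
  case base
  then show ?case by (simp add: cs0 qs0 q0_Mk init_def)
next
  case (step e)
  then have "mstep (qs e, cs e) (qs (Suc e), cs (Suc e))" "cs e j \<le> e" using run by auto
  then show ?case by cases (auto simp: tr_Mk)
qed

text \<open>Counterpart of \<open>nest\<close>: some run does return, instead of every run being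
  finite.\<close>

definition nested :: "nat \<Rightarrow> bool" where
  "nested e \<longleftrightarrow> (\<forall>d m m' el r C. m \<in> Mk \<longrightarrow> m' \<in> Mk \<longrightarrow>
     step\<^sup>*\<^sup>* (FL n d, tp d (pw e (push (dg m') r)) (push (dg m) el), psh C) (resume m d (pw e (push (dg m') r)) el C))"

lemma reach_Cal:
  assumes "nested e" "m \<in> Mk" "m' \<in> Mk"
  shows "step\<^sup>*\<^sup>* (Cal m d, tp d x (pw e (push (dg m') r)), C) (resume m (\<not> d) (pw e (push (dg m') r)) x C)"
proof -
  have "step (Cal m d, tp d x (pw e (push (dg m') r)), C) (FL n (\<not> d), tp d (push (dg m) x) (pw e (push (dg m') r)), psh C)"
    using assms by (intro stepI'[OF hooper_rules.call]) (auto simp: opr_psh)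
  moreover have "step\<^sup>*\<^sup>* (FL n (\<not> d), tp d (push (dg m) x) (pw e (push (dg m') r)), psh C) (resume m (\<not> d) (pw e (push (dg m') r)) x C)"
    using assms(1)[unfolded nested_def, rule_format, OF assms(2,3), of "\<not> d" r x C] by (simp only: tp_swap)
  ultimately show ?thesis by (rule converse_rtranclp_into_rtranclp)
qed

lemma reach_back:
  assumes "\<And>e'. e' < e \<Longrightarrow> nested e'" "\<And>j. c j \<le> e" "m \<in> Mk"
  shows "step\<^sup>*\<^sup>* (B d, tp d x (pw e (push (dg m) el)), cnt c C) (resume m d (pw e x) el C)"
  using assms(1,2)
proof (induction e arbitrary: c x)
  case 0
  then have c: "cnt c C = psh C" by (auto simp: cnt_def psh_def)
  have "step (B d, tp d x (pw 0 (push (dg m) el)), psh C) (resume m d (pw 0 x) el C)"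
    using assms(3) by (cases m) (auto intro!: stepI'[OF hooper_rules.retF] stepI'[OF hooper_rules.retB] simp: psh_def)
  then show ?case unfolding c by auto
next
  case (Suc e)
  \<comment> \<open>All nonempty counters are decremented at once.\<close>
  let ?c = "\<lambda>j. c j - 1"
  have "opr (if j \<in> {j. j < k \<and> 0 < c j} then Pop 0 else Keep) (cnt c C j) (cnt ?c C j)" for j
    by (cases "c j") (auto simp: cnt_def)
  then have "step\<^sup>*\<^sup>* (B d, tp d x (pw (Suc e) (push (dg m) el)), cnt c C) (Cal MB d, tp d x (pw e (push (dg m) el)), cnt ?c C)"
    by (intro r_into_rtranclp stepI'[OF hooper_rules.walk[of "{j. j < k \<and> 0 < c j}"]]) auto
  also have "step\<^sup>*\<^sup>* \<dots> (RB d, tp d x (pw e (push (dg m) el)), cnt ?c C)"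
    using reach_Cal[OF Suc.prems(1) MB_Mk assms(3), of e d x el] by (simp add: tp_swap)
  also (rtranclp_trans) have "step\<^sup>*\<^sup>* (RB d, tp d x (pw e (push (dg m) el)), cnt ?c C) (B d, tp d (push 0 x) (pw e (push (dg m) el)), cnt ?c C)"
    by (intro r_into_rtranclp stepI'[OF hooper_rules.rewind]) auto
  also (rtranclp_trans) have "step\<^sup>*\<^sup>* \<dots> (resume m d (pw e (push 0 x)) el C)"
  proof (intro Suc.IH)
    show "c j - 1 \<le> e" for j using Suc.prems(2)[of j] by simp
  qed (use Suc.prems in auto)
  finally (rtranclp_trans) show ?case by simp
qed

lemma reach_load:
  "e \<le> n \<Longrightarrow> step\<^sup>*\<^sup>* (FL n d, tp d (pw (e + r) x) y, psh C) (FL (n - e) d, tp d (pw r x) (pw e y), cnt (init e) C)"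
proof (induction e arbitrary: r)
  case 0
  then show ?case by (simp add: init_0)
next
  case (Suc e)
  have "init (Suc e) = (init e)(0 := Suc (init e 0))" by (auto simp: init_def)
  then have c: "(cnt (init e) C)(0 := push 0 (cnt (init e) C 0)) = cnt (init (Suc e)) C"
    using cnt_inc[OF k_pos, of "init e" C] by simp
  have "step (FL (Suc (n - Suc e)) d, tp d (pw (Suc r) x) (pw e y), cnt (init e) C) (FL (n - Suc e) d, tp d (pw r x) (pw (Suc e) y), cnt (init (Suc e)) C)"
    using Suc.prems by (intro stepI'[OF hooper_rules.load]) (auto simp: opr_upd c[symmetric])
  moreover have "Suc (n - Suc e) = n - e" using Suc.prems by simp
  ultimately show ?case using Suc.IH[of "Suc r"] Suc.prems by simp
qed

lemma reach_start:
  "step\<^sup>*\<^sup>* (FL n d, tp d (pw (n + r) x) y, psh C) (F (qs n) d, tp d (pw r x) (pw n y), cnt (cs n) C)"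
proof -
  have "step (FL (n - n) d, tp d (pw r x) (pw n y), cnt (init n) C) (F (qs n) d, tp d (pw r x) (pw n y), cnt (cs n) C)"
    unfolding qs0 cs0 diff_self_eq_0 by (intro stepI'[OF hooper_rules.load_exit]) auto
  with reach_load[of n d r x y C] show ?thesis by (auto intro: rtranclp.rtrancl_into_rtrancl)
qed

lemma reach_forward:
  assumes "n \<le> e" "e < N" "nested e" "m \<in> Mk"
  shows "step\<^sup>+\<^sup>+ (F (qs e) d, tp d (push 0 x) (pw e (push (dg m) el)), cnt (cs e) C)
    (F (qs (Suc e)) d, tp d x (pw (Suc e) (push (dg m) el)), cnt (cs (Suc e)) C)"
proof -
  have Mk: "MF (qs (Suc e)) \<in> Mk" using cs_le[of "Suc e"] assms by simp
  have "step\<^sup>+\<^sup>+ (F (qs e) d, tp d (push 0 x) (pw e (push (dg m) el)), cnt (cs e) C)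
    (Cal (MF (qs (Suc e))) d, tp d x (pw e (push (dg m) el)), cnt (cs (Suc e)) C)"
    using run[OF assms(1,2)]
  proof cases
    case (1 j)
    then show ?thesis
      by (intro tranclp.r_into_trancl stepI'[OF hooper_rules.inc]) (auto simp: cnt_def tr_reg')
  next
    case (2 j v)
    then show ?thesis
      by (intro tranclp.r_into_trancl stepI'[OF hooper_rules.dec]) (auto simp: cnt_def tr_reg')
  next
    case (3 j)
    let ?C = "(cnt (cs e) C)(j := C j)"
    have j: "cnt (cs e) C j = push 1 (C j)" using 3 tr_reg' by (simp add: cnt_def)
    have "step (F (qs e) d, tp d (push 0 x) (pw e (push (dg m) el)), cnt (cs e) C) (Z j (qs (Suc e)) d, tp d x (pw e (push (dg m) el)), ?C)"
      using 3 j by (intro stepI'[OF hooper_rules.zero]) (auto simp: opr_upd)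
    moreover have "step (Z j (qs (Suc e)) d, tp d x (pw e (push (dg m) el)), ?C) (Cal (MF (qs (Suc e))) d, tp d x (pw e (push (dg m) el)), cnt (cs (Suc e)) C)"
      using 3 j by (intro stepI'[OF hooper_rules.zero2]) (auto simp: opr_upd)
    ultimately show ?thesis by auto
  qed
  moreover have "step\<^sup>*\<^sup>* (Cal (MF (qs (Suc e))) d, tp d x (pw e (push (dg m) el)), cnt (cs (Suc e)) C) (F (qs (Suc e)) d, tp d x (pw (Suc e) (push (dg m) el)), cnt (cs (Suc e)) C)"
    using reach_Cal[OF assms(3) Mk assms(4), of d x el "cnt (cs (Suc e)) C"] by (simp add: tp_swap)
  ultimately show ?thesis by (rule tranclp_rtranclp_tranclp)
qed

lemma reach_forwards:
  assumes "n + r \<le> N" "\<And>e'. e' < n + r \<Longrightarrow> nested e'" "m \<in> Mk"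
  shows "step\<^sup>*\<^sup>* (F (qs n) d, tp d (pw r x) (pw n (push (dg m) el)), cnt (cs n) C)
    (F (qs (n + r)) d, tp d x (pw (n + r) (push (dg m) el)), cnt (cs (n + r)) C)"
  using assms(1,2)
proof (induction r arbitrary: x)
  case (Suc r)
  have "step\<^sup>*\<^sup>* (F (qs n) d, tp d (pw r (push 0 x)) (pw n (push (dg m) el)), cnt (cs n) C)
    (F (qs (n + r)) d, tp d (push 0 x) (pw (n + r) (push (dg m) el)), cnt (cs (n + r)) C)"
    using Suc.IH[of "push 0 x"] Suc.prems by simp
  also have "step\<^sup>*\<^sup>* \<dots> (F (qs (Suc (n + r))) d, tp d x (pw (Suc (n + r)) (push (dg m) el)), cnt (cs (Suc (n + r))) C)"
    using Suc.prems assms(3) by (intro tranclp_into_rtranclp reach_forward) auto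
  finally (rtranclp_trans) show ?case by simp
qed simp

text \<open>The fuel ends either during loading or after \<open>e - n\<close> steps of the program;
  in both cases only shorter nested executions are met.\<close>

lemma nested_all: "e \<le> N \<Longrightarrow> nested e"
proof (induction e rule: less_induct)
  case (less e)
  then have IH: "\<And>e'. e' < e \<Longrightarrow> nested e'" by simp
  show ?case unfolding nested_def
  proof (intro allI impI)
    fix d m m' el r C assume m: "m \<in> Mk" "m' \<in> Mk"
    let ?el = "pw e (push (dg m) el)" and ?x = "push (dg m') r"
    have E: "step\<^sup>*\<^sup>* (E m' d, tp d r ?el, c) (B d, tp d ?x ?el, c)" for c
      using m by (intro r_into_rtranclp stepI'[OF hooper_rules.turn]) auto
    show "step\<^sup>*\<^sup>* (FL n d, tp d (pw e ?x) (push (dg m) el), psh C) (resume m d (pw e ?x) el C)"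
    proof (cases "e \<le> n")
      case True
      have "step\<^sup>*\<^sup>* (FL n d, tp d (pw e ?x) (push (dg m) el), psh C) (FL (n - e) d, tp d ?x ?el, cnt (init e) C)"
        using reach_load[OF True, of d 0] by simp
      also have "step\<^sup>*\<^sup>* (FL (n - e) d, tp d ?x ?el, cnt (init e) C) (E m' d, tp d r ?el, cnt (init e) C)"
        using m by (intro r_into_rtranclp stepI'[OF hooper_rules.load_end]) auto
      also (rtranclp_trans) note E
      also (rtranclp_trans) have "step\<^sup>*\<^sup>* (B d, tp d ?x ?el, cnt (init e) C) (resume m d (pw e ?x) el C)"
        using IH m by (intro reach_back) (auto simp: init_def)
      finally (rtranclp_trans) show ?thesis .
    next
      case False
      then have e: "e = n + (e - n)" by simp
      have "step\<^sup>*\<^sup>* (FL n d, tp d (pw e ?x) (push (dg m) el), psh C) (F (qs n) d, tp d (pw (e - n) ?x) (pw n (push (dg m) el)), cnt (cs n) C)"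
        using reach_start[of d "e - n"] e by simp
      also have "step\<^sup>*\<^sup>* \<dots> (F (qs e) d, tp d ?x ?el, cnt (cs e) C)"
        using reach_forwards[of "e - n" m d ?x el C] IH m less.prems e by simp
      also (rtranclp_trans) have "step\<^sup>*\<^sup>* (F (qs e) d, tp d ?x ?el, cnt (cs e) C) (E m' d, tp d r ?el, cnt (cs e) C)"
        using m cs_le[of e] False less.prems by (intro r_into_rtranclp stepI'[OF hooper_rules.fuel_end]) auto
      also (rtranclp_trans) note E
      also (rtranclp_trans) have "step\<^sup>*\<^sup>* (B d, tp d ?x ?el, cnt (cs e) C) (resume m d (pw e ?x) el C)"
        using IH m cs_le[of e] False less.prems by (intro reach_back) auto
      finally (rtranclp_trans) show ?thesis .
    qed
  qed
qed

text \<open>A stack fixed by pushing 0 never runs out of fuel, and every program step of the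
  outermost execution costs at least one machine step.\<close>

theorem long_run:
  assumes fuel: "push 0 x = x"
  shows "\<exists>f. \<forall>i < N - n. step (f i) (f (Suc i))"
proof -
  let ?c = "\<lambda>e. (F (qs (n + e)) True, tp True x (pw (n + e) (push (dg MB) x)), cnt (cs (n + e)) (\<lambda>_. x))"
  have go: "\<exists>f m. e \<le> m \<and> f m = ?c e \<and> (\<forall>i < m. step (f i) (f (Suc i)))" if "n + e \<le> N" for e
    using that
  proof (induction e)
    case 0
    then show ?case by (intro exI[of _ "\<lambda>_. ?c 0"] exI[of _ 0]) simp
  next
    case (Suc e)
    then obtain f m where f: "e \<le> m" "f m = ?c e" "\<forall>i < m. step (f i) (f (Suc i))" by auto
    have "step\<^sup>+\<^sup>+ (?c e) (?c (Suc e))"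
      using reach_forward[of "n + e" MB True x x "\<lambda>_. x"] Suc.prems nested_all[of "n + e"] MB_Mk fuel by simp
    then obtain l where l: "l > 0" "(step ^^ l) (?c e) (?c (Suc e))"
      by (auto simp: tranclp_power)
    then obtain g where g: "g 0 = ?c e" "g l = ?c (Suc e)" "\<forall>i < l. step (g i) (g (Suc i))"
      by (auto simp: relpowp_fun_conv)
    let ?f = "\<lambda>i. if i \<le> m then f i else g (i - m)"
    have "step (?f i) (?f (Suc i))" if "i < m + l" for i
    proof (cases "i < m")
      case True
      then show ?thesis using f by simp
    next
      case False
      then have "?f i = g (i - m)" "?f (Suc i) = g (Suc (i - m))" using f g by (auto simp: Suc_diff_le)
      then show ?thesis using g(3) that False by simp
    qed
    moreover have "?f (m + l) = ?c (Suc e)" using g(2) l(1) by simp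
    moreover have "Suc e \<le> m + l" using l(1) f(1) by simp
    ultimately show ?case by (intro exI[of _ ?f] exI[of _ "m + l"] conjI allI impI)
  qed
  show ?thesis
  proof (cases "n \<le> N")
    case True
    then obtain f m where "N - n \<le> m" "\<forall>i < m. step (f i) (f (Suc i))" using go[of "N - n"] by auto
    then show ?thesis by (intro exI[of _ f]) auto
  qed auto
qed

end

end

section \<open>Counter programs\<close>

datatype com = Inc nat | Wh nat "com list"

instance com :: countable by countable_datatype

inductive cstep :: "com list \<times> (nat \<Rightarrow> nat) \<Rightarrow> com list \<times> (nat \<Rightarrow> nat) \<Rightarrow> bool" where
  "cstep (Inc j # p, s) (p, s(j := Suc (s j)))"
| "s j = 0 \<Longrightarrow> cstep (Wh j b # p, s) (p, s)"
| "s j = Suc v \<Longrightarrow> cstep (Wh j b # p, s) (b @ Wh j b # p, s(j := v))"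

text \<open>Quantification over the continuation makes sequencing compositional.\<close>

definition runs :: "com list \<Rightarrow> (nat \<Rightarrow> nat) \<Rightarrow> (nat \<Rightarrow> nat) \<Rightarrow> bool" where
  "runs p s s' \<longleftrightarrow> (\<forall>k. cstep\<^sup>*\<^sup>* (p @ k, s) (k, s'))"

lemma runs_Nil: "runs [] s s"
  by (simp add: runs_def)

lemma runs_append: "runs p s s' \<Longrightarrow> runs q s' s'' \<Longrightarrow> runs (p @ q) s s''"
  unfolding runs_def by (metis append.assoc rtranclp_trans)

lemma runs_Inc: "runs [Inc j] s (s(j := Suc (s j)))"
  unfolding runs_def by (auto intro: cstep.intros)

lemma runs_Wh_0: "s j = 0 \<Longrightarrow> runs [Wh j b] s s"
  unfolding runs_def by (auto intro: cstep.intros)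

lemma runs_Wh_Suc:
  assumes "s j = Suc v" "runs b (s(j := v)) s'" "runs [Wh j b] s' s''"
  shows "runs [Wh j b] s s''"
  unfolding runs_def
proof
  fix k
  have "cstep ([Wh j b] @ k, s) (b @ Wh j b # k, s(j := v))" using cstep.intros(3)[of s j v b k] assms(1) by simp
  moreover have "cstep\<^sup>*\<^sup>* (b @ Wh j b # k, s(j := v)) (Wh j b # k, s')" using assms(2) unfolding runs_def by blast
  moreover have "cstep\<^sup>*\<^sup>* (Wh j b # k, s') (k, s'')" using assms(3) unfolding runs_def by simp
  ultimately show "cstep\<^sup>*\<^sup>* ([Wh j b] @ k, s) (k, s'')" by (meson converse_rtranclp_into_rtranclp rtranclp_trans)
qed

lemma runs_clear: "runs [Wh x []] s (s(x := 0))"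
proof (induction "s x" arbitrary: s)
  case 0
  then show ?case using runs_Wh_0[of s x "[]"] by (metis fun_upd_triv)
next
  case (Suc v)
  show ?case
    by (rule runs_Wh_Suc[of s x v "[]" "s(x := v)"]) (use Suc(1)[of "s(x := v)"] Suc(2) runs_Nil in simp_all)
qed

lemma runs_move: "x \<noteq> y \<Longrightarrow> runs [Wh x [Inc y]] s (s(x := 0, y := s y + s x))"
proof (induction "s x" arbitrary: s)
  case 0
  then have e: "s(x := 0, y := s y + s x) = s" by auto
  show ?case unfolding e using 0 runs_Wh_0[of s x] by simp
next
  case (Suc v)
  let ?s = "(s(x := v))(y := Suc ((s(x := v)) y))"
  show ?case
  proof (rule runs_Wh_Suc[of s x v "[Inc y]" ?s])
    show "s x = Suc v" using Suc(2) by simp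
    show "runs [Inc y] (s(x := v)) ?s" by (rule runs_Inc)
    have "?s(x := 0, y := ?s y + ?s x) = s(x := 0, y := s y + s x)" using Suc by (auto simp: fun_eq_iff)
    then show "runs [Wh x [Inc y]] ?s (s(x := 0, y := s y + s x))" using Suc(1)[of ?s] Suc(3) by simp
  qed
qed

lemma runs_move2: "x \<noteq> y \<Longrightarrow> x \<noteq> t \<Longrightarrow> y \<noteq> t \<Longrightarrow> runs [Wh x [Inc y, Inc t]] s (s(x := 0, y := s y + s x, t := s t + s x))"
proof (induction "s x" arbitrary: s)
  case 0
  then have e: "s(x := 0, y := s y + s x, t := s t + s x) = s" by auto
  show ?case unfolding e using 0 runs_Wh_0[of s x] by simp
next
  case (Suc v)
  let ?s1 = "(s(x := v))(y := Suc ((s(x := v)) y))"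
  let ?s = "?s1(t := Suc (?s1 t))"
  show ?case
  proof (rule runs_Wh_Suc[of s x v "[Inc y, Inc t]" ?s])
    show "s x = Suc v" using Suc(2) by simp
    show "runs [Inc y, Inc t] (s(x := v)) ?s" using runs_append[OF runs_Inc[of y "s(x := v)"] runs_Inc[of t ?s1]] by (simp only: append_Cons append_Nil)
    have "?s(x := 0, y := ?s y + ?s x, t := ?s t + ?s x) = s(x := 0, y := s y + s x, t := s t + s x)"
      using Suc by (auto simp: fun_eq_iff)
    then show "runs [Wh x [Inc y, Inc t]] ?s (s(x := 0, y := s y + s x, t := s t + s x))" using Suc(1)[of ?s] Suc(3-) by simp
  qed
qed

definition copy :: "nat \<Rightarrow> nat \<Rightarrow> nat \<Rightarrow> com list" where
  "copy x y t = [Wh x [Inc y, Inc t]] @ [Wh t [Inc x]]"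

lemma runs_copy:
  assumes "x \<noteq> y" "x \<noteq> t" "y \<noteq> t" "s t = 0"
  shows "runs (copy x y t) s (s(y := s y + s x))"
proof -
  let ?s = "s(x := 0, y := s y + s x, t := s t + s x)"
  have "runs (copy x y t) s (?s(t := 0, x := ?s x + ?s t))"
    unfolding copy_def using assms by (intro runs_append[OF runs_move2 runs_move]) auto
  moreover have "?s(t := 0, x := ?s x + ?s t) = s(y := s y + s x)" using assms by (auto simp: fun_eq_iff)
  ultimately show ?thesis by simp
qed

inductive_cases eval_Zr: "eval Zr xs y"
inductive_cases eval_Sc: "eval Sc xs y"
inductive_cases eval_Id: "eval (Id i) xs y"
inductive_cases eval_Cn: "eval (Cn f gs) xs y"
inductive_cases eval_Pr: "eval (Pr f g) xs y"
inductive_cases eval_Pr0: "eval (Pr f g) (0 # xs) y"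
inductive_cases eval_PrS: "eval (Pr f g) (Suc n # xs) y"
inductive_cases eval_Mn: "eval (Mn f) xs y"

lemma eval_Pr_chain:
  "eval (Pr f g) (n # xs) y \<Longrightarrow> \<exists>Y. eval f xs (Y 0) \<and> (\<forall>i<n. eval g (i # Y i # xs) (Y (Suc i))) \<and> Y n = y"
proof (induction n arbitrary: y)
  case 0
  then have "eval f xs y" by (rule eval_Pr0)
  then show ?case by (intro exI[of _ "\<lambda>_. y"]) simp
next
  case (Suc n)
  from Suc.prems obtain z where z: "eval (Pr f g) (n # xs) z" "eval g (n # z # xs) y" by (rule eval_PrS)
  obtain Y where Y: "eval f xs (Y 0)" "\<forall>i<n. eval g (i # Y i # xs) (Y (Suc i))" "Y n = z" using Suc.IH[OF z(1)] by blast
  show ?case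
    by (intro exI[of _ "Y(Suc n := y)"]) (use Y z in \<open>auto simp: less_Suc_eq\<close>)
qed

text \<open>Arguments are read from \<open>as\<close>, the result goes to \<open>u\<close>, and
  registers from \<open>b\<close> on are scratch: zero before, and zero again in the final
  state.\<close>

definition compiles :: "recf \<Rightarrow> nat list \<Rightarrow> nat \<Rightarrow> nat \<Rightarrow> com list \<Rightarrow> bool" where
  "compiles f as u b P \<longleftrightarrow> (\<forall>s xs y. length xs = length as \<longrightarrow> (\<forall>i<length as. s (as ! i) = xs ! i) \<longrightarrow> (\<forall>j\<ge>b. s j = 0) \<longrightarrow>
     s u = 0 \<longrightarrow> eval f xs y \<longrightarrow> runs P s (s(u := y)))"

lemma compilesD:
  assumes "compiles f as u b P" "length xs = length as" "\<And>i. i < length as \<Longrightarrow> s (as ! i) = xs ! i" "\<And>j. b \<le> j \<Longrightarrow> s j = 0" "s u = 0" "eval f xs y" "s' = s(u := y)"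
  shows "runs P s s'"
  using assms unfolding compiles_def by blast

definition store :: "(nat \<Rightarrow> nat) \<Rightarrow> nat \<Rightarrow> nat list \<Rightarrow> nat \<Rightarrow> nat" where
  "store s b ys = (\<lambda>r. if b \<le> r \<and> r < b + length ys then ys ! (r - b) else s r)"

text \<open>The inner results are parked in the first scratch registers, above which the subprograms
  work, and are cleared at the end.\<close>

lemma compile_Cn:
  assumes f: "\<And>as u b. u < b \<Longrightarrow> (\<forall>a\<in>set as. a < b \<and> a \<noteq> u) \<Longrightarrow> \<exists>P. compiles f as u b P"
    and gs: "\<And>g as u b. g \<in> set gs \<Longrightarrow> u < b \<Longrightarrow> (\<forall>a\<in>set as. a < b \<and> a \<noteq> u) \<Longrightarrow> \<exists>P. compiles g as u b P"
    and u: "u < b" "\<forall>a\<in>set as. a < b \<and> a \<noteq> u"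
  shows "\<exists>P. compiles (Cn f gs) as u b P"
proof -
  let ?k = "length gs"
  have "\<exists>P. i < ?k \<longrightarrow> compiles (gs ! i) as (b + i) (b + ?k) P" for i
    using gs[of "gs ! i" "b + i" "b + ?k" as] u by fastforce
  then obtain Pg where Pg: "\<And>i. i < ?k \<Longrightarrow> compiles (gs ! i) as (b + i) (b + ?k) (Pg i)" by metis
  obtain Pf where Pf: "compiles f [b..<b + ?k] u (b + ?k) Pf" using f[of u "b + ?k" "[b..<b + ?k]"] u by auto
  have "compiles (Cn f gs) as u b (concat (map Pg [0..<?k]) @ Pf @ map (\<lambda>i. Wh (b + i) []) [0..<?k])"
    unfolding compiles_def
  proof (intro allI impI)
    fix s xs y assume h: "length xs = length as" "\<forall>i<length as. s (as ! i) = xs ! i" "\<forall>j\<ge>b. s j = 0" "s u = 0" "eval (Cn f gs) xs y"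
    obtain ys where ys: "list_all2 (\<lambda>g y. eval g xs y) gs ys" "eval f ys y" using h(5) by (rule eval_Cn)
    have k: "length ys = ?k" using ys(1) by (simp add: list_all2_lengthD)
    have "runs (concat (map Pg [0..<i])) s (store s b (take i ys))" if "i \<le> ?k" for i
      using that
    proof (induction i)
      case 0
      have "store s b [] = s" by (auto simp: store_def fun_eq_iff)
      then show ?case by (simp add: runs_Nil)
    next
      case (Suc i)
      have "runs (Pg i) (store s b (take i ys)) (store s b (take (Suc i) ys))"
      proof (rule compilesD[OF Pg])
        show "store s b (take i ys) (as ! j) = xs ! j" if "j < length as" for j
        proof -
          have "as ! j < b" using u(2) nth_mem[OF that] by blast
          then show ?thesis using h(2) that by (simp add: store_def)
        qed
        show "store s b (take i ys) j = 0" if "b + ?k \<le> j" for j using that h(3) Suc.prems k by (auto simp: store_def)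
        show "store s b (take i ys) (b + i) = 0" using h(3) Suc.prems k by (auto simp: store_def)
        show "eval (gs ! i) xs (ys ! i)" using list_all2_nthD[OF ys(1), of i] Suc.prems by simp
        show "store s b (take (Suc i) ys) = (store s b (take i ys))(b + i := ys ! i)"
          using Suc.prems k by (auto simp: store_def fun_eq_iff nth_append take_Suc_conv_app_nth)
      qed (use Suc.prems h(1) in auto)
      then show ?case using Suc by (auto intro: runs_append)
    qed
    from this[of ?k] have r1: "runs (concat (map Pg [0..<?k])) s (store s b ys)" using k by simp
    have r2: "runs Pf (store s b ys) ((store s b ys)(u := y))"
      by (rule compilesD[OF Pf _ _ _ _ ys(2)]) (use u h k in \<open>auto simp: store_def\<close>)
    have "runs (map (\<lambda>i. Wh (b + i) []) [0..<i]) s1 (\<lambda>r. if b \<le> r \<and> r < b + i then 0 else s1 r)" for i s1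
    proof (induction i)
      case 0
      have "(\<lambda>r. if b \<le> r \<and> r < b + 0 then 0 else s1 r) = s1" by (auto simp: fun_eq_iff)
      then show ?case by (simp add: runs_Nil)
    next
      case (Suc i)
      have "(\<lambda>r. if b \<le> r \<and> r < b + Suc i then 0 else s1 r) = (\<lambda>r. if b \<le> r \<and> r < b + i then 0 else s1 r)(b + i := 0)"
        by (auto simp: fun_eq_iff)
      then show ?case using runs_append[OF Suc runs_clear[of "b + i"]] by simp
    qed
    from this[of ?k "(store s b ys)(u := y)"]
    have "runs (map (\<lambda>i. Wh (b + i) []) [0..<?k]) ((store s b ys)(u := y)) (\<lambda>r. if b \<le> r \<and> r < b + ?k then 0 else ((store s b ys)(u := y)) r)" .
    moreover have "(\<lambda>r. if b \<le> r \<and> r < b + ?k then 0 else ((store s b ys)(u := y)) r) = s(u := y)"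
      using u h(3) k by (auto simp: store_def fun_eq_iff)
    ultimately have r3: "runs (map (\<lambda>i. Wh (b + i) []) [0..<?k]) ((store s b ys)(u := y)) (s(u := y))" by simp
    show "runs (concat (map Pg [0..<?k]) @ Pf @ map (\<lambda>i. Wh (b + i) []) [0..<?k]) s (s(u := y))"
      by (intro runs_append[OF r1] runs_append[OF r2] r3)
  qed
  then show ?thesis by blast
qed

lemma compile_Pr:
  assumes f: "\<And>as u b. u < b \<Longrightarrow> (\<forall>a\<in>set as. a < b \<and> a \<noteq> u) \<Longrightarrow> \<exists>P. compiles f as u b P"
    and g: "\<And>as u b. u < b \<Longrightarrow> (\<forall>a\<in>set as. a < b \<and> a \<noteq> u) \<Longrightarrow> \<exists>P. compiles g as u b P"
    and u: "u < b" "\<forall>a\<in>set as. a < b \<and> a \<noteq> u"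
  shows "\<exists>P. compiles (Pr f g) as u b P"
proof (cases as)
  case Nil
  \<comment> \<open>Without an argument to recurse on, \<open>Pr\<close> has no value.\<close>
  have "compiles (Pr f g) as u b []" unfolding compiles_def Nil by (auto elim: eval_Pr)
  then show ?thesis by blast
next
  case (Cons a0 rest)
  have as: "a0 < b" "a0 \<noteq> u" "\<forall>a\<in>set rest. a < b \<and> a \<noteq> u" using u Cons by auto
  obtain Pf where Pf: "compiles f rest (b + 2) (b + 4) Pf" using f[of "b + 2" "b + 4" rest] as by fastforce
  obtain Pg where Pg: "compiles g ((b + 1) # (b + 2) # rest) (b + 3) (b + 4) Pg"
    using g[of "b + 3" "b + 4" "(b + 1) # (b + 2) # rest"] as by fastforce
  \<comment> \<open>Register \<open>b\<close> counts the remaining rounds, \<open>b + 1\<close> the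
    completed ones, \<open>b + 2\<close> holds the current value and \<open>b + 3\<close> receives
    the next.\<close>
  let ?body = "Pg @ [Wh (b + 2) []] @ [Wh (b + 3) [Inc (b + 2)]] @ [Inc (b + 1)]"
  have "compiles (Pr f g) as u b (copy a0 b (b + 4) @ Pf @ [Wh b ?body] @ [Wh (b + 2) [Inc u]] @ [Wh (b + 1) []])"
    unfolding compiles_def
  proof (intro allI impI)
    fix s xs y assume h: "length xs = length as" "\<forall>i<length as. s (as ! i) = xs ! i" "\<forall>j\<ge>b. s j = 0" "s u = 0" "eval (Pr f g) xs y"
    obtain n ys where xs: "xs = n # ys" using h(1) Cons by (cases xs) auto
    have n: "s a0 = n" and rest: "\<And>i. i < length rest \<Longrightarrow> s (rest ! i) = ys ! i" and len: "length ys = length rest"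
      using h(1,2) Cons xs by force+
    obtain Y where Y: "eval f ys (Y 0)" "\<forall>i<n. eval g (i # Y i # ys) (Y (Suc i))" "Y n = y"
      using eval_Pr_chain h(5) xs by blast
    define st where "st i = s(b := n - i, b + 1 := i, b + 2 := Y i)" for i
    have rest': "rest ! i < b" if "i < length rest" for i using as(3) nth_mem[OF that] by blast
    have "runs (copy a0 b (b + 4)) s (s(b := s b + s a0))" using as h(3) by (intro runs_copy) auto
    moreover have "s(b := s b + s a0) = s(b := n)" using n h(3) by simp
    ultimately have r1: "runs (copy a0 b (b + 4)) s (s(b := n))" by simp
    have r2: "runs Pf (s(b := n)) (st 0)"
    proof (rule compilesD[OF Pf len _ _ _ Y(1)])
      show "(s(b := n)) (rest ! i) = ys ! i" if "i < length rest" for i using rest[OF that] rest'[OF that] by simp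
      show "st 0 = (s(b := n))(b + 2 := Y 0)" using h(3) by (auto simp: st_def fun_eq_iff)
    qed (use h(3) in auto)
    have loop: "runs [Wh b ?body] (st i) (st n)" if "i \<le> n" for i
      using that
    proof (induction "n - i" arbitrary: i)
      case 0
      then have "i = n" by simp
      show ?case unfolding \<open>i = n\<close> by (rule runs_Wh_0) (simp add: st_def)
    next
      case (Suc v)
      let ?s = "(st i)(b := v)"
      have i: "i < n" using Suc by simp
      have a: "runs Pg ?s (?s(b + 3 := Y (Suc i)))"
      proof (rule compilesD[OF Pg])
        show "length (i # Y i # ys) = length ((b + 1) # (b + 2) # rest)" using len by simp
        show "?s (((b + 1) # (b + 2) # rest) ! j) = (i # Y i # ys) ! j" if "j < length ((b + 1) # (b + 2) # rest)" for j
        proof -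
          consider "j = 0" | "j = 1" | j' where "j = Suc (Suc j')" by (metis One_nat_def not0_implies_Suc)
          then show ?thesis
          proof cases
            case (3 j')
            then have j': "j' < length rest" using that by simp
            have "rest ! j' < b" by (rule rest'[OF j'])
            then show ?thesis using 3 rest[OF j'] by (simp add: st_def)
          qed (simp_all add: st_def)
        qed
        show "eval g (i # Y i # ys) (Y (Suc i))" using Y i by blast
      qed (use h(3) in \<open>auto simp: st_def\<close>)
      let ?s3 = "?s(b + 3 := Y (Suc i))"
      have m: "runs [Wh (b + 3) [Inc (b + 2)]] (?s3(b + 2 := 0)) (?s3(b + 2 := 0, b + 3 := 0, b + 2 := Y (Suc i)))"
        using runs_move[of "b + 3" "b + 2" "?s3(b + 2 := 0)"] by simp
      let ?s4 = "?s3(b + 2 := 0, b + 3 := 0, b + 2 := Y (Suc i))"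
      have "runs ?body ?s (?s4(b + 1 := Suc (?s4 (b + 1))))"
        by (intro runs_append[OF a] runs_append[OF runs_clear] runs_append[OF m] runs_Inc)
      moreover have "?s4(b + 1 := Suc (?s4 (b + 1))) = st (Suc i)"
        using h(3) Suc(2) by (auto simp: st_def fun_eq_iff)
      ultimately have "runs ?body ?s (st (Suc i))" by simp
      moreover have "st i b = Suc v" using Suc(2) by (simp add: st_def)
      ultimately show ?case using Suc(1)[of "Suc i"] Suc(2) i by (intro runs_Wh_Suc[of "st i" b v]) auto
    qed
    have r4: "runs [Wh (b + 2) [Inc u]] (st n) ((st n)(b + 2 := 0, u := y))"
      using runs_move[of "b + 2" u "st n"] u h(4) Y(3) by (simp add: st_def)
    have "(st n)(b + 2 := 0, u := y, b + 1 := 0) = s(u := y)" using h(3) u by (auto simp: st_def fun_eq_iff)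
    then have r5: "runs [Wh (b + 1) []] ((st n)(b + 2 := 0, u := y)) (s(u := y))"
      using runs_clear[of "b + 1" "(st n)(b + 2 := 0, u := y)"] by simp
    show "runs (copy a0 b (b + 4) @ Pf @ [Wh b ?body] @ [Wh (b + 2) [Inc u]] @ [Wh (b + 1) []]) s (s(u := y))"
      by (intro runs_append[OF r1] runs_append[OF r2] runs_append[OF loop[of 0]] runs_append[OF r4] r5) simp
  qed
  then show ?thesis by blast
qed

lemma compile_Mn:
  assumes f: "\<And>as u b. u < b \<Longrightarrow> (\<forall>a\<in>set as. a < b \<and> a \<noteq> u) \<Longrightarrow> \<exists>P. compiles f as u b P"
    and u: "u < b" "\<forall>a\<in>set as. a < b \<and> a \<noteq> u"
  shows "\<exists>P. compiles (Mn f) as u b P"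
proof -
  obtain Pf where Pf: "compiles f (b # as) (b + 1) (b + 2) Pf" using f[of "b + 1" "b + 2" "b # as"] u by fastforce
  \<comment> \<open>Register \<open>b\<close> holds the candidate and \<open>b + 1\<close> the value
    of \<open>f\<close> there; the loop continues while that value is positive.\<close>
  let ?body = "[Wh (b + 1) []] @ [Inc b] @ Pf"
  have "compiles (Mn f) as u b (Pf @ [Wh (b + 1) ?body] @ [Wh b [Inc u]])"
    unfolding compiles_def
  proof (intro allI impI)
    fix s xs n assume h: "length xs = length as" "\<forall>i<length as. s (as ! i) = xs ! i" "\<forall>j\<ge>b. s j = 0" "s u = 0" "eval (Mn f) xs n"
    have n: "eval f (n # xs) 0" "\<forall>m<n. \<exists>y. 0 < y \<and> eval f (m # xs) y" using h(5) by (auto elim: eval_Mn)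
    then have "\<exists>y. (m < n \<longrightarrow> 0 < y \<and> eval f (m # xs) y) \<and> (m = n \<longrightarrow> y = 0)" for m by (cases "m < n") auto
    then obtain Y where Y: "\<And>m. m < n \<Longrightarrow> 0 < Y m \<and> eval f (m # xs) (Y m)" "Y n = 0" by metis
    then have ev: "eval f (m # xs) (Y m)" if "m \<le> n" for m using n(1) that by (cases "m = n") auto
    define st where "st i = s(b := i, b + 1 := Y i)" for i
    have as: "as ! i < b" if "i < length as" for i using u(2) nth_mem[OF that] by blast
    have P: "runs Pf (s(b := i)) (st i)" if "i \<le> n" for i
    proof (rule compilesD[OF Pf _ _ _ _ ev[OF that]])
      show "(s(b := i)) ((b # as) ! j) = (i # xs) ! j" if "j < length (b # as)" for j
        using that h(2) as by (cases j) auto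
      show "st i = (s(b := i))(b + 1 := Y i)" by (simp add: st_def)
    qed (use h in auto)
    have loop: "runs [Wh (b + 1) ?body] (st i) (st n)" if "i \<le> n" for i
      using that
    proof (induction "n - i" arbitrary: i)
      case 0
      then have "i = n" by simp
      show ?case unfolding \<open>i = n\<close> by (rule runs_Wh_0) (simp add: st_def Y(2))
    next
      case (Suc v)
      then have i: "i < n" by simp
      then obtain w where w: "Y i = Suc w" using Y(1)[OF i] gr0_implies_Suc by blast
      let ?s = "(st i)(b + 1 := w)"
      let ?s1 = "?s(b + 1 := 0)"
      have e: "?s1(b := Suc (?s1 b)) = s(b := Suc i)" using h(3) by (auto simp: st_def fun_eq_iff)
      have i2: "runs [Inc b] ?s1 (s(b := Suc i))" using runs_Inc[of b ?s1] unfolding e .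
      have "runs ?body ?s (st (Suc i))"
        using i by (intro runs_append[OF runs_clear] runs_append[OF i2] P) simp
      moreover have "st i (b + 1) = Suc w" using w by (simp add: st_def)
      ultimately show ?case using Suc(1)[of "Suc i"] Suc(2) i by (intro runs_Wh_Suc[of "st i" "b + 1" w]) auto
    qed
    have r1: "runs Pf s (st 0)"
    proof -
      have "s(b := 0) = s" using h(3) by auto
      then show ?thesis using P[of 0] by simp
    qed
    have "(st n)(b := 0, u := (st n) u + (st n) b) = s(u := n)" using h(3,4) u Y(2) by (auto simp: st_def fun_eq_iff)
    then have r3: "runs [Wh b [Inc u]] (st n) (s(u := n))" using runs_move[of b u "st n"] u by simp
    show "runs (Pf @ [Wh (b + 1) ?body] @ [Wh b [Inc u]]) s (s(u := n))"
      by (intro runs_append[OF r1] runs_append[OF loop[of 0]] r3) simp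
  qed
  then show ?thesis by blast
qed

theorem compile: "u < b \<Longrightarrow> (\<forall>a\<in>set as. a < b \<and> a \<noteq> u) \<Longrightarrow> \<exists>P. compiles f as u b P"
proof (induction f arbitrary: as u b)
  case Zr
  have "compiles Zr as u b []" unfolding compiles_def
    by (auto elim!: eval_Zr) (metis fun_upd_triv runs_Nil)
  then show ?case by blast
next
  case Sc
  show ?case
  proof (cases as)
    case Nil
    have "compiles Sc as u b []" unfolding compiles_def Nil by (auto elim: eval_Sc)
    then show ?thesis by blast
  next
    case (Cons a rest)
    have "compiles Sc as u b (copy a u b @ [Inc u])" unfolding compiles_def
    proof (intro allI impI)
      fix s xs y assume h: "length xs = length as" "\<forall>i<length as. s (as ! i) = xs ! i" "\<forall>j\<ge>b. s j = 0" "s u = 0" "eval Sc xs y"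
      obtain x where x: "y = Suc x" "s a = x" using h(5,1,2) Cons by (auto elim!: eval_Sc)
      have "runs (copy a u b) s (s(u := s u + s a))" using Sc Cons h(3) by (intro runs_copy) auto
      from runs_append[OF this runs_Inc[of u]] show "runs (copy a u b @ [Inc u]) s (s(u := y))" using x h(4) by simp
    qed
    then show ?thesis by blast
  qed
next
  case (Id i)
  have "compiles (Id i) as u b (copy (as ! i) u b)" unfolding compiles_def
  proof (intro allI impI)
    fix s xs y assume h: "length xs = length as" "\<forall>i<length as. s (as ! i) = xs ! i" "\<forall>j\<ge>b. s j = 0" "s u = 0" "eval (Id i) xs y"
    have i: "i < length as" "y = xs ! i" using h(5,1) by (auto elim!: eval_Id)
    then have "as ! i < b" "as ! i \<noteq> u" using Id nth_mem[OF i(1)] by blast+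
    then have "runs (copy (as ! i) u b) s (s(u := s u + s (as ! i)))" using Id h(3) by (intro runs_copy) auto
    then show "runs (copy (as ! i) u b) s (s(u := y))" using i h by simp
  qed
  then show ?case by blast
next
  case (Cn f gs)
  then show ?case by (intro compile_Cn) blast+
next
  case (Pr f g)
  then show ?case by (intro compile_Pr) blast+
next
  case (Mn f)
  then show ?case by (intro compile_Mn) blast+
qed

section \<open>Programs as finite counter machines\<close>

text \<open>These continuations serve as control states. There are finitely many because the body of
  a loop is always followed by the loop itself.\<close>

function (sequential) conts :: "com list \<Rightarrow> com list set" where
  "conts [] = {[]}"
| "conts (Inc j # p) = insert (Inc j # p) (conts p)"
| "conts (Wh j b # p) = insert (Wh j b # p) (conts p \<union> (\<lambda>d. d @ Wh j b # p) ` conts b)"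
  by pat_completeness auto
termination by (relation "measure (size_list size)") auto

lemma finite_conts: "finite (conts p)"
  by (induction p rule: conts.induct) auto

lemma self_conts: "p \<in> conts p"
  by (cases p rule: conts.cases) auto

fun moves :: "com list \<Rightarrow> (mop \<times> com list) list" where
  "moves [] = []"
| "moves (Inc j # p) = [(MInc j, p)]"
| "moves (Wh j b # p) = [(MZero j, p), (MDec j, b @ Wh j b # p)]"

lemma moves_append: "p \<noteq> [] \<Longrightarrow> moves (p @ q) = map (\<lambda>(m, r). (m, r @ q)) (moves p)"
  by (cases p rule: moves.cases) auto

lemma moves_conts: "q \<in> conts p \<Longrightarrow> (m, q') \<in> set (moves q) \<Longrightarrow> q' \<in> conts p"
proof (induction p arbitrary: q q' rule: conts.induct)
  case 1
  then show ?case by simp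
next
  case (2 j p)
  then show ?case using self_conts[of p] by auto
next
  case (3 j b p)
  consider "q = Wh j b # p" | "q \<in> conts p" | d where "d \<in> conts b" "q = d @ Wh j b # p" "d \<noteq> []"
    using 3(3) by auto
  then show ?case
  proof cases
    case 1
    then show ?thesis using 3(4) self_conts by auto
  next
    case 2
    then show ?thesis using 3 by auto
  next
    case (3 d)
    then obtain d' where "(m, d') \<in> set (moves d)" "q' = d' @ Wh j b # p"
      using \<open>(m, q') \<in> set (moves q)\<close> by (auto simp: moves_append)
    then show ?thesis using "3.IH"(2)[OF 3(1)] by auto
  qed
qed

definition machine :: "com list \<Rightarrow> (com list \<times> mop \<times> com list) set" where
  "machine p = {(q, m, q'). q \<in> conts p \<and> (m, q') \<in> set (moves q)}"

lemma finite_machine: "finite (machine p)"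
proof -
  have "machine p = (\<Union>q\<in>conts p. (\<lambda>(m, q'). (q, m, q')) ` set (moves q))" by (auto simp: machine_def)
  then show ?thesis using finite_conts by simp
qed

lemma machine_conts: "(q, m, q') \<in> machine p \<Longrightarrow> q \<in> conts p \<and> q' \<in> conts p"
  using moves_conts by (auto simp: machine_def)

definition perform :: "mop \<Rightarrow> (nat \<Rightarrow> nat) \<Rightarrow> (nat \<Rightarrow> nat) \<Rightarrow> bool" where
  "perform m s s' = (case m of MInc j \<Rightarrow> s' = s(j := Suc (s j)) | MDec j \<Rightarrow> \<exists>v. s j = Suc v \<and> s' = s(j := v) | MZero j \<Rightarrow> s j = 0 \<and> s' = s)"

lemma cstep_moves: "cstep (q, s) (q', s') \<longleftrightarrow> (\<exists>m. (m, q') \<in> set (moves q) \<and> perform m s s')"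
proof
  assume "cstep (q, s) (q', s')"
  then show "\<exists>m. (m, q') \<in> set (moves q) \<and> perform m s s'"
    by cases (auto simp: perform_def)
next
  assume "\<exists>m. (m, q') \<in> set (moves q) \<and> perform m s s'"
  then obtain m where "(m, q') \<in> set (moves q)" "perform m s s'" by blast
  then show "cstep (q, s) (q', s')"
    by (cases q rule: moves.cases) (auto simp: perform_def intro: cstep.intros)
qed

lemma cstep_deterministic: "cstep x y \<Longrightarrow> cstep x z \<Longrightarrow> y = z"
  by (erule cstep.cases; erule cstep.cases) auto

lemma cstep_Nil: "\<not> cstep ([], s) y"
  by (auto elim: cstep.cases)

text \<open>By determinism every run is an initial part of the halting one.\<close>

lemma cstep_run_bound:
  assumes "(cstep ^^ a) x ([], s)" "(cstep ^^ e) x y"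
  shows "e \<le> a"
  using assms
proof (induction a arbitrary: x e)
  case 0
  then show ?case
  proof (cases e)
    case (Suc e')
    then obtain z where "cstep x z" using 0(2) by (meson relpowp_Suc_E2)
    then show ?thesis using 0(1) cstep_Nil by auto
  qed simp
next
  case (Suc a)
  then obtain z where z: "cstep x z" "(cstep ^^ a) z ([], s)" by (meson relpowp_Suc_E2)
  show ?case
  proof (cases e)
    case (Suc e')
    then obtain z' where z': "cstep x z'" "(cstep ^^ e') z' y" using Suc.prems(2) by (meson relpowp_Suc_E2)
    have "z' = z" using z(1) z'(1) cstep_deterministic by blast
    then show ?thesis using Suc.IH[OF z(2)] z'(2) Suc by auto
  qed simp
qed

text \<open>Yields a lower bound on running time: to output a number from 0, a program takes at
  least that many steps.\<close>

lemma cstep_growth: "(cstep ^^ a) (p, s) (q, s') \<Longrightarrow> s' j \<le> s j + a"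
proof (induction a arbitrary: q s')
  case (Suc a)
  then obtain r t where "(cstep ^^ a) (p, s) (r, t)" "cstep (r, t) (q, s')" by auto
  moreover from this(2) have "s' j \<le> Suc (t j)" by cases auto
  ultimately show ?case using Suc.IH by fastforce
qed simp

theorem program_for_recf:
  assumes "\<And>n. eval r [n] (g n)"
  shows "\<exists>P. \<forall>n. runs P ((\<lambda>_. 0)(0 := n)) ((\<lambda>_. 0)(0 := n, 1 := g n))"
proof -
  obtain P where P: "compiles r [0] 1 2 P" using compile[of 1 2 "[0]" r] by auto
  have "runs P ((\<lambda>_. 0)(0 := n)) ((\<lambda>_. 0)(0 := n, 1 := g n))" for n
    by (rule compilesD[OF P _ _ _ _ assms[of n]]) auto
  then show ?thesis by blast
qed

section \<open>Stacks as real numbers\<close>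

typedef ui = "{0..1::real}" morphisms real_ui ui by auto

lemma real_ui_bounds: "0 \<le> real_ui x" "real_ui x \<le> 1"
  using real_ui[of x] by auto

text \<open>Pushing digits maps the unit interval to disjoint subintervals of a Cantor set. The digit 0 fixes
  the point 1, which therefore serves as inexhaustible fuel for long runs.\<close>

definition upush :: "nat \<Rightarrow> ui \<Rightarrow> ui" where
  "upush a x = ui ((real_ui x + 2) / 3 ^ Suc a)"

lemma real_upush: "3 ^ Suc a * real_ui (upush a x) = real_ui x + 2"
proof -
  have "real_ui x + 2 \<le> 3" using real_ui_bounds(2)[of x] by simp
  moreover have "(3::real) \<le> 3 ^ Suc a" by simp
  ultimately have "(real_ui x + 2) / 3 ^ Suc a \<le> 1" by (simp only: divide_le_eq_1) linarith
  then show ?thesis using real_ui_bounds(1)[of x] by (simp add: upush_def ui_inverse)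
qed

lemma ui_eqI: "real_ui x = real_ui y \<Longrightarrow> x = y"
  by (simp add: real_ui_inject)

text \<open>Digit \<open>a\<close> maps into the interval from 2 / 3^(a+1) to 1 / 3^a; these
  intervals are disjoint and move left as \<open>a\<close> grows.\<close>

lemma upush_less:
  assumes "a < b" shows "real_ui (upush b y) < real_ui (upush a x)"
proof -
  have "(3::real) * 3 ^ Suc a \<le> 3 ^ Suc b" using assms power_increasing[of "Suc (Suc a)" "Suc b" "3::real"] by simp
  then have "3 * 3 ^ Suc a * real_ui (upush b y) \<le> 3 ^ Suc b * real_ui (upush b y)"
    using real_ui_bounds(1) by (rule mult_right_mono)
  also have "\<dots> = real_ui y + 2" by (rule real_upush)
  also have "\<dots> < 3 * (real_ui x + 2)" using real_ui_bounds(2)[of y] real_ui_bounds(1)[of x] by simp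
  also have "\<dots> = 3 * 3 ^ Suc a * real_ui (upush a x)" by (simp only: mult.assoc real_upush)
  finally show ?thesis by (simp add: mult_less_cancel_left_pos)
qed

lemma upush_inj: "upush a x = upush b y \<longleftrightarrow> a = b \<and> x = y"
proof
  assume eq: "upush a x = upush b y"
  then have "a = b" using upush_less[of a b y x] upush_less[of b a x y] by (cases a b rule: linorder_cases) auto
  with eq real_upush[of a x] real_upush[of a y] show "a = b \<and> x = y" by (simp add: ui_eqI)
qed simp

lemma upush_eq_iff: "y = upush a x \<longleftrightarrow> 3 ^ Suc a * real_ui y = real_ui x + 2"
proof
  assume "3 ^ Suc a * real_ui y = real_ui x + 2"
  then have "3 ^ Suc a * real_ui y = 3 ^ Suc a * real_ui (upush a x)" by (simp only: real_upush)
  then show "y = upush a x" by (intro ui_eqI) simp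
qed (simp only: real_upush)

lemma upush_fixpoint: "upush 0 (ui 1) = ui 1"
  using upush_eq_iff[of "ui 1" 0 "ui 1"] by (simp add: ui_inverse)

section \<open>Stack operations as linear constraints\<close>

text \<open>Written as a sum of two cases so that the coefficients add up when \<open>i\<close> is
  0.\<close>

definition lf :: "int \<Rightarrow> int \<Rightarrow> nat \<Rightarrow> nat \<Rightarrow> int" where
  "lf a b i = (\<lambda>j. (if j = i then a else 0) + (if j = 0 then b else 0))"

lemma lf_sum: "i < d \<Longrightarrow> (\<Sum>j<d. real_of_int (lf a b i j) * x j) = a * x i + b * x 0"
proof -
  assume i: "i < d"
  have "(\<Sum>j<d. real_of_int (lf a b i j) * x j) = (\<Sum>j<d. (if j = i then a * x j else 0) + (if j = 0 then b * x j else 0))"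
    by (intro sum.cong refl) (auto simp: lf_def distrib_right)
  also have "\<dots> = a * x i + b * x 0" using i by (simp add: sum.distrib)
  finally show ?thesis .
qed

definition lin_eq :: "int \<Rightarrow> int \<Rightarrow> int \<Rightarrow> int \<Rightarrow> nat \<Rightarrow> ((nat \<Rightarrow> int) \<times> (nat \<Rightarrow> int)) list" where
  "lin_eq a b a' b' i = [(lf a b i, lf a' b' i), (lf (- a) (- b) i, lf (- a') (- b') i)]"

fun op_cons :: "int \<Rightarrow> op \<Rightarrow> nat \<Rightarrow> ((nat \<Rightarrow> int) \<times> (nat \<Rightarrow> int)) list" where
  "op_cons \<mu> Keep = lin_eq (- \<mu>) 0 1 0"
| "op_cons \<mu> (Push a) = lin_eq (- \<mu>) (- 2 * \<mu>) (3 ^ Suc a) 0"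
| "op_cons \<mu> (Pop a) = lin_eq (3 ^ Suc a * \<mu>) 0 (- 1) (- 2)"

definition op_at :: "(bool \<Rightarrow> op) \<Rightarrow> (nat \<Rightarrow> op) \<Rightarrow> nat \<Rightarrow> op" where
  "op_at t g i = (if i = 1 then t False else if i = 2 then t True else g (i - 3))"

text \<open>Coordinate 0 holds the unit in which the other coordinates, one per stack, are measured.\<close>

fun stack_cons :: "nat \<Rightarrow> (bool \<Rightarrow> op) \<times> (nat \<Rightarrow> op) \<times> int \<Rightarrow> ((nat \<Rightarrow> int) \<times> (nat \<Rightarrow> int)) list" where
  "stack_cons k (t, g, \<mu>) = lin_eq (- \<mu>) 0 1 0 0 @
     concat (map (\<lambda>i. (lf (- 1) 1 i, lf 0 0 i) # op_cons \<mu> (op_at t g i) i) [1..<k + 3])"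

text \<open>Homogeneous versions of the stack operations: the digit offset 2 becomes a multiple of
  the unit coordinate.\<close>

fun op_rel :: "real \<Rightarrow> op \<Rightarrow> real \<Rightarrow> real \<Rightarrow> real \<Rightarrow> real \<Rightarrow> bool" where
  "op_rel \<mu> Keep u0 u w0 w \<longleftrightarrow> w = \<mu> * u"
| "op_rel \<mu> (Push a) u0 u w0 w \<longleftrightarrow> 3 ^ Suc a * w = \<mu> * (u + 2 * u0)"
| "op_rel \<mu> (Pop a) u0 u w0 w \<longleftrightarrow> 3 ^ Suc a * \<mu> * u = w + 2 * w0"

lemma lin_eq_sat:
  assumes "i < d"
  shows "(\<forall>(f, g)\<in>set (lin_eq a b a' b' i). 0 \<le> (\<Sum>j<d. real_of_int (f j) * u j) + M * (\<Sum>j<d. real_of_int (g j) * w j)) \<longleftrightarrow>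
    a * u i + b * u 0 + M * (a' * w i + b' * w 0) = 0"
proof -
  have "0 \<le> a * u i + b * u 0 + M * (a' * w i + b' * w 0) \<and> 0 \<le> (- a) * u i + (- b) * u 0 + M * ((- a') * w i + (- b') * w 0) \<longleftrightarrow>
    a * u i + b * u 0 + M * (a' * w i + b' * w 0) = 0"
    by (auto simp: algebra_simps)
  then show ?thesis unfolding lin_eq_def by (simp add: lf_sum[OF assms])
qed

lemma op_cons_sat:
  assumes "i < d"
  shows "(\<forall>(f, g)\<in>set (op_cons \<mu> p i). 0 \<le> (\<Sum>j<d. real_of_int (f j) * u j) + M * (\<Sum>j<d. real_of_int (g j) * w j)) \<longleftrightarrow>
    op_rel \<mu> p (u 0) (u i) (M * w 0) (M * w i)"
proof (cases p)
  case (Push a)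
  show ?thesis unfolding Push op_cons.simps lin_eq_sat[OF assms] by (auto simp: algebra_simps)
next
  case (Pop a)
  show ?thesis unfolding Pop op_cons.simps lin_eq_sat[OF assms] by (auto simp: algebra_simps)
next
  case Keep
  show ?thesis unfolding Keep op_cons.simps lin_eq_sat[OF assms] by (auto simp: algebra_simps)
qed

lemma stack_cons_sat:
  "(\<forall>(f, g)\<in>set (stack_cons k (t, h, \<mu>)). 0 \<le> (\<Sum>j<k + 3. real_of_int (f j) * u j) + M * (\<Sum>j<k + 3. real_of_int (g j) * w j)) \<longleftrightarrow>
    M * w 0 = \<mu> * u 0 \<and> (\<forall>i\<in>{1..<k + 3}. u i \<le> u 0 \<and> op_rel \<mu> (op_at t h i) (u 0) (u i) (M * w 0) (M * w i))"
  (is "(\<forall>p\<in>set _. ?S p) \<longleftrightarrow> _")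
proof -
  have "(\<forall>p\<in>set (lin_eq (- \<mu>) 0 1 0 0). ?S p) \<longleftrightarrow> M * w 0 = \<mu> * u 0"
    by (subst lin_eq_sat) auto
  moreover have "(\<forall>p\<in>set ((lf (- 1) 1 i, lf 0 0 i) # op_cons \<mu> (op_at t h i) i). ?S p) \<longleftrightarrow>
    u i \<le> u 0 \<and> op_rel \<mu> (op_at t h i) (u 0) (u i) (M * w 0) (M * w i)" if "i \<in> {1..<k + 3}" for i
    using op_cons_sat[of i "k + 3" \<mu> "op_at t h i" u M w] that by (simp add: lf_sum del: One_nat_def)
  moreover have "(\<forall>p\<in>set (stack_cons k (t, h, \<mu>)). ?S p) \<longleftrightarrow> (\<forall>p\<in>set (lin_eq (- \<mu>) 0 1 0 0). ?S p) \<and>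
    (\<forall>i\<in>{1..<k + 3}. \<forall>p\<in>set ((lf (- 1) 1 i, lf 0 0 i) # op_cons \<mu> (op_at t h i) i). ?S p)"
    by (simp only: stack_cons.simps set_append set_concat set_map set_upt ball_Un ball_UN ball_simps(9))
  ultimately show ?thesis by blast
qed

text \<open>As rows grow by the non-integral factor \<open>lam\<close>, the represented vector is multiplied by 2 or 3 from
  one row to the next, chosen so that its size stays bounded.\<close>

definition stack_rules :: "('c \<times> (bool \<Rightarrow> op) \<times> (nat \<Rightarrow> op) \<times> 'c) set \<Rightarrow> ('c \<times> ((bool \<Rightarrow> op) \<times> (nat \<Rightarrow> op) \<times> int) \<times> 'c) set" where
  "stack_rules R = {(c, (t, g, \<mu>), c') | c t g \<mu> c'. (c, t, g, c') \<in> R \<and> \<mu> \<in> {2, 3}}"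

lemma finite_stack_rules: "finite R \<Longrightarrow> finite (stack_rules R)"
proof -
  assume "finite R"
  moreover have "stack_rules R = (\<lambda>((c, t, g, c'), \<mu>). (c, (t, g, \<mu>), c')) ` (R \<times> {2, 3})"
    by (force simp: stack_rules_def)
  ultimately show ?thesis by simp
qed

abbreviation stack_tiles :: "nat \<Rightarrow> int \<Rightarrow> ('c \<times> (bool \<Rightarrow> op) \<times> (nat \<Rightarrow> op) \<times> 'c) set \<Rightarrow> ('c, (bool \<Rightarrow> op) \<times> (nat \<Rightarrow> op) \<times> int) lab list set" where
  "stack_tiles k Bc R \<equiv> kari.tiles (k + 3) (stack_cons k) (stack_rules R) 4 Bc"

locale ui_hooper = hooper upush tr k n q0 Mk
  for tr :: "('m::countable \<times> mop \<times> 'm) set" and k n :: nat and q0 :: 'm and Mk :: "'m marker set"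
begin

lemma rule_ends: "(c, t, g, c') \<in> HR \<Longrightarrow> c \<noteq> c'"
  by (erule hooper_rules.cases) auto

lemma rule_Keep: "(c, t, g, c') \<in> HR \<Longrightarrow> k \<le> j \<Longrightarrow> g j = Keep"
  by (erule hooper_rules.cases) (use k_pos in \<open>auto dest!: tr_reg'\<close>)

lemma op_rel_iff:
  assumes "0 < \<mu>"
  shows "op_rel \<mu> p 1 (real_ui x) \<mu> (\<mu> * real_ui y) \<longleftrightarrow> opr p x y"
proof (cases p)
  case Keep
  then show ?thesis using assms by (auto simp: real_ui_inject)
next
  case (Push a)
  have "op_rel \<mu> p 1 (real_ui x) \<mu> (\<mu> * real_ui y) \<longleftrightarrow> \<mu> * (3 ^ Suc a * real_ui y) = \<mu> * (real_ui x + 2)"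
    unfolding Push by (simp add: algebra_simps)
  also have "\<dots> \<longleftrightarrow> 3 ^ Suc a * real_ui y = real_ui x + 2" using assms by (simp only: mult_cancel_left) auto
  also have "\<dots> \<longleftrightarrow> opr p x y" by (simp only: Push opr_simps upush_eq_iff)
  finally show ?thesis .
next
  case (Pop a)
  have "op_rel \<mu> p 1 (real_ui x) \<mu> (\<mu> * real_ui y) \<longleftrightarrow> \<mu> * (3 ^ Suc a * real_ui x) = \<mu> * (real_ui y + 2)"
    unfolding Pop by (simp add: algebra_simps)
  also have "\<dots> \<longleftrightarrow> 3 ^ Suc a * real_ui x = real_ui y + 2" using assms by (simp only: mult_cancel_left) auto
  also have "\<dots> \<longleftrightarrow> opr p x y" by (simp only: Pop opr_simps upush_eq_iff)
  finally show ?thesis .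
qed

text \<open>As coordinate 0 is 1 in every row, the unknown growth factor must equal the multiplier
  of the rule, and the other coordinates are honest stacks.\<close>

lemma tiling_imp_run:
  assumes "finite HR" "inj_on num (kari.labels (k + 3) (stack_cons k) (stack_rules HR) 4 Bc)" "tiles_plane (map num ` stack_tiles k Bc HR)"
  shows "\<exists>f. \<forall>i::nat. step (f i) (f (Suc i))"
proof -
  have "(q, b, q) \<notin> stack_rules HR" for q b using rule_ends by (auto simp: stack_rules_def)
  from kari.tiling_imp_orbit[OF finite_stack_rules[OF assms(1)] zero_less_numeral[THEN trans_less_add2] assms(2) this assms(3)]
  obtain Q b x m where "\<forall>n::nat. (Q n, b n, Q (Suc n)) \<in> stack_rules HR \<and> x n 0 = (1::real) \<and> (\<forall>i<k + 3. 0 \<le> x n i) \<and>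
    (\<forall>(f, g)\<in>set (stack_cons k (b n)). 0 \<le> (\<Sum>i<k + 3. real_of_int (f i) * x n i) + m n * (\<Sum>i<k + 3. real_of_int (g i) * x (Suc n) i))"
    by (elim exE)
  then have o: "\<And>n. (Q n, b n, Q (Suc n)) \<in> stack_rules HR" "\<And>n. x n 0 = (1::real)" "\<And>n i. i < k + 3 \<Longrightarrow> 0 \<le> x n i"
    "\<And>n. \<forall>(f, g)\<in>set (stack_cons k (b n)). 0 \<le> (\<Sum>i<k + 3. real_of_int (f i) * x n i) + m n * (\<Sum>i<k + 3. real_of_int (g i) * x (Suc n) i)"
    by blast+
  have "\<exists>t g \<mu>. b n = (t, g, \<mu>) \<and> (Q n, t, g, Q (Suc n)) \<in> HR \<and> \<mu> \<in> {2, 3}" for n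
    using o(1)[of n] by (auto simp: stack_rules_def)
  then obtain t g \<mu> where b: "\<And>n. b n = (t n, g n, \<mu> n)" "\<And>n. (Q n, t n, g n, Q (Suc n)) \<in> HR" "\<And>n. \<mu> n \<in> {2, 3}" by metis
  have \<mu>: "0 < real_of_int (\<mu> n)" for n using b(3)[of n] by auto
  have sat: "m n = \<mu> n \<and> (\<forall>i\<in>{1..<k + 3}. x n i \<le> 1 \<and> op_rel (\<mu> n) (op_at (t n) (g n) i) 1 (x n i) (\<mu> n) (\<mu> n * x (Suc n) i))" for n
    using o(4)[of n] unfolding b(1) stack_cons_sat by (auto simp: o(2))
  define y where "y n i = ui (x n i)" for n i
  have y: "real_ui (y n i) = x n i" if "i \<in> {1..<k + 3}" for n i
    using sat[of n] o(3)[of i n] that by (auto simp: y_def intro!: ui_inverse)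
  have op: "opr (op_at (t n) (g n) i) (y n i) (y (Suc n) i)" if i: "i \<in> {1..<k + 3}" for n i
    using sat[of n] i unfolding op_rel_iff[OF \<mu>, of n, symmetric] y[OF i] by blast
  \<comment> \<open>Rules keep the counters from \<open>k\<close> on, so a constant is put
    there.\<close>
  define f where "f n = (Q n, (\<lambda>c. y n (if c then 2 else 1)), (\<lambda>j. if j < k then y n (j + 3) else ui 0))" for n
  have "step (f n) (f (Suc n))" for n
    unfolding step_def f_def prod.case
  proof (intro exI conjI allI)
    show "(Q n, t n, g n, Q (Suc n)) \<in> HR" by (rule b(2))
    show "opr (t n c) (y n (if c then 2 else 1)) (y (Suc n) (if c then 2 else 1))" for c
      using op[of 1 n] op[of 2 n] by (cases c) (simp_all add: op_at_def)
    show "opr (g n j) (if j < k then y n (j + 3) else ui 0) (if j < k then y (Suc n) (j + 3) else ui 0)" for j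
      using op[of "j + 3" n] rule_Keep[OF b(2), of j n] by (auto simp: op_at_def)
  qed
  then show ?thesis by blast
qed

text \<open>Row t carries configuration number t + r + 1. The rows from -r - 1 to r + 1 are
  involved, hence \<open>2 * r + 2\<close> steps.\<close>

lemma run_imp_surroundable:
  assumes run: "\<And>i. i < 2 * r + 2 \<Longrightarrow> step (f i) (f (Suc i))"
    and Bc: "\<And>c b c' u v. (c, b, c') \<in> stack_rules HR \<Longrightarrow> (u, v) \<in> set (stack_cons k b) \<Longrightarrow> (\<Sum>i<k + 3. \<bar>u i\<bar>) + (\<Sum>i<k + 3. \<bar>v i\<bar>) + 1 \<le> Bc"
  shows "surroundable (map num ` stack_tiles k Bc HR) r"
proof -
  have lam: "2 \<le> lam" "lam \<le> 3" using gphi by (auto simp: lam_def)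
  \<comment> \<open>Factor 2 if the scale then stays at least 1, otherwise 3. The scale remains in
    [1, 3/2], so digits are at most 2 * 3/2 + 1 = 4, the bound used in
    \<open>stack_tiles\<close>.\<close>
  define mu :: "real \<Rightarrow> int" where "mu s = (if lam \<le> 2 * s then 2 else 3)" for s
  define s where "s = rec_nat 1 (\<lambda>_ s. mu s * s / lam)"
  have s0: "s 0 = 1" and s_Suc: "lam * s (Suc i) = mu (s i) * s i" for i using lam by (auto simp: s_def)
  have s_bounds: "1 \<le> s i \<and> s i \<le> 3 / 2" for i
  proof (induction i)
    case (Suc i)
    have "lam \<le> lam * s (Suc i) \<and> lam * s (Suc i) \<le> lam * (3 / 2)"
      unfolding s_Suc using Suc lam by (auto simp: mu_def)
    then show ?case using lam by (simp only: mult_le_cancel_left_pos[of lam]) (auto simp: mult_le_cancel_left_pos)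
  qed (simp add: s0)
  have "\<exists>t g. (fst (f i), t, g, fst (f (Suc i))) \<in> HR \<and> (\<forall>b. opr (t b) (fst (snd (f i)) b) (fst (snd (f (Suc i))) b)) \<and>
    (\<forall>j. opr (g j) (snd (snd (f i)) j) (snd (snd (f (Suc i))) j))" if "i < 2 * r + 2" for i
    using run[OF that] by (cases "f i"; cases "f (Suc i)") (auto simp: step_def)
  then obtain t g where tg: "\<And>i. i < 2 * r + 2 \<Longrightarrow> (fst (f i), t i, g i, fst (f (Suc i))) \<in> HR"
    "\<And>i b. i < 2 * r + 2 \<Longrightarrow> opr (t i b) (fst (snd (f i)) b) (fst (snd (f (Suc i))) b)"
    "\<And>i j. i < 2 * r + 2 \<Longrightarrow> opr (g i j) (snd (snd (f i)) j) (snd (snd (f (Suc i))) j)" by metis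
  define y where "y i j = (if j = 1 then fst (snd (f i)) False else if j = 2 then fst (snd (f i)) True else snd (snd (f i)) (j - 3))" for i j
  define z where "z i j = (if j = 0 then 1 else real_ui (y i j))" for i and j :: nat
  have y: "opr (op_at (t i) (g i) j) (y i j) (y (Suc i) j)" if "i < 2 * r + 2" for i j
    using tg(2,3)[OF that] by (simp add: y_def op_at_def)
  have z: "0 \<le> z i j" "z i j \<le> 1" for i j by (simp_all add: z_def real_ui_bounds)
  let ?e = "\<lambda>i::int. nat (i + int r + 1)"
  define X where "X i j = s (?e i) * z (?e i) j" for i j
  define body where "body i = (t i, g i, mu (s i))" for i
  have Suc_e: "?e (i + 1) = Suc (?e i)" if "\<bar>i\<bar> \<le> int r" for i using that by (simp add: nat_add_distrib[symmetric] Suc_nat_eq_nat_zadd1 algebra_simps)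
  have e_less: "?e i < 2 * r + 2" if "\<bar>i\<bar> \<le> int r" for i using that by linarith
  have rule: "(fst (f (?e i)), body (?e i), fst (f (?e (i + 1)))) \<in> stack_rules HR" if "\<bar>i\<bar> \<le> int r" for i
    using tg(1)[OF e_less[OF that]] unfolding Suc_e[OF that] stack_rules_def body_def by (auto simp: mu_def)
  show ?thesis
  proof (rule kari.orbit_imp_surroundable[where Q = "\<lambda>i. fst (f (?e i))" and b = "\<lambda>i. body (?e i)" and X = X])
    show "1 \<le> X i 0" for i using s_bounds by (simp add: X_def z_def)
    show "0 \<le> X i j \<and> 2 * X i j + 1 \<le> real 4" for i j
    proof -
      have "0 \<le> X i j" "X i j \<le> 3 / 2 * 1" unfolding X_def using s_bounds[of "?e i"] z[of "?e i" j]
        by (intro mult_nonneg_nonneg mult_mono; simp)+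
      then show ?thesis by simp
    qed
    fix i u v assume i: "\<bar>i\<bar> \<le> int r" and uv: "(u, v) \<in> set (stack_cons k (body (?e i)))"
    let ?i = "?e i"
    have mu: "0 < real_of_int (mu (s ?i))" by (simp add: mu_def)
    have sat: "\<forall>(u, v)\<in>set (stack_cons k (body ?i)). 0 \<le> (\<Sum>j<k + 3. real_of_int (u j) * z ?i j) + mu (s ?i) * (\<Sum>j<k + 3. real_of_int (v j) * z (Suc ?i) j)"
      unfolding body_def stack_cons_sat
      using y[OF e_less[OF i]] z(2)[of ?i] by (auto simp: z_def op_rel_iff[OF mu] real_ui_bounds)
    have "0 \<le> s ?i * ((\<Sum>j<k + 3. real_of_int (u j) * z ?i j) + mu (s ?i) * (\<Sum>j<k + 3. real_of_int (v j) * z (Suc ?i) j))"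
      using sat uv s_bounds[of ?i] by (intro mult_nonneg_nonneg) auto
    also have "\<dots> = (\<Sum>j<k + 3. real_of_int (u j) * X i j) + mu (s ?i) * s ?i * (\<Sum>j<k + 3. real_of_int (v j) * z (Suc ?i) j)"
      by (simp add: X_def sum_distrib_left algebra_simps)
    also have "mu (s ?i) * s ?i * (\<Sum>j<k + 3. real_of_int (v j) * z (Suc ?i) j) = lam * (\<Sum>j<k + 3. real_of_int (v j) * X (i + 1) j)"
      unfolding s_Suc[symmetric] X_def Suc_e[OF i] by (simp add: sum_distrib_left algebra_simps)
    finally show "0 \<le> (\<Sum>j<k + 3. real_of_int (u j) * X i j) + lam * (\<Sum>j<k + 3. real_of_int (v j) * X (i + 1) j)" .
    show "(\<Sum>j<k + 3. \<bar>u j\<bar>) + (\<Sum>j<k + 3. \<bar>v j\<bar>) + 1 \<le> Bc" using Bc[OF rule[OF i] uv] .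
  qed (use rule in auto)
qed

end

lemma finite_hooper_rules:
  fixes tr :: "('m::countable \<times> mop \<times> 'm) set"
  assumes "finite tr" "finite Mk"
  shows "finite (hooper_rules tr k n q0 Mk)"
proof -
  let ?K = "\<lambda>_::nat. Keep" and ?T = "\<lambda>_::bool. Keep"
  let ?tr = "\<lambda>(q, u, q') d. case u of
      MInc j \<Rightarrow> {(F q d, tp d (Pop 0) Keep, ?K(j := Push 0), Cal (MF q') d)}
    | MDec j \<Rightarrow> {(F q d, tp d (Pop 0) Keep, ?K(j := Pop 0), Cal (MF q') d)}
    | MZero j \<Rightarrow> {(F q d, tp d (Pop 0) Keep, ?K(j := Pop 1), Z j q' d), (Z j q' d, ?T, ?K(j := Push 1), Cal (MF q') d)}"
  let ?load = "\<lambda>i d. {(FL (Suc i) d, tp d (Pop 0) (Push 0), ?K(0 := Push 0), FL i d)}"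
  let ?mark = "\<lambda>i m d. {(FL i d, tp d (Pop (mdig m)) Keep, ?K, E m d), (E m d, tp d (Push (mdig m)) Keep, ?K, B d),
    (Cal m d, tp d (Push (mdig m)) Keep, all_counters k (Push 1), FL i (\<not> d))}"
  let ?marks = "\<lambda>m m' d. case m' of MB \<Rightarrow> {} | MF q \<Rightarrow>
     {(F q d, tp d (Pop (mdig m)) Keep, ?K, E m d), (B d, tp d (Push 0) (Pop (mdig (MF q))), all_counters k (Pop 1), F q (\<not> d))}"
  let ?d = "\<lambda>d. {(FL 0 d, ?T, ?K, F q0 d), (B d, tp d Keep (Pop 1), all_counters k (Pop 1), RB (\<not> d)), (RB d, tp d (Push 0) Keep, ?K, B d)}"
  let ?walk = "\<lambda>J d. {(B d, tp d Keep (Pop 0), \<lambda>j. if j \<in> J then Pop 0 else Keep, Cal MB d)}"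
  define S1 where "S1 = (\<Union>d\<in>UNIV. \<Union>\<rho>\<in>tr. ?tr \<rho> d)"
  define S2 :: "('m ctl \<times> (bool \<Rightarrow> op) \<times> (nat \<Rightarrow> op) \<times> 'm ctl) set" where "S2 = (\<Union>d\<in>UNIV. \<Union>i\<in>{..n}. ?load i d)"
  define S3 :: "('m ctl \<times> (bool \<Rightarrow> op) \<times> (nat \<Rightarrow> op) \<times> 'm ctl) set" where "S3 = (\<Union>d\<in>UNIV. \<Union>i\<in>{..n}. \<Union>m\<in>Mk. ?mark i m d)"
  define S4 :: "('m ctl \<times> (bool \<Rightarrow> op) \<times> (nat \<Rightarrow> op) \<times> 'm ctl) set" where "S4 = (\<Union>d\<in>UNIV. \<Union>m\<in>Mk. \<Union>m'\<in>Mk. ?marks m m' d)"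
  define S5 :: "('m ctl \<times> (bool \<Rightarrow> op) \<times> (nat \<Rightarrow> op) \<times> 'm ctl) set" where "S5 = (\<Union>d\<in>UNIV. ?d d)"
  define S6 :: "('m ctl \<times> (bool \<Rightarrow> op) \<times> (nat \<Rightarrow> op) \<times> 'm ctl) set" where "S6 = (\<Union>d\<in>UNIV. \<Union>J\<in>Pow {..<k}. ?walk J d)"
  note S_defs = S1_def S2_def S3_def S4_def S5_def S6_def
  let ?S = "S1 \<union> S2 \<union> S3 \<union> S4 \<union> S5 \<union> S6"
  have fin: "finite ?S"
    unfolding S_defs using assms by (intro finite_UN_I finite_UnI) (auto split: mop.split marker.split)
  have mem: "(c, t, g, c') \<in> ?S" if "(c, t, g, c') \<in> hooper_rules tr k n q0 Mk" for c t g c'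
  proof -
    have S: "y \<in> ?tr r d \<Longrightarrow> r \<in> tr \<Longrightarrow> y \<in> S1" "y \<in> ?load i d \<Longrightarrow> i \<le> n \<Longrightarrow> y \<in> S2"
      "y \<in> ?mark i m d \<Longrightarrow> i \<le> n \<Longrightarrow> m \<in> Mk \<Longrightarrow> y \<in> S3" "y \<in> ?marks m m' d \<Longrightarrow> m \<in> Mk \<Longrightarrow> m' \<in> Mk \<Longrightarrow> y \<in> S4"
      "y \<in> ?d d \<Longrightarrow> y \<in> S5" "y \<in> ?walk J d \<Longrightarrow> J \<subseteq> {..<k} \<Longrightarrow> y \<in> S6" for y r d i m m' J
      unfolding S_defs by (rule UN_I UNIV_I | assumption | simp)+
    show ?thesis using that
    proof cases
      case (inc q j q' d)
      then show ?thesis using S(1)[of _ "(q, MInc j, q')" d] by simp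
    next
      case (dec q j q' d)
      then show ?thesis using S(1)[of _ "(q, MDec j, q')" d] by simp
    next
      case (zero q j q' d)
      then show ?thesis using S(1)[of _ "(q, MZero j, q')" d] by simp
    next
      case (zero2 q j q' d)
      then show ?thesis using S(1)[of _ "(q, MZero j, q')" d] by simp
    next
      case (retF q d)
      then show ?thesis using S(4)[of _ d "MF q" "MF q"] by simp
    next
      case (fuel_end q m d)
      then show ?thesis using S(4)[of _ d m "MF q"] by simp
    next
      case (turn m d)
      then show ?thesis using S(3)[of _ 0 d m] by simp
    next
      case (load_end i m d)
      then show ?thesis using S(3)[of _ i d m] by simp
    next
      case (call i m d)
      then show ?thesis using S(3)[of _ i d m] by simp
    next
      case (load i d)
      then show ?thesis using S(2)[of _ i d] by simp
    next
      case (walk J d)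
      then show ?thesis using S(6)[of _ d J] by simp
    next
      case (load_exit d)
      then show ?thesis using S(5)[of _ d] by simp
    next
      case (retB d)
      then show ?thesis using S(5)[of _ d] by simp
    next
      case (rewind d)
      then show ?thesis using S(5)[of _ d] by simp
    qed
  qed
  show ?thesis
  proof (rule finite_subset[OF _ fin], rule subsetI)
    fix x assume "x \<in> hooper_rules tr k n q0 Mk"
    moreover obtain c t g c' where "x = (c, t, g, c')" by (cases x)
    ultimately show "x \<in> ?S" using mem[of c t g c'] by metis
  qed
qed

section \<open>The control states as instances of finitely many templates\<close>

fun idx :: "'m ctl \<Rightarrow> nat" where "idx (FL i d) = i" | "idx _ = 0"
fun strip :: "'m ctl \<Rightarrow> 'm ctl" where "strip (FL i d) = FL 0 d" | "strip c = c"
text \<open>In a template the indices 0, 1, 2 stand for 0, \<open>i\<close> and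
  \<open>i + 1\<close>.\<close>

fun inst :: "nat \<Rightarrow> 'm ctl \<Rightarrow> 'm ctl" where "inst i (FL (Suc a) d) = FL (a + i) d" | "inst i c = c"
fun idx_const :: "'m ctl \<Rightarrow> nat" where "idx_const (FL (Suc a) d) = a" | "idx_const _ = 0"
fun idx_coeff :: "'m ctl \<Rightarrow> nat" where "idx_coeff (FL (Suc a) d) = 1" | "idx_coeff _ = 0"

lemma idx_inst: "idx (inst i c) = idx_const c + idx_coeff c * i"
  by (cases "(i, c)" rule: inst.cases) auto

lemma strip_inst [simp]: "strip (inst i c) = strip c"
  by (cases "(i, c)" rule: inst.cases) auto

lemma strip_idx_eq: "strip c = strip c' \<Longrightarrow> idx c = idx c' \<Longrightarrow> c = c'"
  by (cases c; cases c') auto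

text \<open>The rules for bound 1 contain all templates. The excluded loading rule would turn into a
  jump from \<open>FL i\<close> to \<open>FL 0\<close>; it reappears as instance 0 of the rule from
  index 2 to index 1.\<close>

definition hooper_templates :: "('m::countable \<times> mop \<times> 'm) set \<Rightarrow> nat \<Rightarrow> 'm \<Rightarrow> 'm marker set \<Rightarrow> ('m ctl \<times> (bool \<Rightarrow> op) \<times> (nat \<Rightarrow> op) \<times> 'm ctl) set" where
  "hooper_templates tr k q0 Mk = {(c, t, g, c') \<in> hooper_rules tr k 1 q0 Mk. \<not> (\<exists>d. c = FL 1 d \<and> c' = FL 0 d)}"

lemma inst_simps [simp]: "inst i (FL 0 d) = FL 0 d" "inst i (FL (Suc 0) d) = FL i d" "inst i (FL (Suc (Suc 0)) d) = FL (Suc i) d"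
  by auto

text \<open>This is why calls admit every input up to \<open>n\<close>: the rules are exactly the
  instances 0 to \<open>n\<close> of a fixed finite set.\<close>

lemma hooper_rules_inst:
  "hooper_rules tr k n q0 Mk = (\<Union>i\<in>{..n}. (\<lambda>(c, t, g, c'). (inst i c, t, g, inst i c')) ` hooper_templates tr k q0 Mk)"
  (is "?R = ?S")
proof
  have S: "(inst i c, t, g, inst i c') \<in> ?S"
    if "i \<le> n" "(c, t, g, c') \<in> hooper_rules tr k 1 q0 Mk" "\<And>d. c \<noteq> FL 1 d \<or> c' \<noteq> FL 0 d" for i c t g c'
  proof (rule UN_I)
    have "(c, t, g, c') \<in> hooper_templates tr k q0 Mk" using that(2,3) by (auto simp: hooper_templates_def)
    then show "(inst i c, t, g, inst i c') \<in> (\<lambda>(c, t, g, c'). (inst i c, t, g, inst i c')) ` hooper_templates tr k q0 Mk"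
      by (rule image_eqI[rotated]) simp
  qed (use that(1) in simp)
  note rl = hooper_rules.intros[where n = 1 and k = k and tr = tr and ?q0.0 = q0 and Mk = Mk]
  show "?R \<subseteq> ?S"
  proof
    fix x assume "x \<in> ?R"
    moreover obtain c t g c' where x: "x = (c, t, g, c')" by (cases x)
    ultimately have "(c, t, g, c') \<in> ?R" by simp
    then show "x \<in> ?S"
    proof cases
      case (load i d)
      with S[OF _ rl(1)[of 1], of i] show ?thesis by (simp add: x)
    next
      case (load_end i m d)
      with S[OF _ rl(2)[of 1 m], of i] show ?thesis by (simp add: x)
    next
      case (load_exit d)
      with S[OF _ rl(3), of 0] show ?thesis by (simp add: x)
    next
      case (inc q j q' d)
      with S[OF _ rl(4)[of q j q'], of 0] show ?thesis by (simp add: x)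
    next
      case (dec q j q' d)
      with S[OF _ rl(5)[of q j q'], of 0] show ?thesis by (simp add: x)
    next
      case (zero q j q' d)
      with S[OF _ rl(6)[of q j q'], of 0] show ?thesis by (simp add: x)
    next
      case (zero2 q j q' d)
      with S[OF _ rl(7)[of q j q'], of 0] show ?thesis by (simp add: x)
    next
      case (call i m d)
      with S[OF _ rl(8)[of 1 m], of i] show ?thesis by (simp add: x)
    next
      case (fuel_end q m d)
      with S[OF _ rl(9)[of q m], of 0] show ?thesis by (simp add: x)
    next
      case (turn m d)
      with S[OF _ rl(10)[of m], of 0] show ?thesis by (simp add: x)
    next
      case (walk J d)
      with S[OF _ rl(11)[of J], of 0] show ?thesis by (simp add: x)
    next
      case (retF q d)
      with S[OF _ rl(12)[of q], of 0] show ?thesis by (simp add: x)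
    next
      case (retB d)
      with S[OF _ rl(13), of 0] show ?thesis by (simp add: x)
    next
      case (rewind d)
      with S[OF _ rl(14), of 0] show ?thesis by (simp add: x)
    qed
  qed
  have "(inst i c, t, g, inst i c') \<in> ?R"
    if i: "i \<le> n" and T: "(c, t, g, c') \<in> hooper_rules tr k 1 q0 Mk" and L: "\<And>d. c = FL 1 d \<Longrightarrow> c' \<noteq> FL 0 d" for i c t g c'
    using T
  proof cases
    case (load j d)
    then have "j = 1" using L by (cases j) auto
    then show ?thesis using load i by (auto intro: hooper_rules.load)
  next
    case (load_end j m d)
    then show ?thesis using i by (cases j) (auto intro: hooper_rules.load_end)
  next
    case (call j m d)
    then show ?thesis using i by (cases j) (auto intro: hooper_rules.call)
  next
    case (retF q d)
    then show ?thesis using hooper_rules.retF[of q Mk d k tr n q0] by simp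
  next
    case (retB d)
    then show ?thesis using hooper_rules.retB[of d k tr n q0 Mk] by simp
  qed (auto intro: hooper_rules.intros[unfolded One_nat_def])
  then show "?S \<subseteq> ?R" unfolding hooper_templates_def by auto
qed

lemma hooper_load_ends:
  "(FL i d, t, g, FL j d') \<in> hooper_rules tr k n q0 Mk \<Longrightarrow> i = Suc j"
  by (erule hooper_rules.cases) auto

text \<open>The number of a horizontal label shows only the sum of the two indices. It determines
  both, since two loading states in one rule differ by one.\<close>

lemma hooper_rule_determined:
  assumes "(c1, t1, g1, c1') \<in> hooper_rules tr k n q0 Mk" "(c2, t2, g2, c2') \<in> hooper_rules tr k n q0 Mk"
    "strip c1 = strip c2" "strip c1' = strip c2'" "idx c1 + idx c1' = idx c2 + idx c2'"
  shows "c1 = c2 \<and> c1' = c2'"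
proof (cases "(\<exists>i d. c1 = FL i d) \<and> (\<exists>i d. c1' = FL i d)")
  case True
  then obtain i d j d' where c1: "c1 = FL i d" "c1' = FL j d'" by auto
  then obtain i' j' where c2: "c2 = FL i' d" "c2' = FL j' d'" using assms(3,4) by (cases c2; cases c2') auto
  have "i = Suc j" "i' = Suc j'" using assms(1,2) hooper_load_ends unfolding c1 c2 by blast+
  then show ?thesis using assms(5) c1 c2 by simp
next
  case False
  have nFL: "idx c = 0 \<and> idx c' = 0" if "\<not> (\<exists>i d. c = FL i d)" "strip c = strip c'" for c c' :: "'a ctl"
    using that by (cases c; cases c') auto
  have "idx c1 = idx c2 \<and> idx c1' = idx c2'" using False nFL[of c1 c2] nFL[of c1' c2'] assms(3-5) by auto
  then show ?thesis using assms(3,4) strip_idx_eq by blast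
qed

section \<open>Numbering the labels\<close>

abbreviation map_ends :: "('c \<Rightarrow> 'd) \<Rightarrow> ('c, 'b) lab \<Rightarrow> ('d, 'b) lab" where
  "map_ends h \<equiv> map_lab h (\<lambda>b. b)"

lemma map_tile: "map (map_ends h) (tile r q b q' v ws cL cR) = tile r (h q) b (h q') v ws cL cR"
  by (simp add: tile_def)

text \<open>Admissibility of a tile depends on its states through the rule alone.\<close>

lemma tiles_map_ends:
  "kari.tiles d cons ((\<lambda>(q, b, q'). (h q, b, h q')) ` R) Bv Bc = map (map_ends h) ` kari.tiles d cons R Bv Bc"
proof
  show "kari.tiles d cons ((\<lambda>(q, b, q'). (h q, b, h q')) ` R) Bv Bc \<subseteq> map (map_ends h) ` kari.tiles d cons R Bv Bc"
  proof
    fix \<tau> assume "\<tau> \<in> kari.tiles d cons ((\<lambda>(q, b, q'). (h q, b, h q')) ` R) Bv Bc"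
    then show "\<tau> \<in> map (map_ends h) ` kari.tiles d cons R Bv Bc"
    proof (rule kari.tilesE)
      fix r q b q' v ws cL cR
      assume t: "\<tau> = tile r q b q' v ws cL cR" "(q, b, q') \<in> (\<lambda>(q, b, q'). (h q, b, h q')) ` R" and
        o: "r \<noteq> PR" "kari.okv d Bv v" "length ws = nkids r" "\<forall>w\<in>set ws. kari.okv d Bv w" "kari.okc cons Bc b cL" "kari.okc cons Bc b cR"
        "kari.balanced d cons b v ws cL cR"
      from t(2) obtain p p' where p: "(p, b, p') \<in> R" "q = h p" "q' = h p'" by auto
      have "\<tau> = map (map_ends h) (tile r p b p' v ws cL cR)" unfolding map_tile t(1) p(2,3) ..
      moreover have "tile r p b p' v ws cL cR \<in> kari.tiles d cons R Bv Bc" unfolding kari.tiles_def using p(1) o by blast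
      ultimately show ?thesis by blast
    qed
  qed
  show "map (map_ends h) ` kari.tiles d cons R Bv Bc \<subseteq> kari.tiles d cons ((\<lambda>(q, b, q'). (h q, b, h q')) ` R) Bv Bc"
  proof (rule image_subsetI)
    fix \<tau> assume "\<tau> \<in> kari.tiles d cons R Bv Bc"
    then show "map (map_ends h) \<tau> \<in> kari.tiles d cons ((\<lambda>(q, b, q'). (h q, b, h q')) ` R) Bv Bc"
    proof (rule kari.tilesE)
      fix r q b q' v ws cL cR
      assume t: "\<tau> = tile r q b q' v ws cL cR" "(q, b, q') \<in> R" and
        o: "r \<noteq> PR" "kari.okv d Bv v" "length ws = nkids r" "\<forall>w\<in>set ws. kari.okv d Bv w" "kari.okc cons Bc b cL" "kari.okc cons Bc b cR"
        "kari.balanced d cons b v ws cL cR"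
      have "(h q, b, h q') \<in> (\<lambda>(q, b, q'). (h q, b, h q')) ` R" using t(2) by force
      then show ?thesis unfolding t(1) map_tile kari.tiles_def using o by blast
    qed
  qed
qed

lemma tiles_UN: "kari.tiles d cons (\<Union>i\<in>I. R i) Bv Bc = (\<Union>i\<in>I. kari.tiles d cons (R i) Bv Bc)"
proof -
  have mem: "\<tau> \<in> kari.tiles d cons R' Bv Bc \<longleftrightarrow> (\<exists>(q, b, q')\<in>R'. \<exists>r v ws cL cR. \<tau> = tile r q b q' v ws cL cR \<and> r \<noteq> PR \<and> kari.okv d Bv v \<and>
     length ws = nkids r \<and> (\<forall>w\<in>set ws. kari.okv d Bv w) \<and> kari.okc cons Bc b cL \<and> kari.okc cons Bc b cR \<and> kari.balanced d cons b v ws cL cR)"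
    (is "_ \<longleftrightarrow> (\<exists>\<rho>\<in>R'. ?P \<tau> \<rho>)") for \<tau> R'
    unfolding kari.tiles_def by blast
  show ?thesis by (intro set_eqI) (simp only: mem UN_iff bex_UN)
qed

lemma finite_tiles:
  assumes "finite R"
  shows "finite (kari.tiles d cons R Bv Bc)"
proof -
  define V where "V = {v. set v \<subseteq> {..Bv} \<and> length v = d}"
  define C where "C = (\<Union>(_, b, _)\<in>R. {c. set c \<subseteq> {- Bc..Bc} \<and> length c = length (cons b)})"
  let ?D = "{P1, P2, P3, PL, PR} \<times> R \<times> V \<times> {ws. set ws \<subseteq> V \<and> length ws \<le> 4} \<times> C \<times> C"
  have inV: "v \<in> V" if "kari.okv d Bv v" for v
    using that unfolding kari.okv_def V_def by (auto simp: in_set_conv_nth)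
  have inC: "c \<in> C" if "kari.okc cons Bc b c" "(q, b, q') \<in> R" for b c q q'
  proof -
    have "x \<in> {- Bc..Bc}" if "x \<in> set c" for x
    proof -
      have "\<bar>x\<bar> \<le> Bc" using that \<open>kari.okc cons Bc b c\<close> unfolding kari.okc_def in_set_conv_nth by metis
      then show ?thesis by simp linarith
    qed
    then have "set c \<subseteq> {- Bc..Bc}" by (rule subsetI)
    moreover have "length c = length (cons b)" using that unfolding kari.okc_def by simp
    ultimately show ?thesis using that(2) unfolding C_def by blast
  qed
  have sub: "kari.tiles d cons R Bv Bc \<subseteq> (\<lambda>(r, (q, b, q'), v, ws, cL, cR). tile r q b q' v ws cL cR) ` ?D"
  proof
    fix \<tau> assume "\<tau> \<in> kari.tiles d cons R Bv Bc"
    then show "\<tau> \<in> (\<lambda>(r, (q, b, q'), v, ws, cL, cR). tile r q b q' v ws cL cR) ` ?D"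
    proof (rule kari.tilesE)
      fix r q b q' v ws cL cR
      assume t: "\<tau> = tile r q b q' v ws cL cR" and q: "(q, b, q') \<in> R" and o: "kari.okv d Bv v" "length ws = nkids r" "\<forall>w\<in>set ws. kari.okv d Bv w" "kari.okc cons Bc b cL" "kari.okc cons Bc b cR"
      have "r \<in> {P1, P2, P3, PL, PR}" by (cases r) auto
      moreover have "length ws \<le> 4" using o(2) by (simp add: nkids_def)
      moreover have "set ws \<subseteq> V" using o(3) inV by blast
      ultimately have "(r, (q, b, q'), v, ws, cL, cR) \<in> ?D" using q inV[OF o(1)] inC[OF o(4) q] inC[OF o(5) q] by simp
      then show ?thesis unfolding t by (rule image_eqI[rotated]) simp
    qed
  qed
  have fin: "finite V" "finite C"
    unfolding V_def C_def by (rule finite_lists_length_eq, simp) (rule finite_UN_I[OF assms], clarsimp, rule finite_lists_length_eq, simp)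
  have "finite ?D"
    by (intro finite_cartesian_product assms fin finite_lists_length_le) simp
  then show ?thesis by (rule finite_subset[OF sub finite_imageI])
qed

fun end_sum :: "('c \<Rightarrow> nat) \<Rightarrow> ('c, 'b) lab \<Rightarrow> nat" where
  "end_sum w (H _ q b q' _) = w q + w q'"
| "end_sum w (V _ q _) = w q"

text \<open>Affine in the parameter on instances of a template, and decodable when codes are below
  \<open>K\<close>: the remainder gives the label without indices, the quotient the sum of its
  indices.\<close>

definition number :: "(('m ctl, 'b) lab \<Rightarrow> nat) \<Rightarrow> nat \<Rightarrow> ('m ctl, 'b) lab \<Rightarrow> nat" where
  "number code K l = code (map_ends strip l) + K * end_sum idx l"

definition template_row :: "(('m ctl, 'b) lab \<Rightarrow> nat) \<Rightarrow> nat \<Rightarrow> ('m ctl, 'b) lab list \<Rightarrow> nat list" where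
  "template_row code K \<tau> = concat (map (\<lambda>l. [code (map_ends strip l) + K * end_sum idx_const l, K * end_sum idx_coeff l]) \<tau>)"

lemma strip_inst_lab: "map_ends strip (map_ends (inst i) l) = map_ends strip l"
  by (cases l) auto

lemma number_inst:
  "number code K (map_ends (inst i) l) = code (map_ends strip l) + K * end_sum idx_const l + K * end_sum idx_coeff l * i"
proof -
  have "end_sum idx (map_ends (inst i) l) = end_sum idx_const l + end_sum idx_coeff l * i"
    by (cases l) (auto simp: idx_inst algebra_simps)
  then show ?thesis by (simp add: number_def strip_inst_lab algebra_simps)
qed

lemma instance_of_template_row:
  assumes "length \<tau> = 7"
  shows "instance_of (template_row code K \<tau>) i = map (number code K) (map (map_ends (inst i)) \<tau>)"
proof -
  obtain a0 a1 a2 a3 a4 a5 a6 where "\<tau> = [a0, a1, a2, a3, a4, a5, a6]"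
    using assms by (auto simp: numeral_eq_Suc length_Suc_conv)
  then show ?thesis
    by (simp add: instance_of_def template_row_def number_inst numeral_eq_Suc)
qed

lemma length_template_row: "length (template_row code K \<tau>) = 2 * length \<tau>"
  unfolding template_row_def by (induction \<tau>) auto

lemma number_eqD:
  assumes "inj_on code A" "code ` A \<subseteq> {..<K}" "map_ends strip l \<in> A" "map_ends strip l' \<in> A" "number code K l = number code K l'"
  shows "map_ends strip l = map_ends strip l' \<and> end_sum idx l = end_sum idx l'"
proof -
  have b: "code (map_ends strip l) < K" "code (map_ends strip l') < K" using assms(2-4) by auto
  have "code (map_ends strip l) = number code K l mod K" using b by (simp add: number_def)
  also have "\<dots> = code (map_ends strip l')" unfolding assms(5) using b by (simp add: number_def)
  finally have "code (map_ends strip l) = code (map_ends strip l')" .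
  then show ?thesis using assms b by (auto simp: number_def dest: inj_onD)
qed

section \<open>The tile sets of a program and the diagonal argument\<close>

lemma stack_rules_inst:
  "stack_rules (hooper_rules tr k n q0 Mk) =
    (\<Union>i\<in>{..n}. (\<lambda>(q, b, q'). (inst i q, b, inst i q')) ` stack_rules (hooper_templates tr k q0 Mk))"
proof -
  have U: "stack_rules (\<Union>i\<in>I. R i) = (\<Union>i\<in>I. stack_rules (R i))" for I :: "nat set" and R :: "nat \<Rightarrow> ('a ctl \<times> (bool \<Rightarrow> op) \<times> (nat \<Rightarrow> op) \<times> 'a ctl) set"
    unfolding stack_rules_def by blast
  have I: "stack_rules ((\<lambda>(c, t, g, c'). (h c, t, g, h c')) ` R) = (\<lambda>(q, b, q'). (h q, b, h q')) ` stack_rules R"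
    for h and R :: "('a ctl \<times> (bool \<Rightarrow> op) \<times> (nat \<Rightarrow> op) \<times> 'a ctl) set"
  proof
    show "stack_rules ((\<lambda>(c, t, g, c'). (h c, t, g, h c')) ` R) \<subseteq> (\<lambda>(q, b, q'). (h q, b, h q')) ` stack_rules R"
    proof
      fix x assume "x \<in> stack_rules ((\<lambda>(c, t, g, c'). (h c, t, g, h c')) ` R)"
      then obtain c t g c' \<mu> where x: "x = (h c, (t, g, \<mu>), h c')" "(c, t, g, c') \<in> R" "\<mu> = 2 \<or> \<mu> = 3"
        unfolding stack_rules_def by auto
      then have "(c, (t, g, \<mu>), c') \<in> stack_rules R" unfolding stack_rules_def by auto
      then show "x \<in> (\<lambda>(q, b, q'). (h q, b, h q')) ` stack_rules R" unfolding x(1) by (rule image_eqI[rotated]) simp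
    qed
    show "(\<lambda>(q, b, q'). (h q, b, h q')) ` stack_rules R \<subseteq> stack_rules ((\<lambda>(c, t, g, c'). (h c, t, g, h c')) ` R)"
    proof
      fix x assume "x \<in> (\<lambda>(q, b, q'). (h q, b, h q')) ` stack_rules R"
      then obtain c t g c' \<mu> where x: "x = (h c, (t, g, \<mu>), h c')" "(c, t, g, c') \<in> R" "\<mu> = 2 \<or> \<mu> = 3"
        unfolding stack_rules_def by auto
      then have "(h c, t, g, h c') \<in> (\<lambda>(c, t, g, c'). (h c, t, g, h c')) ` R" by (rule_tac image_eqI[rotated]) auto
      with x show "x \<in> stack_rules ((\<lambda>(c, t, g, c'). (h c, t, g, h c')) ` R)" unfolding stack_rules_def by blast
    qed
  qed
  show ?thesis by (simp only: hooper_rules_inst[of tr k n] U I)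
qed

lemma hooper_tiles:
  "stack_tiles k Bc (hooper_rules tr k n q0 Mk) = (\<Union>i\<in>{..n}. map (map_ends (inst i)) ` stack_tiles k Bc (hooper_templates tr k q0 Mk))"
  by (simp only: stack_rules_inst tiles_UN tiles_map_ends)

lemma set_instances_templates:
  assumes "set T = template_row code K ` stack_tiles k Bc (hooper_templates tr k q0 Mk)"
  shows "set (all_instances T (Suc n)) = map (number code K) ` stack_tiles k Bc (hooper_rules tr k n q0 Mk)"
proof -
  let ?B = "stack_tiles k Bc (hooper_templates tr k q0 Mk)"
  have i: "instance_of (template_row code K \<tau>) i = map (number code K) (map (map_ends (inst i)) \<tau>)" if "\<tau> \<in> ?B" for \<tau> i
    by (rule instance_of_template_row) (rule kari.length_tiles[OF that])
  have "set (all_instances T (Suc n)) = (\<Union>i\<in>{..n}. (\<lambda>\<tau>. instance_of (template_row code K \<tau>) i) ` ?B)"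
    unfolding set_all_instances assms less_Suc_eq_le by blast
  also have "\<dots> = (\<Union>i\<in>{..n}. (\<lambda>\<tau>. map (number code K) (map (map_ends (inst i)) \<tau>)) ` ?B)"
    by (intro SUP_cong image_cong refl i)
  also have "\<dots> = map (number code K) ` (\<Union>i\<in>{..n}. map (map_ends (inst i)) ` ?B)"
    by (simp only: image_UN image_image)
  finally show ?thesis unfolding hooper_tiles .
qed

lemma H_label_rule: "H h q b q' c \<in> kari.labels d cons R Bv Bc \<Longrightarrow> (q, b, q') \<in> R"
  unfolding kari.labels_def by (auto elim!: kari.tilesE simp: tile_def split: if_splits)

lemma inj_on_number:
  assumes code: "inj_on code A" "code ` A \<subseteq> {..<K}" and A: "A = map_ends strip ` \<Union> (set ` stack_tiles k Bc (hooper_templates tr k q0 Mk))"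
  shows "inj_on (number code K) (kari.labels (k + 3) (stack_cons k) (stack_rules (hooper_rules tr k n q0 Mk)) 4 Bc)"
proof (rule inj_onI)
  let ?L = "kari.labels (k + 3) (stack_cons k) (stack_rules (hooper_rules tr k n q0 Mk)) 4 Bc"
  have strip: "map_ends strip l \<in> A" if "l \<in> ?L" for l
  proof -
    from that obtain i \<tau> l' where "\<tau> \<in> stack_tiles k Bc (hooper_templates tr k q0 Mk)" "l' \<in> set \<tau>" "l = map_ends (inst i) l'"
      unfolding kari.labels_def hooper_tiles by auto
    then show ?thesis unfolding A by (simp only: strip_inst_lab) blast
  qed
  fix l l' assume l: "l \<in> ?L" "l' \<in> ?L" "number code K l = number code K l'"
  from number_eqD[OF code strip[OF l(1)] strip[OF l(2)] l(3)]
  have eq: "map_ends strip l = map_ends strip l'" "end_sum idx l = end_sum idx l'" by auto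
  show "l = l'"
  proof (cases l)
    case (H h q b q' c)
    then obtain p p' where l': "l' = H h p b p' c" "strip q = strip p" "strip q' = strip p'" using eq(1) by (cases l') auto
    obtain t g \<mu> where b: "b = (t, g, \<mu>)" by (cases b)
    have "(q, t, g, q') \<in> hooper_rules tr k n q0 Mk" "(p, t, g, p') \<in> hooper_rules tr k n q0 Mk"
      using H_label_rule[OF l(1)[unfolded H]] H_label_rule[OF l(2)[unfolded l'(1)]] by (auto simp: stack_rules_def b)
    from hooper_rule_determined[OF this l'(2,3)] show ?thesis using eq(2) H l'(1) by simp
  next
    case (V r q v)
    then show ?thesis using eq strip_idx_eq by (cases l') auto
  qed
qed

text \<open>Mortality gives the first part, long runs the second. Halting is assumed on all inputs
  because nested executions choose theirs. The templates depend on the program but not on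
  \<open>n\<close>.\<close>

theorem program_tiles:
  assumes halts: "\<And>i. \<exists>a s. (cstep ^^ a) (P, (\<lambda>_. 0)(0 := i)) ([], s)"
  shows "\<exists>T. (\<forall>t\<in>set T. length t = 14) \<and> (\<forall>n. \<not> tiles_plane (set (all_instances T (Suc n))) \<and>
    (\<forall>a s r. (cstep ^^ a) (P, (\<lambda>_. 0)(0 := n)) ([], s) \<longrightarrow> 2 * r + 2 \<le> a \<longrightarrow> surroundable (set (all_instances T (Suc n))) r))"
proof -
  let ?reg = "\<lambda>(q, m, q'). case m of MInc j \<Rightarrow> j | MDec j \<Rightarrow> j | MZero j \<Rightarrow> j"
  define k where "k = Suc (Max (insert 0 (?reg ` machine P)))"
  define Mk where "Mk = insert MB (MF ` conts P)"
  have reg: "?reg \<rho> < k" if "\<rho> \<in> machine P" for \<rho>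
    using that finite_machine[of P] unfolding k_def by (simp add: less_Suc_eq_le)
  have hooper: "ui_hooper (machine P) k P Mk"
  proof
    show "upush a x = upush b y \<longleftrightarrow> a = b \<and> x = y" for a b x y by (rule upush_inj)
    show "0 < k" by (simp add: k_def)
    show "j < k" if "(q, MInc j, q') \<in> machine P \<or> (q, MDec j, q') \<in> machine P \<or> (q, MZero j, q') \<in> machine P" for q j q'
      using that reg by fastforce
  qed (use machine_conts self_conts in \<open>auto simp: Mk_def\<close>)
  have "finite Mk" by (simp add: Mk_def finite_conts)
  note fin_rules = finite_hooper_rules[OF finite_machine[of P] this]
  let ?T = "hooper_templates (machine P) k P Mk"
  have "finite ?T" by (rule finite_subset[OF _ fin_rules[of k 1 P]]) (auto simp: hooper_templates_def)
  then have fin: "finite (stack_rules ?T)" by (rule finite_stack_rules)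
  let ?w = "\<lambda>(u, v). (\<Sum>i<k + 3. \<bar>u i\<bar>) + (\<Sum>i<k + 3. \<bar>v i :: int\<bar>) + 1"
  let ?W = "\<Union>(c, b, c')\<in>stack_rules ?T. set (stack_cons k b)"
  \<comment> \<open>One carry bound for all \<open>n\<close>: the constraints ignore the control
    states, so those of the templates are all there are.\<close>
  define Bc where "Bc = Max (insert 0 (?w ` ?W))"
  have Bc: "(\<Sum>i<k + 3. \<bar>u i\<bar>) + (\<Sum>i<k + 3. \<bar>v i\<bar>) + 1 \<le> Bc"
    if "(c, b, c') \<in> stack_rules (hooper_rules (machine P) k n P Mk)" "(u, v) \<in> set (stack_cons k b)" for n c b c' u v
  proof -
    have "finite (insert 0 (?w ` ?W))" using fin by auto
    moreover have "(u, v) \<in> ?W" using that unfolding stack_rules_inst by fastforce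
    then have "?w (u, v) \<in> insert 0 (?w ` ?W)" by blast
    ultimately show ?thesis unfolding Bc_def by (metis (no_types, lifting) Max_ge case_prod_conv)
  qed
  let ?B = "stack_tiles k Bc ?T"
  have finB: "finite ?B" by (rule finite_tiles[OF fin])
  define A where "A = map_ends strip ` \<Union> (set ` ?B)"
  have "finite A" using finB by (simp add: A_def)
  from finite_imp_inj_to_nat_seg[OF this]
  obtain code :: "(com list ctl, (bool \<Rightarrow> op) \<times> (nat \<Rightarrow> op) \<times> int) lab \<Rightarrow> nat" and K :: nat where code: "code ` A = {i. i < K}" "inj_on code A"
    by (elim exE conjE)
  from finite_list[OF finite_imageI[OF finB, of "template_row code K"]] obtain T where T: "set T = template_row code K ` ?B" by (elim exE)
  have "\<forall>t\<in>set T. length t = 14"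
  proof
    fix t assume "t \<in> set T"
    then obtain \<tau> where "\<tau> \<in> ?B" "t = template_row code K \<tau>" unfolding T by (elim imageE)
    then show "length t = 14" using kari.length_tiles[of \<tau>] by (simp add: length_template_row)
  qed
  moreover have "\<not> tiles_plane (set (all_instances T (Suc n))) \<and>
    (\<forall>a s r. (cstep ^^ a) (P, (\<lambda>_. 0)(0 := n)) ([], s) \<longrightarrow> 2 * r + 2 \<le> a \<longrightarrow> surroundable (set (all_instances T (Suc n))) r)" for n
  proof (intro conjI allI impI)
    interpret ui_hooper "machine P" k n P Mk by (rule hooper)
    note tiles = set_instances_templates[OF T, of n]
    have inj: "inj_on (number code K) (kari.labels (k + 3) (stack_cons k) (stack_rules HR) 4 Bc)"
      using inj_on_number[OF code(2) _ A_def, of K n] code(1) by auto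
    have mstep: "mstep (q, c) (q', c') \<longleftrightarrow> q \<in> conts P \<and> cstep (q, c) (q', c')" for q c q' c'
    proof
      assume "mstep (q, c) (q', c')"
      then show "q \<in> conts P \<and> cstep (q, c) (q', c')"
        by cases (auto simp: machine_def cstep_moves perform_def)
    next
      assume "q \<in> conts P \<and> cstep (q, c) (q', c')"
      then obtain m where "(q, m, q') \<in> machine P" "perform m c c'" by (auto simp: machine_def cstep_moves)
      then show "mstep (q, c) (q', c')"
        by (cases m) (auto simp: perform_def intro: mstep.intros)
    qed
    show "\<not> tiles_plane (set (all_instances T (Suc n)))"
    proof
      assume "tiles_plane (set (all_instances T (Suc n)))"
      from tiling_imp_run[OF fin_rules inj this[unfolded tiles]] obtain f where f: "\<forall>i::nat. step (f i) (f (Suc i))" by blast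
      obtain a where a: "\<And>i. \<exists>s. (cstep ^^ a i) (P, (\<lambda>_. 0)(0 := i)) ([], s)" using halts by metis
      \<comment> \<open>The largest halting time, loading included, among the inputs a call may
        choose.\<close>
      define Tm where "Tm = Max ((\<lambda>i. i + a i) ` {..n})"
      have start: "\<exists>i\<le>n. \<exists>m. e = i + m \<and> (cstep ^^ m) (P, init i) (q, c)" if "proper e q c" for e q c
        using that
      proof induction
        case (1 i)
        then show ?case by (intro exI[of _ i] conjI exI[of _ 0]) auto
      next
        case (2 e q c q' c')
        then obtain i m where "i \<le> n" "e = i + m" "(cstep ^^ m) (P, init i) (q, c)" by auto
        then show ?case using 2(2) mstep by (intro exI[of _ i] conjI exI[of _ "Suc m"]) auto
      qed
      have bound: "e \<le> Tm" if "proper e q c" for e q c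
      proof -
        obtain i m where i: "i \<le> n" "e = i + m" "(cstep ^^ m) (P, init i) (q, c)" using start[OF \<open>proper e q c\<close>] by blast
        have "m \<le> a i" using a[of i] i(3) cstep_run_bound unfolding init_def by blast
        moreover have "i + a i \<le> Tm" unfolding Tm_def using i(1) by (intro Max_ge) auto
        ultimately show ?thesis using i(2) by simp
      qed
      have "\<not> (\<forall>i. step (f i) (f (Suc i)))" by (rule no_infinite_run) (rule bound)
      with f show False by contradiction
    qed
    fix a s r assume run: "(cstep ^^ a) (P, (\<lambda>_. 0)(0 := n)) ([], s)" and r: "2 * r + 2 \<le> a"
    from run obtain x where x: "x 0 = (P, init n)" "\<forall>i<a. cstep (x i) (x (Suc i))"
      unfolding init_def by (auto simp: relpowp_fun_conv)
    have conts: "fst (x i) \<in> conts P" if "i \<le> a" for i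
      using that
    proof (induction i)
      case 0
      then show ?case by (simp add: x(1) self_conts)
    next
      case (Suc i)
      then have "cstep (x i) (x (Suc i))" "fst (x i) \<in> conts P" using x(2) by auto
      then show ?case using moves_conts by (cases "x i"; cases "x (Suc i)") (auto simp: cstep_moves)
    qed
    \<comment> \<open>The run of the program is reindexed by the fuel spent, which is
      \<open>n\<close> when loading is over.\<close>
    have "\<exists>f. \<forall>i<(n + a) - n. step (f i) (f (Suc i))"
    proof (rule long_run[where qs = "\<lambda>e. fst (x (e - n))" and cs = "\<lambda>e. snd (x (e - n))", OF _ _ _ upush_fixpoint])
      fix e assume "n \<le> e" "e < n + a"
      then show "mstep (fst (x (e - n)), snd (x (e - n))) (fst (x (Suc e - n)), snd (x (Suc e - n)))"
        unfolding mstep using x(2) conts[of "e - n"] by (simp add: Suc_diff_le less_diff_conv2)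
    qed (simp_all add: x(1))
    then obtain f where "\<forall>i<a. step (f i) (f (Suc i))" by (elim exE) simp
    then have f: "step (f i) (f (Suc i))" if "i < 2 * r + 2" for i using r that by simp
    show "surroundable (set (all_instances T (Suc n))) r"
      unfolding tiles by (rule run_imp_surroundable[where f = f]) (fact f, fact Bc)
  qed
  ultimately show ?thesis by blast
qed

lemma heesch_ge: "surroundable S r \<Longrightarrow> enat r \<le> heesch_number S"
  unfolding heesch_number_def by (intro Sup_upper) auto

theorem theorem2:
  "\<not> (\<exists>f :: nat list set \<Rightarrow> nat. computable_on_tilesets f \<and>
       (\<forall>S. finite S \<and> (\<forall>t\<in>S. prototile t) \<and> \<not> tiles_plane S \<longrightarrow>
            heesch_number S \<le> enat (f S)))"
proof
  assume "\<exists>f :: nat list set \<Rightarrow> nat. computable_on_tilesets f \<and>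
       (\<forall>S. finite S \<and> (\<forall>t\<in>S. prototile t) \<and> \<not> tiles_plane S \<longrightarrow> heesch_number S \<le> enat (f S))"
  then obtain f h where h: "computable h" "\<And>ts. \<forall>t\<in>set ts. prototile t \<Longrightarrow> h (encode_tiles ts) = f (set ts)"
    and f: "\<And>S. finite S \<Longrightarrow> \<forall>t\<in>S. prototile t \<Longrightarrow> \<not> tiles_plane S \<Longrightarrow> heesch_number S \<le> enat (f S)"
    unfolding computable_on_tilesets_def by metis
  \<comment> \<open>A running time of twice the bound plus 4 suffices for one corona more than the
    bound, as \<open>r\<close> coronas take \<open>2 * r + 2\<close> steps.\<close>
  define g where "g n = h (tileset_code n) + h (tileset_code n) + 4" for n
  have "cmp 1 (\<lambda>xs. h (tileset_code (xs ! 0)))"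
    by (intro cmp_c1[OF h(1)] cmp_c1[OF computable_tileset_code] cmp_nth) simp
  then have "computable g" unfolding computable_cmp g_def by (intro cmp_add cmp_const)
  then obtain rg where "\<And>n. eval rg [n] (g n)" unfolding computable_def by blast
  from program_for_recf[OF this] obtain P where P: "\<And>n. runs P ((\<lambda>_. 0)(0 := n)) ((\<lambda>_. 0)(0 := n, 1 := g n))" by blast
  have run: "\<exists>a. (cstep ^^ a) (P, (\<lambda>_. 0)(0 := n)) ([], (\<lambda>_. 0)(0 := n, 1 := g n))" for n
    using P[of n] unfolding runs_def by (metis append_Nil2 rtranclp_imp_relpowp)
  then obtain T where T: "\<forall>t\<in>set T. length t = 14" and
    S: "\<And>n. \<not> tiles_plane (set (all_instances T (Suc n)))"
    "\<And>n a s r. (cstep ^^ a) (P, (\<lambda>_. 0)(0 := n)) ([], s) \<Longrightarrow> 2 * r + 2 \<le> a \<Longrightarrow> surroundable (set (all_instances T (Suc n))) r"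
    using program_tiles[of P] by metis
  define n where "n = template_code T"
  let ?ts = "all_instances T (Suc n)"
  have proto: "\<forall>t\<in>set ?ts. prototile t" by (auto simp: set_all_instances instance_of_def prototile_def)
  have code: "tileset_code n = encode_tiles ?ts" using T by (intro tileset_code) (auto simp: n_def)
  obtain a where a: "(cstep ^^ a) (P, (\<lambda>_. 0)(0 := n)) ([], (\<lambda>_. 0)(0 := n, 1 := g n))" using run by blast
  \<comment> \<open>Register 1 climbs from 0 to \<open>g n\<close> by at most one per step.\<close>
  have "g n \<le> a" using cstep_growth[OF a, of 1] by simp
  moreover have "g n = 2 * (f (set ?ts) + 1) + 2" unfolding g_def code h(2)[OF proto] by simp
  ultimately have "surroundable (set ?ts) (f (set ?ts) + 1)" using S(2)[OF a] by simp
  then have "enat (f (set ?ts) + 1) \<le> heesch_number (set ?ts)" by (rule heesch_ge)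
  also have "\<dots> \<le> enat (f (set ?ts))" using proto S(1) by (intro f) auto
  finally show False by simp
qed

end
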